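(* Let $\lambda=(1^{a_1},2^{a_2})$ with $a_1,a_2\ge 2$. If $a_1=a_2=2$, then $\mathrm{Aut}(\mathrm{GT}_\lambda)\cong D_4\times\mathbb{Z}_2$. Otherwise, $\mathrm{Aut}(\mathrm{GT}_\lambda)\cong D_4\times\mathbb{Z}_2\times\mathbb{Z}_2^{\delta_{a_1,a_2}}$, where $\delta_{a_1,a_2}=1$ if $a_1=a_2$ and $0$ otherwise.
   Context: For a partition $\lambda=(\lambda_1\le\cdots\le\lambda_n)$ of positive integers, the Gelfand–Tsetlin polytope $\mathrm{GT}_\lambda$ is the set of points $(x_{i,j})_{1\le j\le i\le n}\in\mathbb{R}^{n(n+1)/2}$ with $x_{i,i}=\lambda_i$ for all $i$ and $x_{i-1,j}\le x_{i,j}\le x_{i+1,j}$, $x_{i,j-1}\le x_{i,j}\le x_{i,j+1}$ whenever the indices lie in $\{(i,j):1\le j\le i\le n\}$. The notation $(1^{a_1},2^{a_2})$ means $a_1$ copies of $1$ followed by $a_2$ copies of $2$. $\mathrm{Aut}(\mathrm{GT}_\lambda)$ denotes the combinatorial automorphism group, i.e. the group of automorphisms of the poset of faces of $\mathrm{GT}_\lambda$ ordered by inclusion. $D_4$ is the dihedral group of order $8$ and $\mathbb{Z}_2$ the cyclic group of order $2$. *)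

theory Defs
  imports
    "HOL-Analysis.Polytope"
    "HOL-Analysis.Finite_Function_Topology"
    "HOL-Algebra.Bij"
    "HOL-Algebra.Product_Groups"
begin

definition GT_index :: "nat \<Rightarrow> (nat \<times> nat) set" where
  "GT_index n = {(i, j). 1 \<le> j \<and> j \<le> i \<and> i \<le> n}"

text \<open>
  The space of real families indexed by the triangle of size \<open>n\<close> is realised, uniformly in \<open>n\<close>,
  as the subspace of the real vector space of finitely supported functions on all index pairs
  consisting of those supported in the triangle.
  Lists are indexed from 0, hence the shift in the diagonal condition.
\<close>

definition GT_polytope :: "nat list \<Rightarrow> ((nat \<times> nat) \<Rightarrow>\<^sub>0 real) set" where
  "GT_polytope lam =
    {x. Poly_Mapping.keys x \<subseteq> GT_index (length lam) \<and>
        (\<forall>i\<in>{1..length lam}. Poly_Mapping.lookup x (i, i) = real (lam ! (i - 1))) \<and>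
        (\<forall>i j. (i, j) \<in> GT_index (length lam) \<and> (i + 1, j) \<in> GT_index (length lam) \<longrightarrow>
           Poly_Mapping.lookup x (i, j) \<le> Poly_Mapping.lookup x (i + 1, j)) \<and>
        (\<forall>i j. (i, j) \<in> GT_index (length lam) \<and> (i, j + 1) \<in> GT_index (length lam) \<longrightarrow>
           Poly_Mapping.lookup x (i, j) \<le> Poly_Mapping.lookup x (i, j + 1))}"

definition inclusion_aut_group :: "'a set set \<Rightarrow> ('a set \<Rightarrow> 'a set) monoid" where
  "inclusion_aut_group \<F> =
    BijGroup \<F> \<lparr>carrier := {f \<in> Bij \<F>. \<forall>F\<in>\<F>. \<forall>G\<in>\<F>. F \<subseteq> G \<longleftrightarrow> f F \<subseteq> f G}\<rparr>"

text \<open>The empty face and the whole polytope count as faces here.\<close>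

definition combinatorial_aut_group ::
    "'a::real_vector set \<Rightarrow> ('a set \<Rightarrow> 'a set) monoid" where
  "combinatorial_aut_group P = inclusion_aut_group {F. F face_of P}"

text \<open>
  The dihedral group of order \<open>2 m\<close>: the pair \<open>(k, b)\<close> stands for the rotation by \<open>k\<close> steps,
  preceded by a fixed reflection \<open>s\<close> if \<open>b\<close> holds, so that \<open>s r = r\<^sup>-\<^sup>1 s\<close>.
\<close>

definition dihedral_group :: "nat \<Rightarrow> (int \<times> bool) monoid" where
  "dihedral_group m =
    \<lparr>carrier = {0..<int m} \<times> UNIV,
     monoid.mult = (\<lambda>(k, b) (l, c). ((if b then k - l else k + l) mod int m, b \<noteq> c)),
     one = (0, False)\<rparr>"

abbreviation Z2 :: "int monoid" where
  "Z2 \<equiv> integer_mod_group 2"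

abbreviation Z2_power :: "nat \<Rightarrow> (nat \<Rightarrow> int) monoid" where
  "Z2_power d \<equiv> product_group {..<d} (\<lambda>_. Z2)"

lemma subgroup_inclusion_aut:
  "subgroup {f \<in> Bij \<F>. \<forall>F\<in>\<F>. \<forall>G\<in>\<F>. F \<subseteq> G \<longleftrightarrow> f F \<subseteq> f G} (BijGroup \<F>)"
    (is "subgroup ?A _")
proof (rule group.subgroupI [OF group_BijGroup])
  show "?A \<subseteq> carrier (BijGroup \<F>)"
    by (auto simp: BijGroup_def)
  show "?A \<noteq> {}"
    using id_Bij [of \<F>] by force
next
  fix f assume f: "f \<in> ?A"
  then have bij: "f \<in> Bij \<F>" "bij_betw f \<F> \<F>"
    by (auto simp: Bij_def)
  let ?g = "restrict (inv_into \<F> f) \<F>"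
  have "F \<subseteq> G \<longleftrightarrow> ?g F \<subseteq> ?g G" if "F \<in> \<F>" "G \<in> \<F>" for F G
  proof -
    have "inv_into \<F> f F \<in> \<F>" "inv_into \<F> f G \<in> \<F>"
      using bij that by (simp_all add: Bij_inv_into_mem)
    moreover have "f (inv_into \<F> f F) = F" "f (inv_into \<F> f G) = G"
      using bij that by (simp_all add: bij_betw_inv_into_right)
    moreover have "\<forall>F\<in>\<F>. \<forall>G\<in>\<F>. F \<subseteq> G \<longleftrightarrow> f F \<subseteq> f G"
      using f by blast
    ultimately have "inv_into \<F> f F \<subseteq> inv_into \<F> f G \<longleftrightarrow> F \<subseteq> G"
      by presburger
    then show ?thesis
      using that by simp
  qed
  then show "inv\<^bsub>BijGroup \<F>\<^esub> f \<in> ?A"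
    using bij by (simp add: inv_BijGroup restrict_inv_into_Bij)
next
  fix f g assume "f \<in> ?A" "g \<in> ?A"
  then have fg: "f \<in> Bij \<F>" "g \<in> Bij \<F>"
    and mono: "\<forall>F\<in>\<F>. \<forall>G\<in>\<F>. F \<subseteq> G \<longleftrightarrow> f F \<subseteq> f G" "\<forall>F\<in>\<F>. \<forall>G\<in>\<F>. F \<subseteq> G \<longleftrightarrow> g F \<subseteq> g G"
    by blast+
  have "F \<subseteq> G \<longleftrightarrow> compose \<F> f g F \<subseteq> compose \<F> f g G" if "F \<in> \<F>" "G \<in> \<F>" for F G
  proof -
    have "g F \<in> \<F>" "g G \<in> \<F>"
      using Bij_imp_funcset [OF fg(2)] that by (auto intro: funcset_mem)
    then have "F \<subseteq> G \<longleftrightarrow> f (g F) \<subseteq> f (g G)"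
      by (rule trans [OF mono(2) [rule_format, OF that] mono(1) [rule_format]])
    then show ?thesis
      using that by (simp only: compose_eq)
  qed
  then have "compose \<F> f g \<in> ?A"
    using compose_Bij [OF fg] by blast
  moreover have "f \<otimes>\<^bsub>BijGroup \<F>\<^esub> g = compose \<F> f g"
    using fg by (simp add: BijGroup_def)
  ultimately show "f \<otimes>\<^bsub>BijGroup \<F>\<^esub> g \<in> ?A"
    by argo
qed

lemma group_inclusion_aut_group: "group (inclusion_aut_group \<F>)"
  unfolding inclusion_aut_group_def
  by (rule subgroup.subgroup_is_group [OF subgroup_inclusion_aut group_BijGroup])

lemma group_dihedral_group:
  assumes "m > 0"
  shows "group (dihedral_group m)"
proof (rule groupI)
  fix x assume x: "x \<in> carrier (dihedral_group m)"
  obtain k b where kb: "x = (k, b)" by (cases x)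
  show "\<exists>y\<in>carrier (dihedral_group m). y \<otimes>\<^bsub>dihedral_group m\<^esub> x = \<one>\<^bsub>dihedral_group m\<^esub>"
  proof (cases b)
    case True
    then show ?thesis
      using kb x by (intro bexI [where x = x]) (auto simp: dihedral_group_def)
  next
    case False
    then show ?thesis
      using kb assms
      by (intro bexI [where x = "((- k) mod int m, False)"])
         (auto simp: dihedral_group_def mod_add_left_eq)
  qed
next
  fix x y z
  show "x \<otimes>\<^bsub>dihedral_group m\<^esub> y \<otimes>\<^bsub>dihedral_group m\<^esub> z =
        x \<otimes>\<^bsub>dihedral_group m\<^esub> (y \<otimes>\<^bsub>dihedral_group m\<^esub> z)"
    by (simp add: dihedral_group_def split: prod.split)
       (auto simp: mod_add_left_eq mod_add_right_eq mod_diff_left_eq mod_diff_right_eq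
                   diff_diff_eq diff_diff_eq2 diff_add_eq add.assoc add_diff_eq)
qed (use assms in \<open>auto simp: dihedral_group_def\<close>)

lemma card_dihedral_group: "card (carrier (dihedral_group m)) = 2 * m"
  by (simp add: dihedral_group_def card_cartesian_product)

end

theory Submission
  imports Defs "HOL-Combinatorics.Permutations"
begin

text \<open>
  For \<open>\<lambda> = (1\<^sup>b, 2\<^sup>a)\<close> only an \<open>a \<times> b\<close> rectangle of entries is free, and \<open>GT\<^sub>\<lambda>\<close> is the order polytope of
  that rectangle. Its facets are the cover relations (edges) of the rectangle with a bottom and a top
  element adjoined, and the face lattice is dual to the family of zero sets of nonnegative edge
  weightings \<open>s\<close> that are balanced: in every unit square the two paths from the lowest to the highest
  corner have equal weight. Combinatorial automorphisms are therefore the permutations of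
  the edges preserving this family. Two facets have an intersection contained in a third one exactly if the edges
  are the two halves of such a path (they are ``partners''), so the partner relation and the squares
  are preserved.

  Placing each edge at its doubled midpoint turns partners into diagonal neighbours, and the partner
  relation decomposes the edges into diagonal zigzags. An automorphism is determined along a zigzag by
  the image of its first edge, and going from square to square everything is determined by the
  lowest square, up to flipping the two partners in the south-east and in the north-west corner and
  swapping the bottom and the top edge. Hence the group is generated by the two flips and the half turn
  (together a dihedral group of order 8), the outer swap, and, for \<open>a = b\<close>, the reflection in the
  antidiagonal.
\<close>

section \<open>Automorphisms of families of sets and of polyhedral faces\<close>

text \<open>Edge permutations can stand for automorphisms of the face lattice only if every edge
  inequality is a facet and every nonzero balanced weighting comes from a point. The first rests on
  cuts (gradients of indicators of up-sets), the second on rescaling a potential. Cuts also give the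
  hard half of the invariance of squares: unless \<open>g\<close> is opposite to \<open>e\<close>
  and \<open>f\<close>, some cut crosses \<open>g\<close> and misses both. The flips are the only
  local freedom because exactly the two corner zigzags have length two; elsewhere an end edge cannot
  be exchanged with its partner. The dihedral group appears as two commuting flips exchanged by the
  half turn; the half turn after one flip has order 4. For \<open>a = b\<close> the antidiagonal
  reflection is the right extra generator, because unlike the diagonal one it commutes with the
  flips and splits off as a direct factor. For \<open>a = b = 2\<close> it is the product of the two
  flips, which is why this case is exceptional.\<close>

definition perm_aut_group :: "'e set \<Rightarrow> 'e set set \<Rightarrow> ('e \<Rightarrow> 'e) monoid" where
  "perm_aut_group E \<C> =
    \<lparr>carrier = {p. p permutes E \<and> (\<forall>S\<subseteq>E. S \<in> \<C> \<longleftrightarrow> p ` S \<in> \<C>)},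
     monoid.mult = (\<circ>), one = id\<rparr>"

lemma group_perm_aut_group: "group (perm_aut_group E \<C>)"
proof (rule groupI)
  fix p q assume "p \<in> carrier (perm_aut_group E \<C>)" "q \<in> carrier (perm_aut_group E \<C>)"
  then have pq: "p permutes E" "q permutes E"
      "\<And>S. S \<subseteq> E \<Longrightarrow> S \<in> \<C> \<longleftrightarrow> p ` S \<in> \<C>" "\<And>S. S \<subseteq> E \<Longrightarrow> S \<in> \<C> \<longleftrightarrow> q ` S \<in> \<C>"
    by (auto simp: perm_aut_group_def)
  have "S \<in> \<C> \<longleftrightarrow> (p \<circ> q) ` S \<in> \<C>" if "S \<subseteq> E" for S
  proof -
    have "q ` S \<subseteq> E"
      using that permutes_in_image [OF pq(2)] by blast
    then show ?thesis
      using pq(3) [of "q ` S"] pq(4) [OF that] by (simp add: image_comp)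
  qed
  then show "p \<otimes>\<^bsub>perm_aut_group E \<C>\<^esub> q \<in> carrier (perm_aut_group E \<C>)"
    using pq permutes_compose by (auto simp: perm_aut_group_def)
next
  fix p assume "p \<in> carrier (perm_aut_group E \<C>)"
  then have p: "p permutes E" "\<And>S. S \<subseteq> E \<Longrightarrow> S \<in> \<C> \<longleftrightarrow> p ` S \<in> \<C>"
    by (auto simp: perm_aut_group_def)
  have "S \<in> \<C> \<longleftrightarrow> inv_into UNIV p ` S \<in> \<C>" if "S \<subseteq> E" for S
  proof -
    have "inv_into UNIV p ` S \<subseteq> E"
      using that permutes_in_image [OF permutes_inv [OF p(1)]] by blast
    moreover have "p ` inv_into UNIV p ` S = S"
      using permutes_surj [OF p(1)] by (simp add: image_f_inv_f)
    ultimately show ?thesis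
      using p(2) [of "inv_into UNIV p ` S"] by simp
  qed
  moreover have "inv_into UNIV p permutes E" "inv_into UNIV p \<circ> p = id"
    using p(1) permutes_inv permutes_inv_o(2) by blast+
  ultimately show "\<exists>q\<in>carrier (perm_aut_group E \<C>). q \<otimes>\<^bsub>perm_aut_group E \<C>\<^esub> p = \<one>\<^bsub>perm_aut_group E \<C>\<^esub>"
    by (intro bexI [where x = "inv_into UNIV p"]) (auto simp: perm_aut_group_def)
qed (auto simp: perm_aut_group_def permutes_id o_assoc)

text \<open>An inclusion automorphism fixes the least member \<open>{}\<close>, hence permutes the
  atoms, which are the singletons. The resulting permutation of \<open>E\<close> determines it,
  because a member is recovered from the singletons below it.\<close>

lemma perm_aut_group_iso_inclusion_aut_group:
  assumes sub: "\<C> \<subseteq> Pow E" and sing: "\<And>e. e \<in> E \<Longrightarrow> {e} \<in> \<C>" and empty: "{} \<in> \<C>"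
  shows "perm_aut_group E \<C> \<cong> inclusion_aut_group \<C>"
proof -
  let ?G = "perm_aut_group E \<C>" and ?H = "inclusion_aut_group \<C>"
  define \<Phi> where "\<Phi> p = restrict ((`) p) \<C>" for p :: "'a \<Rightarrow> 'a"
  have Gp: "p permutes E" "inj p" "\<And>S. S \<subseteq> E \<Longrightarrow> S \<in> \<C> \<longleftrightarrow> p ` S \<in> \<C>" if "p \<in> carrier ?G" for p
    using that permutes_inj by (auto simp: perm_aut_group_def)
  have into: "\<Phi> p \<in> carrier ?H" if p: "p \<in> carrier ?G" for p
  proof -
    have "bij_betw ((`) p) \<C> \<C>"
    proof (rule bij_betw_imageI)
      show "inj_on ((`) p) \<C>"
        using Gp(2) [OF p] by (simp add: inj_on_def inj_image_eq_iff)
      show "(`) p ` \<C> = \<C>"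
      proof (intro equalityI subsetI)
        fix S assume "S \<in> (`) p ` \<C>"
        then show "S \<in> \<C>" using Gp(3) [OF p] sub by blast
      next
        fix S assume S: "S \<in> \<C>"
        have eq: "p ` inv_into UNIV p ` S = S"
          using permutes_surj [OF Gp(1) [OF p]] by (simp add: image_f_inv_f)
        moreover have "inv_into UNIV p ` S \<subseteq> E"
          using S sub permutes_in_image [OF permutes_inv [OF Gp(1) [OF p]]] by blast
        ultimately have "inv_into UNIV p ` S \<in> \<C>"
          using Gp(3) [OF p, of "inv_into UNIV p ` S"] S by simp
        then show "S \<in> (`) p ` \<C>"
          using eq by (metis image_eqI)
      qed
    qed
    then have "\<Phi> p \<in> Bij \<C>"
      by (simp add: \<Phi>_def Bij_def bij_betw_restrict_eq)
    moreover have "F \<subseteq> G \<longleftrightarrow> \<Phi> p F \<subseteq> \<Phi> p G" if "F \<in> \<C>" "G \<in> \<C>" for F G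
      using that Gp(2) [OF p] by (simp add: \<Phi>_def inj_image_subset_iff)
    ultimately show ?thesis
      by (simp add: inclusion_aut_group_def)
  qed
  have "\<Phi> \<in> hom ?G ?H"
  proof (rule homI)
    show "\<Phi> p \<in> carrier ?H" if "p \<in> carrier ?G" for p
      by (rule into [OF that])
    fix p q assume p: "p \<in> carrier ?G" and q: "q \<in> carrier ?G"
    have B: "\<Phi> p \<in> Bij \<C>" "\<Phi> q \<in> Bij \<C>"
      using into [OF p] into [OF q] by (simp_all add: inclusion_aut_group_def)
    have mem: "q ` S \<in> \<C>" if "S \<in> \<C>" for S
      using Gp(3) [OF q] sub that by blast
    show "\<Phi> (p \<otimes>\<^bsub>?G\<^esub> q) = \<Phi> p \<otimes>\<^bsub>?H\<^esub> \<Phi> q"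
      using B mem by (auto simp: inclusion_aut_group_def BijGroup_def perm_aut_group_def \<Phi>_def
          compose_def image_comp fun_eq_iff restrict_def)
  qed
  moreover have "inj_on \<Phi> (carrier ?G)"
  proof (rule inj_onI)
    fix p q assume p: "p \<in> carrier ?G" and q: "q \<in> carrier ?G" and eq: "\<Phi> p = \<Phi> q"
    show "p = q"
    proof
      fix e show "p e = q e"
      proof (cases "e \<in> E")
        case True
        then have "p ` {e} = q ` {e}"
          using fun_cong [OF eq, of "{e}"] sing by (simp add: \<Phi>_def)
        then show ?thesis by simp
      next
        case False
        then show ?thesis
          using Gp(1) [OF p] Gp(1) [OF q] by (simp add: permutes_def)
      qed
    qed
  qed
  moreover have "\<Phi> ` carrier ?G = carrier ?H"
  proof (intro equalityI subsetI)
    show "f \<in> carrier ?H" if "f \<in> \<Phi> ` carrier ?G" for f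
      using that into by blast
  next
    fix f assume "f \<in> carrier ?H"
    then have ext: "f \<in> extensional \<C>" and bij: "bij_betw f \<C> \<C>"
      and mono: "\<And>F G. F \<in> \<C> \<Longrightarrow> G \<in> \<C> \<Longrightarrow> F \<subseteq> G \<longleftrightarrow> f F \<subseteq> f G"
      by (auto simp: inclusion_aut_group_def Bij_def)
    have f0: "f {} = {}"
    proof -
      obtain S where "S \<in> \<C>" "f S = {}"
        using bij empty unfolding bij_betw_def by (metis imageE)
      then show ?thesis
        using mono [of "{}" S] empty by auto
    qed
    have atom: "\<exists>g\<in>E. f {e} = {g}" if e: "e \<in> E" for e
    proof -
      have fe: "f {e} \<in> \<C>"
        using bij sing [OF e] unfolding bij_betw_def by blast
      have "f {e} \<noteq> {}"
        using bij sing [OF e] empty f0 unfolding bij_betw_def inj_on_def by (metis insert_not_empty)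
      then obtain g where g: "g \<in> f {e}" by blast
      then have gE: "g \<in> E"
        using fe sub by blast
      \<comment> \<open>Pulling a single point of \<open>f {e}\<close> back gives a nonempty member
        inside \<open>{e}\<close>, so \<open>f {e}\<close> has no second point.\<close>
      then obtain S where S: "S \<in> \<C>" "f S = {g}"
        using bij sing unfolding bij_betw_def by (metis imageE)
      then have "S \<subseteq> {e}"
        using mono [of S "{e}"] sing [OF e] g by simp
      moreover have "S \<noteq> {}"
        using S f0 by auto
      ultimately have "S = {e}" by blast
      then show ?thesis
        using S gE by blast
    qed
    define p where "p e = (if e \<in> E then the_elem (f {e}) else e)" for e
    have fp: "f {e} = {p e}" "p e \<in> E" if e: "e \<in> E" for e
    proof -
      obtain g where "g \<in> E" "f {e} = {g}"
        using atom [OF e] by blast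
      then show "f {e} = {p e}" "p e \<in> E"
        using e by (simp_all add: p_def)
    qed
    have "p permutes E"
    proof (rule bij_imp_permutes)
      show "bij_betw p E E"
      proof (rule bij_betw_imageI)
        show "inj_on p E"
        proof (rule inj_onI)
          fix e g assume "e \<in> E" "g \<in> E" "p e = p g"
          then have "f {e} = f {g}" "{e} \<in> \<C>" "{g} \<in> \<C>"
            using fp sing by simp_all
          then have "{e} = {g}"
            using bij unfolding bij_betw_def by (blast dest: inj_onD)
          then show "e = g" by simp
        qed
        show "p ` E = E"
        proof (intro equalityI subsetI)
          show "x \<in> E" if "x \<in> p ` E" for x using that fp by blast
        next
          fix g assume g: "g \<in> E"
          then obtain S where S: "S \<in> \<C>" "f S = {g}"
            using bij sing unfolding bij_betw_def by (metis imageE)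
          then have "S \<noteq> {}" using f0 by auto
          then obtain e where e: "e \<in> S" by blast
          then have eE: "e \<in> E" using S sub by blast
          have "f {e} \<subseteq> f S"
            using mono [of "{e}" S] S sing [OF eE] e by simp
          then have "p e = g"
            using S fp(1) [OF eE] by simp
          then show "g \<in> p ` E" using eE by blast
        qed
      qed
    qed (simp add: p_def)
    moreover have fS: "f S = p ` S" if S: "S \<in> \<C>" for S
    proof -
      have SE: "S \<subseteq> E" "f S \<subseteq> E"
        using S bij sub unfolding bij_betw_def by blast+
      have *: "p e \<in> f S \<longleftrightarrow> e \<in> S" if "e \<in> E" for e
        using mono [OF sing [OF that] S] fp(1) [OF that] by simp
      show ?thesis
      proof (intro equalityI subsetI)
        fix g assume g: "g \<in> f S"
        then have "g \<in> p ` E"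
          using SE(2) permutes_image [OF \<open>p permutes E\<close>] by auto
        then obtain e where "e \<in> E" "p e = g" by blast
        then show "g \<in> p ` S" using * g by blast
      qed (use * SE in blast)
    qed
    moreover have "S \<in> \<C> \<longleftrightarrow> p ` S \<in> \<C>" if "S \<subseteq> E" for S
    proof
      show "S \<in> \<C> \<Longrightarrow> p ` S \<in> \<C>"
        using fS bij unfolding bij_betw_def by (metis image_eqI)
    next
      assume "p ` S \<in> \<C>"
      then obtain T where T: "T \<in> \<C>" "f T = p ` S"
        using bij unfolding bij_betw_def by (metis imageE)
      then have "p ` T = p ` S" using fS by simp
      then have "T = S"
        using permutes_inj [OF \<open>p permutes E\<close>] by (simp add: inj_image_eq_iff)
      then show "S \<in> \<C>" using T by simp
    qed
    ultimately have "p \<in> carrier ?G" "f = \<Phi> p"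
      using ext by (auto simp: perm_aut_group_def \<Phi>_def extensional_def fun_eq_iff)
    then show "f \<in> \<Phi> ` carrier ?G" by blast
  qed
  ultimately show ?thesis
    unfolding is_iso_def iso_def bij_betw_def by blast
qed

text \<open>Conjugation by the anti-isomorphism \<open>h\<close> reverses inclusions twice.\<close>

lemma inclusion_aut_group_dual_iso:
  assumes bij: "bij_betw h \<C> \<F>" and anti: "\<And>S T. S \<in> \<C> \<Longrightarrow> T \<in> \<C> \<Longrightarrow> h S \<subseteq> h T \<longleftrightarrow> T \<subseteq> S"
  shows "inclusion_aut_group \<C> \<cong> inclusion_aut_group \<F>"
proof -
  let ?G = "inclusion_aut_group \<C>" and ?H = "inclusion_aut_group \<F>"
  define k where "k = inv_into \<C> h"
  have k: "bij_betw k \<F> \<C>"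
    using bij unfolding k_def by (rule bij_betw_inv_into)
  have hk: "h (k F) = F" "k F \<in> \<C>" if "F \<in> \<F>" for F
    using that bij k unfolding k_def by (auto simp: bij_betw_inv_into_right bij_betwE)
  have kh: "k (h S) = S" "h S \<in> \<F>" if "S \<in> \<C>" for S
    using that bij unfolding k_def by (auto simp: bij_betw_inv_into_left bij_betwE)
  have antik: "k S \<subseteq> k T \<longleftrightarrow> T \<subseteq> S" if "S \<in> \<F>" "T \<in> \<F>" for S T
    using anti [OF hk(2) hk(2), OF that(2,1)] hk that by simp
  define \<Phi> where "\<Phi> f = restrict (h \<circ> f \<circ> k) \<F>" for f
  define \<Psi> where "\<Psi> f = restrict (k \<circ> f \<circ> h) \<C>" for f
  have G: "bij_betw f \<C> \<C>" "f \<in> extensional \<C>" "\<And>S. S \<in> \<C> \<Longrightarrow> f S \<in> \<C>"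
    "\<And>S T. S \<in> \<C> \<Longrightarrow> T \<in> \<C> \<Longrightarrow> S \<subseteq> T \<longleftrightarrow> f S \<subseteq> f T" if "f \<in> carrier ?G" for f
    using that by (auto simp: inclusion_aut_group_def Bij_def bij_betwE)
  have H: "bij_betw f \<F> \<F>" "f \<in> extensional \<F>" "\<And>S. S \<in> \<F> \<Longrightarrow> f S \<in> \<F>"
    "\<And>S T. S \<in> \<F> \<Longrightarrow> T \<in> \<F> \<Longrightarrow> S \<subseteq> T \<longleftrightarrow> f S \<subseteq> f T" if "f \<in> carrier ?H" for f
    using that by (auto simp: inclusion_aut_group_def Bij_def bij_betwE)
  have \<Phi>: "\<Phi> f \<in> carrier ?H" if f: "f \<in> carrier ?G" for f
  proof -
    have "bij_betw (h \<circ> f \<circ> k) \<F> \<F>"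
      using bij k G(1) [OF f] by (intro bij_betw_trans [where B = \<C>])
    then have "\<Phi> f \<in> Bij \<F>"
      by (simp add: \<Phi>_def Bij_def bij_betw_restrict_eq)
    moreover have "S \<subseteq> T \<longleftrightarrow> \<Phi> f S \<subseteq> \<Phi> f T" if "S \<in> \<F>" "T \<in> \<F>" for S T
      using anti [OF G(3) [OF f hk(2) [OF that(1)]] G(3) [OF f hk(2) [OF that(2)]]]
        G(4) [OF f hk(2) [OF that(2)] hk(2) [OF that(1)]] antik [OF that(2,1)] that
      by (simp add: \<Phi>_def)
    ultimately show ?thesis by (simp add: inclusion_aut_group_def)
  qed
  have \<Psi>: "\<Psi> f \<in> carrier ?G" if f: "f \<in> carrier ?H" for f
  proof -
    have "bij_betw (k \<circ> f \<circ> h) \<C> \<C>"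
      using bij k H(1) [OF f] by (intro bij_betw_trans [where B = \<F>])
    then have "\<Psi> f \<in> Bij \<C>"
      by (simp add: \<Psi>_def Bij_def bij_betw_restrict_eq)
    moreover have "S \<subseteq> T \<longleftrightarrow> \<Psi> f S \<subseteq> \<Psi> f T" if "S \<in> \<C>" "T \<in> \<C>" for S T
      using antik [OF H(3) [OF f kh(2) [OF that(1)]] H(3) [OF f kh(2) [OF that(2)]]]
        H(4) [OF f kh(2) [OF that(2)] kh(2) [OF that(1)]] anti [OF that(2,1)] that
      by (simp add: \<Psi>_def)
    ultimately show ?thesis by (simp add: inclusion_aut_group_def)
  qed
  have "\<Phi> \<in> hom ?G ?H"
  proof (rule homI)
    fix f g assume f: "f \<in> carrier ?G" and g: "g \<in> carrier ?G"
    have "f \<in> Bij \<C>" "g \<in> Bij \<C>" "\<Phi> f \<in> Bij \<F>" "\<Phi> g \<in> Bij \<F>"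
      using f g \<Phi> [OF f] \<Phi> [OF g] by (simp_all add: inclusion_aut_group_def)
    then show "\<Phi> (f \<otimes>\<^bsub>?G\<^esub> g) = \<Phi> f \<otimes>\<^bsub>?H\<^esub> \<Phi> g"
      using G(3) [OF g] hk kh
      by (auto simp: inclusion_aut_group_def BijGroup_def \<Phi>_def compose_def fun_eq_iff restrict_def)
  qed (rule \<Phi>)
  moreover have "bij_betw \<Phi> (carrier ?G) (carrier ?H)"
  proof (rule bij_betw_byWitness [where f' = \<Psi>])
    show "\<forall>f\<in>carrier ?G. \<Psi> (\<Phi> f) = f"
      using G(2,3) kh by (auto simp: \<Phi>_def \<Psi>_def fun_eq_iff restrict_def extensional_def)
    show "\<forall>f\<in>carrier ?H. \<Phi> (\<Psi> f) = f"
      using H(2,3) hk by (auto simp: \<Phi>_def \<Psi>_def fun_eq_iff restrict_def extensional_def)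
  qed (use \<Phi> \<Psi> in auto)
  ultimately show ?thesis
    unfolding is_iso_def iso_def by blast
qed

text \<open>The parameter \<open>t\<close> ranges over all reals, so \<open>A\<close> contains whole
  lines and the slacks are affine along them. Besides finiteness of \<open>E\<close>, the face
  argument uses nothing else: no topology and no dimension.\<close>

locale slack_polyhedron =
  fixes A :: "'v::real_vector set" and E :: "'e set" and L :: "'e \<Rightarrow> 'v \<Rightarrow> real" and P :: "'v set"
  assumes fin: "finite E"
    and line: "x \<in> A \<Longrightarrow> y \<in> A \<Longrightarrow> (1 - t) *\<^sub>R x + t *\<^sub>R y \<in> A"
    and aff: "x \<in> A \<Longrightarrow> y \<in> A \<Longrightarrow> e \<in> E \<Longrightarrow> L e ((1 - t) *\<^sub>R x + t *\<^sub>R y) = (1 - t) * L e x + t * L e y"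
    and P_def: "P = {x \<in> A. \<forall>e\<in>E. 0 \<le> L e x}"
begin

definition zeros :: "'v \<Rightarrow> 'e set" where
  "zeros x = {e \<in> E. L e x = 0}"

definition face :: "'e set \<Rightarrow> 'v set" where
  "face S = {x \<in> P. S \<subseteq> zeros x}"

lemma convex_P: "convex P"
  unfolding convex_alt
proof (intro ballI allI impI)
  fix x y and t :: real
  assume "x \<in> P" "y \<in> P" "0 \<le> t \<and> t \<le> 1"
  then show "(1 - t) *\<^sub>R x + t *\<^sub>R y \<in> P"
    using line aff by (simp add: P_def)
qed

lemma zeros_between:
  assumes "x \<in> P" "y \<in> P" "0 < t" "t < 1"
  shows "zeros ((1 - t) *\<^sub>R x + t *\<^sub>R y) = zeros x \<inter> zeros y"
proof -
  have "L e ((1 - t) *\<^sub>R x + t *\<^sub>R y) = 0 \<longleftrightarrow> L e x = 0 \<and> L e y = 0" if "e \<in> E" for e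
  proof -
    have "0 \<le> L e x" "0 \<le> L e y" "L e ((1 - t) *\<^sub>R x + t *\<^sub>R y) = (1 - t) * L e x + t * L e y"
      using assms aff that by (auto simp: P_def)
    then show ?thesis
      using assms by (simp add: add_nonneg_eq_0_iff)
  qed
  then show ?thesis by (auto simp: zeros_def)
qed

lemma face_face_of: "face S face_of P"
  unfolding face_of_def
proof (intro conjI ballI impI)
  show "convex (face S)"
    unfolding convex_alt
  proof (intro ballI allI impI)
    fix x y and t :: real
    assume xy: "x \<in> face S" "y \<in> face S" and t: "0 \<le> t \<and> t \<le> 1"
    have "(1 - t) *\<^sub>R x + t *\<^sub>R y \<in> P"
      using convex_P xy t unfolding convex_alt face_def by blast
    moreover have "S \<subseteq> zeros ((1 - t) *\<^sub>R x + t *\<^sub>R y)"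
      using xy t zeros_between [of x y t] by (cases "t = 0"; cases "t = 1") (auto simp: face_def)
    ultimately show "(1 - t) *\<^sub>R x + t *\<^sub>R y \<in> face S"
      by (simp add: face_def)
  qed
next
  fix x y z assume "x \<in> P" "y \<in> P" "z \<in> face S" "z \<in> open_segment x y"
  then show "x \<in> face S" "y \<in> face S"
    using zeros_between by (auto simp: in_segment face_def)
qed (simp add: face_def)

text \<open>A point \<open>x\<close> of \<open>F\<close> with fewest zeros acts as a relative
  interior point: its midpoint with any \<open>y\<close> in \<open>F\<close> has only the common
  zeros, so minimality forces \<open>zeros x\<close> into \<open>zeros y\<close>. Conversely, a
  point of \<open>face (zeros x)\<close> other than \<open>x\<close> is the end of a segment in
  \<open>P\<close> with \<open>x\<close> in its interior.\<close>

lemma face_of_imp_face: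
  assumes F: "F face_of P" and "F \<noteq> {}"
  obtains x where "x \<in> P" "F = face (zeros x)"
proof -
  obtain x where x: "x \<in> F" "\<And>y. y \<in> F \<Longrightarrow> card (zeros x) \<le> card (zeros y)"
    using \<open>F \<noteq> {}\<close> ex_has_least_nat [of "\<lambda>x. x \<in> F" _ "\<lambda>x. card (zeros x)"] by blast
  have FP: "F \<subseteq> P" and cF: "convex F"
    using F by (auto simp: face_of_def)
  have "zeros x \<subseteq> zeros y" if y: "y \<in> F" for y
  proof -
    let ?m = "(1 - 1/2) *\<^sub>R x + (1/2) *\<^sub>R y"
    have "?m \<in> F"
      by (rule convexD_alt [OF cF x(1) y]) auto
    moreover have z: "zeros ?m = zeros x \<inter> zeros y"
      using x(1) y FP by (intro zeros_between) auto
    ultimately have "card (zeros x) \<le> card (zeros x \<inter> zeros y)"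
      using x(2) by metis
    then show ?thesis
      using fin card_seteq [of "zeros x" "zeros x \<inter> zeros y"] by (auto simp: zeros_def)
  qed
  then have 1: "F \<subseteq> face (zeros x)"
    using FP by (auto simp: face_def)
  have 2: "y \<in> F" if y: "y \<in> face (zeros x)" for y
  proof (cases "y = x")
    case False
    have xP: "x \<in> P" and yP: "y \<in> P"
      using x(1) FP y by (auto simp: face_def)
    then have A: "x \<in> A" "y \<in> A" by (auto simp: P_def)
    \<comment> \<open>A point \<open>w\<close> of \<open>P\<close> slightly beyond \<open>x\<close>, seen from \<open>y\<close>, puts \<open>x\<close> inside a segment ending in \<open>y\<close>.\<close>
    obtain \<epsilon> where \<epsilon>: "\<epsilon> > 0" "\<And>e. e \<in> E \<Longrightarrow> e \<notin> zeros x \<Longrightarrow> \<epsilon> * L e y \<le> L e x"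
    proof -
      \<comment> \<open>The ratios bound the step beyond \<open>x\<close> before an inactive slack
        turns negative; \<open>+ 1\<close> avoids division by zero, and the inserted
        \<open>1\<close> keeps the set nonempty if all constraints are active at
        \<open>x\<close>.\<close>
      define D where "D = insert 1 ((\<lambda>e. L e x / (L e y + 1)) ` (E - zeros x))"
      have D: "finite D" "D \<noteq> {}" using fin by (auto simp: D_def)
      have pos: "L e x / (L e y + 1) > 0" if "e \<in> E - zeros x" for e
      proof -
        have "0 \<le> L e x" "L e x \<noteq> 0" "0 \<le> L e y"
          using that xP yP by (auto simp: P_def zeros_def)
        then show ?thesis by simp
      qed
      have "Min D > 0"
        using D pos by (auto simp: D_def)
      moreover have "Min D * L e y \<le> L e x" if "e \<in> E" "e \<notin> zeros x" for e
      proof -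
        have y0: "0 \<le> L e y" using that yP by (auto simp: P_def)
        have "Min D \<le> L e x / (L e y + 1)"
          using D that by (intro Min_le) (auto simp: D_def)
        then have "Min D * (L e y + 1) \<le> L e x"
          using y0 by (simp add: pos_le_divide_eq)
        moreover have "Min D * L e y \<le> Min D * (L e y + 1)"
          using \<open>Min D > 0\<close> by simp
        ultimately show ?thesis by linarith
      qed
      ultimately show ?thesis using that by blast
    qed
    define w where "w = (1 - (- \<epsilon>)) *\<^sub>R x + (- \<epsilon>) *\<^sub>R y"
    have "w \<in> A" unfolding w_def using A by (rule line)
    moreover have "0 \<le> L e w" if e: "e \<in> E" for e
    proof -
      have Lw: "L e w = (1 - (- \<epsilon>)) * L e x + (- \<epsilon>) * L e y"
        unfolding w_def using A e by (rule aff)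
      show ?thesis
      proof (cases "e \<in> zeros x")
        case True
        then have "L e x = 0" "L e y = 0"
          using y by (auto simp: face_def zeros_def)
        then show ?thesis using Lw by simp
      next
        case False
        have "0 \<le> L e x" using xP e by (simp add: P_def)
        then have "0 \<le> \<epsilon> * L e x" using \<epsilon>(1) by simp
        then show ?thesis
          using \<epsilon>(2) [OF e False] Lw by (simp add: algebra_simps)
      qed
    qed
    ultimately have wP: "w \<in> P" by (simp add: P_def)
    have xw: "x = (1 - 1/(1+\<epsilon>)) *\<^sub>R y + (1/(1+\<epsilon>)) *\<^sub>R w"
    proof -
      define c where "c = 1/(1+\<epsilon>)"
      have c: "c * (1 + \<epsilon>) = 1" "1 - c = c * \<epsilon>"
        using \<epsilon>(1) by (simp_all add: c_def field_simps)
      have "c *\<^sub>R w = (c * (1 + \<epsilon>)) *\<^sub>R x - (c * \<epsilon>) *\<^sub>R y"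
        unfolding w_def by (simp add: scaleR_right_distrib scaleR_right_diff_distrib)
      then have "(1 - c) *\<^sub>R y + c *\<^sub>R w = x"
        unfolding c by simp
      then show ?thesis by (simp add: c_def)
    qed
    have "y \<noteq> w"
    proof
      assume "y = w"
      then have "x = (1 - 1/(1+\<epsilon>)) *\<^sub>R y + (1/(1+\<epsilon>)) *\<^sub>R y"
        using xw by simp
      then show False
        using False by (simp add: scaleR_left_distrib [symmetric])
    qed
    then have "x \<in> open_segment y w"
      using xw \<epsilon>(1) unfolding in_segment by (intro conjI exI [where x = "1/(1+\<epsilon>)"]) auto
    then show ?thesis
      using F yP wP x(1) unfolding face_of_def by blast
  qed (use x in simp)
  show ?thesis
    using that [of x] 1 2 x(1) FP by blast
qed

text \<open>\<open>E\<close> is adjoined as the label of the empty face: by assumption no point of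
  \<open>P\<close> has all slacks zero. Order reversal holds because \<open>x\<close> itself lies in
  \<open>face (zeros x)\<close>.\<close>

lemma face_bij:
  assumes "E \<notin> zeros ` P"
  shows "bij_betw face (insert E (zeros ` P)) {F. F face_of P}"
    and "S \<in> insert E (zeros ` P) \<Longrightarrow> T \<in> insert E (zeros ` P) \<Longrightarrow> face S \<subseteq> face T \<longleftrightarrow> T \<subseteq> S"
proof -
  have empty: "face E = {}"
    using assms by (auto simp: face_def zeros_def)
  have self: "x \<in> face (zeros x)" if "x \<in> P" for x
    using that by (simp add: face_def)
  show anti: "face S \<subseteq> face T \<longleftrightarrow> T \<subseteq> S"
    if ST: "S \<in> insert E (zeros ` P)" "T \<in> insert E (zeros ` P)" for S T
  proof
    show "T \<subseteq> S \<Longrightarrow> face S \<subseteq> face T"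
      by (auto simp: face_def)
    assume sub: "face S \<subseteq> face T"
    show "T \<subseteq> S"
    proof (cases "S = E")
      case True
      then show ?thesis using ST by (auto simp: zeros_def)
    next
      case False
      then obtain x where "x \<in> P" "S = zeros x" using ST by blast
      then show ?thesis using sub self by (auto simp: face_def)
    qed
  qed
  show "bij_betw face (insert E (zeros ` P)) {F. F face_of P}"
  proof (rule bij_betw_imageI)
    show "inj_on face (insert E (zeros ` P))"
    proof (rule inj_onI)
      fix S T assume "S \<in> insert E (zeros ` P)" "T \<in> insert E (zeros ` P)" "face S = face T"
      then show "S = T"
        using anti [of S T] anti [of T S] by blast
    qed
    show "face ` insert E (zeros ` P) = {F. F face_of P}"
    proof (intro equalityI subsetI)
      show "F \<in> {F. F face_of P}" if "F \<in> face ` insert E (zeros ` P)" for F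
        using that face_face_of by blast
      fix F assume F: "F \<in> {F. F face_of P}"
      show "F \<in> face ` insert E (zeros ` P)"
      proof (cases "F = {}")
        case False
        then obtain x where "x \<in> P" "F = face (zeros x)"
          using F face_of_imp_face by blast
        then show ?thesis by blast
      qed (use empty in blast)
    qed
  qed
qed

lemma combinatorial_aut_group_iso:
  assumes "E \<notin> zeros ` P" and "{} \<in> zeros ` P" and "\<And>e. e \<in> E \<Longrightarrow> {e} \<in> zeros ` P"
  shows "perm_aut_group E (insert E (zeros ` P)) \<cong> combinatorial_aut_group P"
proof -
  have "perm_aut_group E (insert E (zeros ` P)) \<cong> inclusion_aut_group (insert E (zeros ` P))"
    using assms by (intro perm_aut_group_iso_inclusion_aut_group) (auto simp: zeros_def)
  moreover have "inclusion_aut_group (insert E (zeros ` P)) \<cong> combinatorial_aut_group P"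
    unfolding combinatorial_aut_group_def
    by (intro inclusion_aut_group_dual_iso [where h = face] face_bij assms)
  ultimately show ?thesis
    by (rule iso_trans)
qed

end

section \<open>Edges of the grid and zero sets of balanced weightings\<close>

type_synonym edge = "nat \<times> nat"

text \<open>
  The edge from \<open>(i, j)\<close> to \<open>(i, j + 1)\<close> or \<open>(i + 1, j)\<close> is encoded by the sum of its ends (its doubled midpoint),
  \<open>(2 i, 2 j + 1)\<close> or \<open>(2 i + 1, 2 j)\<close>. The outer edges \<open>(1, 2)\<close> and \<open>(2 a, 2 b + 1)\<close> join \<open>(1, 1)\<close> and \<open>(a, b)\<close>
  to the adjoined bottom \<open>(0, 1)\<close> and top \<open>(a, b + 1)\<close>.
\<close>

definition inner_edges :: "nat \<Rightarrow> nat \<Rightarrow> edge set" where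
  "inner_edges a b = {(u, v). 2 \<le> u \<and> u \<le> 2 * a \<and> 2 \<le> v \<and> v \<le> 2 * b \<and> odd (u + v)}"

definition edges :: "nat \<Rightarrow> nat \<Rightarrow> edge set" where
  "edges a b = inner_edges a b \<union> {(1, 2), (2 * a, 2 * b + 1)}"

text \<open>Exactly one coordinate of an edge is odd, so rounding the halves down or up gives the
  two ends.\<close>

definition lo :: "edge \<Rightarrow> nat \<times> nat" where
  "lo e = (fst e div 2, snd e div 2)"

definition hi :: "edge \<Rightarrow> nat \<times> nat" where
  "hi e = ((fst e + 1) div 2, (snd e + 1) div 2)"

lemma lo_hi_simps [simp]:
  "lo (2*i, Suc (2*j)) = (i, j)" "hi (2*i, Suc (2*j)) = (i, Suc j)"
  "lo (Suc (2*i), 2*j) = (i, j)" "hi (Suc (2*i), 2*j) = (Suc i, j)"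
  by (simp_all add: lo_def hi_def)

text \<open>The condition for a discrete gradient: the signed sum around each unit square vanishes.
  The two outer edges lie in no square, so their weights are unconstrained.\<close>

definition balanced :: "nat \<Rightarrow> nat \<Rightarrow> (edge \<Rightarrow> real) \<Rightarrow> bool" where
  "balanced a b s \<longleftrightarrow> (\<forall>i j. 1 \<le> i \<and> i < a \<and> 1 \<le> j \<and> j < b \<longrightarrow>
     s (2*i, 2*j+1) + s (2*i+1, 2*j+2) = s (2*i+1, 2*j) + s (2*i+2, 2*j+1))"

definition zero_sets :: "nat \<Rightarrow> nat \<Rightarrow> edge set set" where
  "zero_sets a b =
    {{e \<in> edges a b. s e = 0} | s. (\<forall>e\<in>edges a b. 0 \<le> s e) \<and> balanced a b s}"

text \<open>\<open>e\<close> and \<open>f\<close> form one of the two paths through a unit square, and \<open>g\<close> lies on the other one.\<close>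

definition opposite :: "nat \<Rightarrow> nat \<Rightarrow> edge \<Rightarrow> edge \<Rightarrow> edge \<Rightarrow> bool" where
  "opposite a b e f g \<longleftrightarrow> (\<exists>i j. 1 \<le> i \<and> i < a \<and> 1 \<le> j \<and> j < b \<and>
     ({e, f} = {(2*i, 2*j+1), (2*i+1, 2*j+2)} \<and> g \<in> {(2*i+1, 2*j), (2*i+2, 2*j+1)} \<or>
      {e, f} = {(2*i+1, 2*j), (2*i+2, 2*j+1)} \<and> g \<in> {(2*i, 2*j+1), (2*i+1, 2*j+2)}))"

lemma finite_edges: "finite (edges a b)"
proof -
  have "inner_edges a b \<subseteq> {..2*a} \<times> {..2*b}"
    by (auto simp: inner_edges_def)
  then show ?thesis
    unfolding edges_def by (auto intro: finite_subset)
qed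

lemma edge_cases:
  assumes "e \<in> edges a b"
  obtains (row) i j where "e = (2*i, 2*j+1)" "1 \<le> i \<and> i \<le> a \<and> 1 \<le> j \<and> j < b \<or> i = a \<and> j = b"
    | (col) i j where "e = (2*i+1, 2*j)" "1 \<le> i \<and> i < a \<and> 1 \<le> j \<and> j \<le> b \<or> i = 0 \<and> j = 1"
proof -
  obtain u v where e: "e = (u, v)" by (cases e)
  have uv: "odd (u + v)" "(u, v) = (1, 2) \<or> (u, v) = (2*a, 2*b+1) \<or> 2 \<le> u \<and> u \<le> 2*a \<and> 2 \<le> v \<and> v \<le> 2*b"
    using assms by (auto simp: e edges_def inner_edges_def)
  show ?thesis
  proof (cases "even u")
    case True
    then obtain i j where "u = 2*i" "v = 2*j+1"
      using uv(1) by (auto elim!: evenE oddE)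
    moreover from this have "1 \<le> i \<and> i \<le> a \<and> 1 \<le> j \<and> j < b \<or> i = a \<and> j = b"
      using uv(2) by (simp only: prod.inject) presburger
    ultimately show ?thesis using e by (intro row [of i j]) auto
  next
    case False
    then obtain i j where "u = 2*i+1" "v = 2*j"
      using uv(1) by (auto elim!: evenE oddE)
    moreover from this have "1 \<le> i \<and> i < a \<and> 1 \<le> j \<and> j \<le> b \<or> i = 0 \<and> j = 1"
      using uv(2) by (simp only: prod.inject) presburger
    ultimately show ?thesis using e by (intro col [of i j]) auto
  qed
qed

section \<open>Cuts by up-sets and the characterisation of opposite edges\<close>

definition cut :: "(nat \<times> nat \<Rightarrow> bool) \<Rightarrow> edge \<Rightarrow> real" where
  "cut U e = of_bool (U (hi e)) - of_bool (U (lo e))"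

lemma balanced_cut: "balanced a b (cut U)"
  by (auto simp: balanced_def cut_def hi_def lo_def)

text \<open>\<open>cut U\<close> is the gradient of the indicator of \<open>U\<close>; an up-set
  makes it nonnegative, and its zeros are the edges that do not enter \<open>U\<close> from
  outside.\<close>

lemma cut_zero_set:
  assumes "\<And>i j i' j'. U (i, j) \<Longrightarrow> i \<le> i' \<Longrightarrow> j \<le> j' \<Longrightarrow> U (i', j')"
  shows "{e \<in> edges a b. U (hi e) \<longrightarrow> U (lo e)} \<in> zero_sets a b"
proof -
  have up: "U (lo e) \<Longrightarrow> U (hi e)" for e
    unfolding lo_def hi_def by (rule assms) auto
  then have "\<forall>e\<in>edges a b. 0 \<le> cut U e"
    by (auto simp: cut_def)
  moreover have "{e \<in> edges a b. U (hi e) \<longrightarrow> U (lo e)} = {e \<in> edges a b. cut U e = 0}"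
    using up by (auto simp: cut_def)
  ultimately show ?thesis
    using balanced_cut unfolding zero_sets_def by blast
qed

abbreviation below :: "nat \<times> nat \<Rightarrow> nat \<times> nat \<Rightarrow> bool" where
  "below x y \<equiv> fst x \<le> fst y \<and> snd x \<le> snd y"

text \<open>The ends of an edge are neighbours in the componentwise order, which leaves no room for
  a second edge between them.\<close>

lemma edge_between:
  assumes "e \<in> edges a b" "g \<in> edges a b" "below (lo e) (lo g)" "below (hi g) (hi e)"
  shows "g = e"
proof -
  obtain i j k l where "e = (2*i, 2*j+1) \<or> e = (2*i+1, 2*j)" "g = (2*k, 2*l+1) \<or> g = (2*k+1, 2*l)"
    by (rule edge_cases [OF assms(1)]; rule edge_cases [OF assms(2)]) blast+
  then show ?thesis
    using assms(3,4) by (elim disjE) simp_all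
qed

text \<open>With the coordinate sum as rank, \<open>lo f\<close> is at most one step above
  \<open>lo e\<close>, so \<open>g\<close> lies in an interval of at most two steps from
  \<open>lo e\<close> to \<open>hi f\<close>. Excluding \<open>g = e\<close> and
  \<open>g = f\<close> leaves the case where \<open>e\<close> and \<open>f\<close> turn a corner; as
  \<open>g\<close> is an edge too, the square lies inside the rectangle.\<close>

lemma opposite_of_between:
  assumes "e \<in> edges a b" "f \<in> edges a b" "g \<in> edges a b" "g \<noteq> e" "g \<noteq> f"
    and "below (lo e) (lo g)" "below (hi g) (hi f)" "below (lo f) (hi e)"
  shows "opposite a b e f g"
  using assms(1)
proof (cases rule: edge_cases)
  case e: (row i j)
  from assms(2) show ?thesis
  proof (cases rule: edge_cases)
    case f: (row k l)
    from assms(3) show ?thesis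
      by (cases rule: edge_cases) (use assms(4-8) in \<open>simp_all add: e(1) f(1)\<close>)
  next
    case f: (col k l)
    from assms(3) show ?thesis
    proof (cases rule: edge_cases)
      case g: (row m n)
      have "k = i" "l = j+1" "m = i+1" "n = j"
        using assms(4-8) unfolding e(1) f(1) g(1) by simp_all
      moreover from this have "1 \<le> i \<and> i < a \<and> 1 \<le> j \<and> j < b"
        using e(2) f(2) g(2) by presburger
      ultimately show ?thesis
        unfolding opposite_def e(1) f(1) g(1) by (intro exI [of _ i] exI [of _ j]) (simp add: insert_commute)
    next
      case g: (col m n)
      have "k = i" "l = j+1" "m = i" "n = j"
        using assms(4-8) unfolding e(1) f(1) g(1) by simp_all
      moreover from this have "1 \<le> i \<and> i < a \<and> 1 \<le> j \<and> j < b"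
        using e(2) f(2) g(2) by presburger
      ultimately show ?thesis
        unfolding opposite_def e(1) f(1) g(1) by (intro exI [of _ i] exI [of _ j]) (simp add: insert_commute)
    qed
  qed
next
  case e: (col i j)
  from assms(2) show ?thesis
  proof (cases rule: edge_cases)
    case f: (col k l)
    from assms(3) show ?thesis
      by (cases rule: edge_cases) (use assms(4-8) in \<open>simp_all add: e(1) f(1)\<close>)
  next
    case f: (row k l)
    from assms(3) show ?thesis
    proof (cases rule: edge_cases)
      case g: (row m n)
      have "k = i+1" "l = j" "m = i" "n = j"
        using assms(4-8) unfolding e(1) f(1) g(1) by simp_all
      moreover from this have "1 \<le> i \<and> i < a \<and> 1 \<le> j \<and> j < b"
        using e(2) f(2) g(2) by presburger
      ultimately show ?thesis
        unfolding opposite_def e(1) f(1) g(1) by (intro exI [of _ i] exI [of _ j]) (simp add: insert_commute)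
    next
      case g: (col m n)
      have "k = i+1" "l = j" "m = i" "n = j+1"
        using assms(4-8) unfolding e(1) f(1) g(1) by simp_all
      moreover from this have "1 \<le> i \<and> i < a \<and> 1 \<le> j \<and> j < b"
        using e(2) f(2) g(2) by presburger
      ultimately show ?thesis
        unfolding opposite_def e(1) f(1) g(1) by (intro exI [of _ i] exI [of _ j]) (simp add: insert_commute)
    qed
  qed
qed

lemma opposite_commute: "opposite a b e f g \<longleftrightarrow> opposite a b f e g"
  by (simp add: opposite_def insert_commute)

lemma zero_set_separating:
  assumes "e \<in> edges a b" "f \<in> edges a b" "g \<in> edges a b" "g \<noteq> e" "g \<noteq> f" "\<not> opposite a b e f g"
  obtains S where "S \<in> zero_sets a b" "e \<in> S" "f \<in> S" "g \<notin> S"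
proof -
  \<comment> \<open>The least up-set that contains the upper end of \<open>g\<close> and is not entered by \<open>e\<close> or \<open>f\<close>.\<close>
  define Ce where "Ce \<longleftrightarrow> below (hi g) (hi e) \<or> below (hi g) (hi f) \<and> below (lo f) (hi e)"
  define Cf where "Cf \<longleftrightarrow> below (hi g) (hi f) \<or> below (hi g) (hi e) \<and> below (lo e) (hi f)"
  define U where "U x \<longleftrightarrow> below (hi g) x \<or> Ce \<and> below (lo e) x \<or> Cf \<and> below (lo f) x" for x
  let ?S = "{e \<in> edges a b. U (hi e) \<longrightarrow> U (lo e)}"
  have "?S \<in> zero_sets a b"
    by (rule cut_zero_set) (auto simp: U_def)
  \<comment> \<open>\<open>Ce\<close> and \<open>Cf\<close> allow forcing directly by
    \<open>hi g\<close> or through the other edge; with two edges no longer chain occurs.\<close>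
  moreover have "e \<in> ?S" "f \<in> ?S"
    using assms(1,2) by (auto simp: U_def Ce_def Cf_def)
  moreover have "\<not> below (hi g) (lo g)"
    using assms(3) by (cases rule: edge_cases) auto
  \<comment> \<open>If \<open>lo g\<close> were above a forced \<open>lo e\<close>, direct forcing
    would squeeze \<open>g\<close> between the ends of \<open>e\<close>, and forcing through
    \<open>f\<close> would make \<open>g\<close> opposite to \<open>e\<close> and
    \<open>f\<close>.\<close>
  moreover have "\<not> (Ce \<and> below (lo e) (lo g))"
    using edge_between [of e a b g] opposite_of_between [of e a b f g] assms unfolding Ce_def by blast
  moreover have "\<not> (Cf \<and> below (lo f) (lo g))"
    using edge_between [of f a b g] opposite_of_between [of f a b e g] opposite_commute assms
    unfolding Cf_def by blast
  ultimately show ?thesis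
    using that [of ?S] by (auto simp: U_def)
qed

text \<open>The two paths of a square have equal weight; if one is \<open>0 + 0\<close>,
  nonnegativity kills both edges of the other.\<close>

lemma opposite_imp_mem:
  assumes "opposite a b e f g" "S \<in> zero_sets a b" "e \<in> S" "f \<in> S"
  shows "g \<in> S"
proof -
  obtain s where S: "S = {e \<in> edges a b. s e = 0}" and nn: "\<And>e. e \<in> edges a b \<Longrightarrow> 0 \<le> s e"
    and bal: "balanced a b s"
    using assms(2) unfolding zero_sets_def by blast
  obtain i j where ij: "1 \<le> i" "i < a" "1 \<le> j" "j < b"
    and efg: "{e, f} = {(2*i, 2*j+1), (2*i+1, 2*j+2)} \<and> g \<in> {(2*i+1, 2*j), (2*i+2, 2*j+1)} \<or>
      {e, f} = {(2*i+1, 2*j), (2*i+2, 2*j+1)} \<and> g \<in> {(2*i, 2*j+1), (2*i+1, 2*j+2)}"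
    using assms(1) unfolding opposite_def by blast
  have mem: "(2*i, 2*j+1) \<in> edges a b" "(2*i+1, 2*j+2) \<in> edges a b"
     "(2*i+1, 2*j) \<in> edges a b" "(2*i+2, 2*j+1) \<in> edges a b"
    using ij by (auto simp: edges_def inner_edges_def)
  have eq: "s (2*i, 2*j+1) + s (2*i+1, 2*j+2) = s (2*i+1, 2*j) + s (2*i+2, 2*j+1)"
    using bal ij by (auto simp: balanced_def)
  have "s e = 0" "s f = 0" using assms(3,4) S by auto
  then have "s g = 0" "g \<in> edges a b"
    using efg eq mem nn [OF mem(1)] nn [OF mem(2)] nn [OF mem(3)] nn [OF mem(4)]
    by (auto simp: doubleton_eq_iff)
  then show ?thesis using S by simp
qed

lemma opposite_distinct:
  "opposite a b e f g \<Longrightarrow> e \<noteq> f \<and> g \<noteq> e \<and> g \<noteq> f"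
  by (auto simp: opposite_def doubleton_eq_iff)

text \<open>The right side speaks of zero sets only, which makes the relation invariant under
  automorphisms.\<close>

lemma opposite_iff:
  assumes "e \<in> edges a b" "f \<in> edges a b" "g \<in> edges a b"
  shows "opposite a b e f g \<longleftrightarrow>
    g \<noteq> e \<and> g \<noteq> f \<and> (\<forall>S\<in>zero_sets a b. e \<in> S \<longrightarrow> f \<in> S \<longrightarrow> g \<in> S)"
    (is "_ \<longleftrightarrow> ?R")
proof
  show "opposite a b e f g \<Longrightarrow> ?R"
    using opposite_distinct opposite_imp_mem by blast
  assume R: ?R
  show "opposite a b e f g"
  proof (rule ccontr)
    assume "\<not> opposite a b e f g"
    then obtain S where "S \<in> zero_sets a b" "e \<in> S" "f \<in> S" "g \<notin> S"
      using zero_set_separating [OF assms] R by metis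
    then show False using R by blast
  qed
qed

text \<open>Adding nonnegative weightings intersects their zero sets.\<close>

lemma zero_sets_Int:
  assumes "S \<in> zero_sets a b" "T \<in> zero_sets a b"
  shows "S \<inter> T \<in> zero_sets a b"
proof -
  obtain s t where S: "S = {e \<in> edges a b. s e = 0}" "\<forall>e\<in>edges a b. 0 \<le> s e" "balanced a b s"
    and T: "T = {e \<in> edges a b. t e = 0}" "\<forall>e\<in>edges a b. 0 \<le> t e" "balanced a b t"
    using assms unfolding zero_sets_def by blast
  have "balanced a b (\<lambda>e. s e + t e)"
    using S(3) T(3) unfolding balanced_def by (smt (verit))
  moreover have "S \<inter> T = {e \<in> edges a b. s e + t e = 0}"
    using S(1,2) T(1,2) by (auto simp: add_nonneg_eq_0_iff)
  moreover have "\<forall>e\<in>edges a b. 0 \<le> s e + t e"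
    using S(2) T(2) by auto
  ultimately show ?thesis
    unfolding zero_sets_def by (intro CollectI exI [of _ "\<lambda>e. s e + t e"]) blast
qed

lemma edges_in_zero_sets: "edges a b \<in> zero_sets a b"
  unfolding zero_sets_def by (intro CollectI exI [of _ "\<lambda>_. 0"]) (auto simp: balanced_def)

lemma zero_sets_subset: "zero_sets a b \<subseteq> Pow (edges a b)"
  by (auto simp: zero_sets_def)

text \<open>Taking \<open>f = e\<close> in \<open>zero_set_separating\<close> separates
  \<open>e\<close> from every other edge, since opposite pairs are distinct; the intersection of the
  separating sets is \<open>{e}\<close>. So every edge inequality is a facet.\<close>

lemma singleton_in_zero_sets:
  assumes e: "e \<in> edges a b"
  shows "{e} \<in> zero_sets a b"
proof -
  have sep: "\<exists>S. S \<in> zero_sets a b \<and> e \<in> S \<and> g \<notin> S" if "g \<in> edges a b" "g \<noteq> e" for g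
  proof -
    have "\<not> opposite a b e e g"
      using opposite_distinct by blast
    then show ?thesis
      using zero_set_separating [OF e e that(1) that(2) that(2)] by metis
  qed
  then have "\<exists>S. \<forall>g\<in>edges a b - {e}. S g \<in> zero_sets a b \<and> e \<in> S g \<and> g \<notin> S g"
    by (intro bchoice) blast
  then obtain S where S: "\<And>g. g \<in> edges a b - {e} \<Longrightarrow> S g \<in> zero_sets a b \<and> e \<in> S g \<and> g \<notin> S g"
    by blast
  have "edges a b \<inter> \<Inter>(S ` G) \<in> zero_sets a b" if "finite G" "G \<subseteq> edges a b - {e}" for G
    using that
  proof (induction G rule: finite_induct)
    case empty
    then show ?case by (simp add: edges_in_zero_sets)
  next
    case (insert g G)
    then have "S g \<inter> (edges a b \<inter> \<Inter>(S ` G)) \<in> zero_sets a b"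
      by (intro zero_sets_Int insert.IH) (use S in auto)
    then show ?case by (simp add: Int_left_commute)
  qed
  then have "edges a b \<inter> \<Inter>(S ` (edges a b - {e})) \<in> zero_sets a b"
    using finite_edges by simp
  moreover have "edges a b \<inter> \<Inter>(S ` (edges a b - {e})) = {e}"
    using S e by blast
  ultimately show ?thesis by simp
qed

lemma empty_in_zero_sets: "{} \<in> zero_sets a b"
proof -
  have "{(1, 2)} \<inter> {(2*a, 2*b+1)} \<in> zero_sets a b"
    by (intro zero_sets_Int singleton_in_zero_sets) (auto simp: edges_def)
  moreover have "{(1, 2)} \<inter> {(2*a, 2*b+1)} = ({} :: edge set)"
    by auto
  ultimately show ?thesis by simp
qed

section \<open>The Gelfand--Tsetlin polytope\<close>

text \<open>
  With \<open>b\<close> ones and \<open>a\<close> twos the free entries are those at \<open>(b + r, j)\<close> for \<open>1 \<le> r \<le> a\<close> and \<open>1 \<le> j \<le> b\<close>; the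
  adjoined vertices \<open>(0, 1)\<close> and \<open>(a, b + 1)\<close> correspond to fixed entries \<open>1\<close> and \<open>2\<close>.
\<close>

definition grid_entry :: "nat \<Rightarrow> ((nat \<times> nat) \<Rightarrow>\<^sub>0 real) \<Rightarrow> nat \<times> nat \<Rightarrow> real" where
  "grid_entry b x v = Poly_Mapping.lookup x (b + fst v, snd v)"

definition slack :: "nat \<Rightarrow> edge \<Rightarrow> ((nat \<times> nat) \<Rightarrow>\<^sub>0 real) \<Rightarrow> real" where
  "slack b e x = grid_entry b x (hi e) - grid_entry b x (lo e)"

definition GT_affine :: "nat \<Rightarrow> nat \<Rightarrow> ((nat \<times> nat) \<Rightarrow>\<^sub>0 real) set" where
  "GT_affine a b = {x. Poly_Mapping.keys x \<subseteq> GT_index (a + b) \<and>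
     (\<forall>i j. 1 \<le> j \<and> j \<le> i \<and> i \<le> b \<longrightarrow> Poly_Mapping.lookup x (i, j) = 1) \<and>
     (\<forall>i j. b < j \<and> j \<le> i \<and> i \<le> a + b \<longrightarrow> Poly_Mapping.lookup x (i, j) = 2)}"

abbreviation (input) two_step :: "nat \<Rightarrow> nat \<Rightarrow> nat list" where
  "two_step a b \<equiv> replicate b 1 @ replicate a 2"

text \<open>The path changes \<open>i\<close> first and then \<open>j\<close>, which keeps it inside
  the triangle.\<close>

lemma GT_polytope_mono:
  assumes x: "x \<in> GT_polytope lam" and ij: "1 \<le> j" "j \<le> j'" "j' \<le> i'" "i' \<le> length lam" "j \<le> i" "i \<le> i'"
  shows "Poly_Mapping.lookup x (i, j) \<le> Poly_Mapping.lookup x (i', j')"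
proof -
  have "Poly_Mapping.lookup x (i, j) \<le> Poly_Mapping.lookup x (i', j)"
    using ij(6,4)
  proof (induction i' rule: dec_induct)
    case (step k)
    have "Poly_Mapping.lookup x (k, j) \<le> Poly_Mapping.lookup x (k + 1, j)"
      using x ij(1,5) step by (simp add: GT_polytope_def GT_index_def)
    then show ?case using step by simp
  qed simp
  also have "\<dots> \<le> Poly_Mapping.lookup x (i', j')"
    using ij(2,3)
  proof (induction j' rule: dec_induct)
    case (step k)
    have "Poly_Mapping.lookup x (i', k) \<le> Poly_Mapping.lookup x (i', k + 1)"
      using x ij(1,4) step by (simp add: GT_polytope_def GT_index_def)
    then show ?case using step by simp
  qed simp
  finally show ?thesis .
qed

lemma two_step_nth: "i < a + b \<Longrightarrow> two_step a b ! i = (if i < b then 1 else 2)"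
  by (auto simp: nth_append)

text \<open>The entry at \<open>(i, j)\<close> lies between the diagonal entries in positions
  \<open>j\<close> and \<open>i\<close>, so it is forced where these agree.\<close>

lemma GT_polytope_affine:
  assumes x: "x \<in> GT_polytope (two_step a b)"
  shows "x \<in> GT_affine a b"
proof -
  have diag: "Poly_Mapping.lookup x (i, i) = (if i \<le> b then 1 else 2)" if "1 \<le> i" "i \<le> a + b" for i
    using x that two_step_nth [of "i - 1" a b] by (auto simp: GT_polytope_def)
  have "Poly_Mapping.lookup x (i, j) = 1" if "1 \<le> j" "j \<le> i" "i \<le> b" for i j
    using GT_polytope_mono [OF x, of j j i j] GT_polytope_mono [OF x, of j i i i] diag [of i] diag [of j] that
    by simp
  moreover have "Poly_Mapping.lookup x (i, j) = 2" if "b < j" "j \<le> i" "i \<le> a + b" for i j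
    using GT_polytope_mono [OF x, of j j i j] GT_polytope_mono [OF x, of j i i i] diag [of i] diag [of j] that
    by simp
  ultimately show ?thesis
    using x by (simp add: GT_affine_def GT_polytope_def add.commute)
qed

section \<open>Slacks of the grid edges and points with prescribed slacks\<close>

context
  fixes a b :: nat
  assumes a1: "1 \<le> a" and b1: "1 \<le> b"
begin

lemma row_edge: "1 \<le> r \<Longrightarrow> r \<le> a \<Longrightarrow> 1 \<le> j \<Longrightarrow> j < b \<Longrightarrow> (2*r, Suc (2*j)) \<in> edges a b"
  and col_edge: "1 \<le> r \<Longrightarrow> r < a \<Longrightarrow> 1 \<le> j \<Longrightarrow> j \<le> b \<Longrightarrow> (Suc (2*r), 2*j) \<in> edges a b"
  and bottom_edge: "(Suc 0, 2) \<in> edges a b" and top_edge: "(2*a, Suc (2*b)) \<in> edges a b"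
  by (auto simp: edges_def inner_edges_def)

lemma bottom_ends: "lo (Suc 0, 2) = (0, 1)" "hi (Suc 0, 2) = (1, 1)"
  by (simp_all add: lo_def hi_def)

lemma slack_nonneg:
  assumes x: "x \<in> GT_polytope (two_step a b)" and e: "e \<in> edges a b"
  shows "0 \<le> slack b e x"
  using e
proof (cases rule: edge_cases)
  case (row i j)
  then show ?thesis
    using GT_polytope_mono [OF x, of j "Suc j" "b + i" "b + i"] a1 b1
    by (auto simp: slack_def grid_entry_def)
next
  case (col i j)
  then show ?thesis
    using GT_polytope_mono [OF x, of j j "b + Suc i" "b + i"] a1 b1
    by (auto simp: slack_def grid_entry_def)
qed

text \<open>Interlacing inequalities that are not edges compare a grid entry with a forced one. They
  follow from the outer edges by monotonicity: the first row is at least its first entry, the last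
  column at most its last.\<close>

lemma GT_polytopeI:
  assumes x: "x \<in> GT_affine a b" and nn: "\<And>e. e \<in> edges a b \<Longrightarrow> 0 \<le> slack b e x"
  shows "x \<in> GT_polytope (two_step a b)"
proof -
  let ?x = "Poly_Mapping.lookup x"
  have one: "?x (i, j) = 1" if "1 \<le> j" "j \<le> i" "i \<le> b" for i j
    using x that by (simp add: GT_affine_def)
  have two: "?x (i, j) = 2" if "b < j" "j \<le> i" "i \<le> a + b" for i j
    using x that by (simp add: GT_affine_def)
  have row: "?x (b + r, j) \<le> ?x (b + r, Suc j)" if "1 \<le> r" "r \<le> a" "1 \<le> j" "j < b" for r j
    using nn [OF row_edge [OF that]] by (simp add: slack_def grid_entry_def)
  have col: "?x (b + r, j) \<le> ?x (Suc (b + r), j)" if "1 \<le> r" "r < a" "1 \<le> j" "j \<le> b" for r j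
    using nn [OF col_edge [OF that]] by (simp add: slack_def grid_entry_def)
  have bot: "1 \<le> ?x (Suc b, 1)"
    using nn [OF bottom_edge] one [of 1 b] b1 by (simp add: slack_def grid_entry_def bottom_ends)
  have top: "?x (b + a, b) \<le> 2"
    using nn [OF top_edge] two [of "Suc b" "b + a"] a1 by (simp add: slack_def grid_entry_def)
  have first_row: "1 \<le> ?x (Suc b, j)" if "1 \<le> j" "j \<le> b" for j
    using that
  proof (induction j rule: nat_induct_at_least)
    case (Suc j)
    then show ?case using row [of 1 j] a1 by simp
  qed (rule bot)
  have last_col: "?x (b + r, b) \<le> 2" if "r \<le> a" "1 \<le> r" for r
    using that
  proof (induction r rule: inc_induct)
    case (step r)
    then show ?case using col [of r b] b1 by simp
  qed (rule top)
  have "?x (i, j) \<le> ?x (i + 1, j)" if "1 \<le> j" "j \<le> i" "i + 1 \<le> a + b" for i j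
  proof -
    consider "i < b" | "i = b" | "b < i" "j \<le> b" | "b < j" using that by linarith
    then show ?thesis
    proof cases
      case 3
      then show ?thesis using col [of "i - b" j] that by simp
    qed (use one two first_row that in auto)
  qed
  moreover have "?x (i, j) \<le> ?x (i, j + 1)" if "1 \<le> j" "j + 1 \<le> i" "i \<le> a + b" for i j
  proof -
    consider "i \<le> b" | "b < i" "j < b" | "b < i" "j = b" | "b < j" by linarith
    then show ?thesis
    proof cases
      case 2
      then show ?thesis using row [of "i - b" j] that by simp
    next
      case 3
      then show ?thesis using last_col [of "i - b"] two [of "b + 1" i] that by simp
    qed (use one two that in auto)
  qed
  moreover have "?x (i, i) = real (two_step a b ! (i - 1))" if "i \<in> {1..a + b}" for i
    using that two_step_nth [of "i - 1" a b] one [of i i] two [of i i] by (cases "i \<le> b") auto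
  ultimately show ?thesis
    using x by (simp add: GT_polytope_def GT_affine_def GT_index_def add.commute)
qed

lemma GT_polytope_eq:
  "GT_polytope (two_step a b) = {x \<in> GT_affine a b. \<forall>e\<in>edges a b. 0 \<le> slack b e x}"
  using GT_polytopeI slack_nonneg GT_polytope_affine by blast

lemma lookup_line:
  "Poly_Mapping.lookup ((1 - t) *\<^sub>R x + t *\<^sub>R y) v = (1 - t) * Poly_Mapping.lookup x v + t * Poly_Mapping.lookup y v"
  for x y :: "(nat \<times> nat) \<Rightarrow>\<^sub>0 real"
proof -
  have "Poly_Mapping.lookup (c *\<^sub>R z) v = c * Poly_Mapping.lookup z v" for c and z :: "(nat \<times> nat) \<Rightarrow>\<^sub>0 real"
  proof -
    have "finite {i. c *\<^sub>R Poly_Mapping.lookup z i \<noteq> 0}"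
      by (rule finite_subset [OF _ finite_lookup [of z]]) auto
    then show ?thesis
      by (simp add: scaleR_poly_mapping_def)
  qed
  then show ?thesis by (simp add: lookup_add)
qed

lemma slack_polyhedron_GT:
  "slack_polyhedron (GT_affine a b) (edges a b) (slack b) (GT_polytope (two_step a b))"
proof
  fix x y and t :: real
  assume xy: "x \<in> GT_affine a b" "y \<in> GT_affine a b"
  have "Poly_Mapping.keys ((1 - t) *\<^sub>R x + t *\<^sub>R y) \<subseteq> Poly_Mapping.keys x \<union> Poly_Mapping.keys y"
    by (auto simp: in_keys_iff lookup_line)
  then show "(1 - t) *\<^sub>R x + t *\<^sub>R y \<in> GT_affine a b"
    using xy by (auto simp: GT_affine_def lookup_line)
  show "slack b e ((1 - t) *\<^sub>R x + t *\<^sub>R y) = (1 - t) * slack b e x + t * slack b e y" for e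
    unfolding slack_def grid_entry_def lookup_line by (simp add: algebra_simps)
qed (rule finite_edges, rule GT_polytope_eq)

text \<open>Summing a balanced weighting along a path from the bottom recovers a point with the given slacks.\<close>

definition potential :: "(edge \<Rightarrow> real) \<Rightarrow> nat \<Rightarrow> nat \<Rightarrow> real" where
  "potential s r j = s (1, 2) + (\<Sum>k=1..<j. s (2, 2*k+1)) + (\<Sum>l=1..<r. s (2*l+1, 2*j))"

lemma potential_col: "1 \<le> r \<Longrightarrow> potential s (Suc r) j - potential s r j = s (2*r+1, 2*j)"
  by (simp add: potential_def)

text \<open>Path independence: \<open>potential\<close> runs along the first row and then across the
  rows, and the balance of the square \<open>(r, j)\<close> carries the difference from row
  \<open>r\<close> to row \<open>r + 1\<close>.\<close>

lemma potential_row: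
  assumes s: "balanced a b s" and j: "1 \<le> j" "j < b" and r: "1 \<le> r" "r \<le> a"
  shows "potential s r (Suc j) - potential s r j = s (2*r, 2*j+1)"
  using r
proof (induction r rule: nat_induct_at_least)
  case base
  then show ?case using j by (simp add: potential_def)
next
  case (Suc r)
  then have "potential s r (Suc j) - potential s r j = s (2*r, 2*j+1)" by simp
  moreover have "s (2*r, 2*j+1) + s (2*r+1, 2*j+2) = s (2*r+1, 2*j) + s (2*r+2, 2*j+1)"
    using s j Suc by (simp add: balanced_def)
  ultimately show ?case
    using potential_col [of r s j] potential_col [of r s "Suc j"] Suc by simp
qed

text \<open>The total rise from the adjoined bottom to the adjoined top. Dividing by it makes the
  rise \<open>2 - 1\<close>, as the forced entries require.\<close>

definition height :: "(edge \<Rightarrow> real) \<Rightarrow> real" where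
  "height s = potential s a b + s (2*a, 2*b+1)"

definition pattern :: "(edge \<Rightarrow> real) \<Rightarrow> nat \<times> nat \<Rightarrow> real" where
  "pattern s = (\<lambda>(i, j). if (i, j) \<in> GT_index (a + b)
     then if i \<le> b then 1 else if b < j then 2 else 1 + potential s (i - b) j / height s else 0)"

lemma finite_GT_index: "finite (GT_index n)"
proof -
  have "GT_index n \<subseteq> {..n} \<times> {..n}" by (auto simp: GT_index_def)
  then show ?thesis by (rule finite_subset) simp
qed

definition pattern_point :: "(edge \<Rightarrow> real) \<Rightarrow> (nat \<times> nat) \<Rightarrow>\<^sub>0 real" where
  "pattern_point s = Abs_poly_mapping (pattern s)"

lemma lookup_pattern: "Poly_Mapping.lookup (pattern_point s) = pattern s"
  unfolding pattern_point_def
proof (rule lookup_Abs_poly_mapping)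
  have "{v. pattern s v \<noteq> 0} \<subseteq> GT_index (a + b)"
    by (auto simp: pattern_def split: if_splits)
  then show "finite {v. pattern s v \<noteq> 0}"
    by (rule finite_subset) (rule finite_GT_index)
qed

lemma pattern_affine: "pattern_point s \<in> GT_affine a b"
proof -
  have "Poly_Mapping.keys (pattern_point s) \<subseteq> GT_index (a + b)"
    by (auto simp: in_keys_iff lookup_pattern pattern_def split: if_splits)
  then show ?thesis
    by (auto simp: GT_affine_def lookup_pattern pattern_def GT_index_def)
qed

lemma slack_pattern:
  assumes s: "balanced a b s" and tot: "height s \<noteq> 0" and e: "e \<in> edges a b"
  shows "slack b e (pattern_point s) = s e / height s"
  using e
proof (cases rule: edge_cases)
  case (row i j)
  from row(2) show ?thesis
  proof
    assume ij: "1 \<le> i \<and> i \<le> a \<and> 1 \<le> j \<and> j < b"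
    then have "slack b e (pattern_point s) = (potential s i (Suc j) - potential s i j) / height s"
      by (simp add: row(1) slack_def grid_entry_def lookup_pattern pattern_def GT_index_def diff_divide_distrib)
    then show ?thesis using potential_row [OF s] ij row(1) by simp
  next
    assume ij: "i = a \<and> j = b"
    have "2 - (1 + potential s a b / height s) = (height s - potential s a b) / height s"
      using tot by (simp add: field_simps)
    then show ?thesis
      using ij a1 b1 by (simp add: row(1) slack_def grid_entry_def lookup_pattern pattern_def GT_index_def height_def)
  qed
next
  case (col i j)
  from col(2) show ?thesis
  proof
    assume ij: "1 \<le> i \<and> i < a \<and> 1 \<le> j \<and> j \<le> b"
    then have "slack b e (pattern_point s) = (potential s (Suc i) j - potential s i j) / height s"
      by (simp add: col(1) slack_def grid_entry_def lookup_pattern pattern_def GT_index_def diff_divide_distrib)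
    then show ?thesis using potential_col ij col(1) by simp
  next
    assume ij: "i = 0 \<and> j = 1"
    then show ?thesis
      using a1 b1 by (simp add: col(1) slack_def grid_entry_def lookup_pattern pattern_def GT_index_def
          bottom_ends potential_def)
  qed
qed

lemma potential_nonneg:
  assumes nn: "\<And>e. e \<in> edges a b \<Longrightarrow> 0 \<le> s e" and rj: "1 \<le> r" "r \<le> a" "1 \<le> j" "j \<le> b"
  shows "0 \<le> potential s r j"
  unfolding potential_def using nn bottom_edge row_edge [of 1] col_edge a1 rj
  by (intro add_nonneg_nonneg sum_nonneg) auto

text \<open>\<open>potential\<close> is nonnegative, increases along edges and is at most 0 at the
  last vertex, so it vanishes. Hence a weighting that cannot be rescaled to a point is zero on all
  edges.\<close>

lemma height_eq_0:
  assumes s: "balanced a b s" and nn: "\<And>e. e \<in> edges a b \<Longrightarrow> 0 \<le> s e" and tot: "height s = 0"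
    and e: "e \<in> edges a b"
  shows "s e = 0"
proof -
  have row: "potential s r j \<le> potential s r (Suc j)" if "1 \<le> r" "r \<le> a" "1 \<le> j" "j < b" for r j
    using potential_row [OF s that(3,4,1,2)] nn [OF row_edge [OF that]] by simp
  have col: "potential s r j \<le> potential s (Suc r) j" if "1 \<le> r" "r < a" "1 \<le> j" "j \<le> b" for r j
    using potential_col [OF that(1), of s j] nn [OF col_edge [OF that]] by simp
  have top: "potential s a b \<le> 0" "s (2*a, 2*b+1) = 0"
    using potential_nonneg [of s a b, OF nn] nn [OF top_edge] tot a1 b1 by (simp_all add: height_def)
  have last: "potential s r b \<le> 0" if "r \<le> a" "1 \<le> r" for r
    using that
  proof (induction r rule: inc_induct)
    case (step r)
    then show ?case using col [of r b] b1 by simp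
  qed (rule top)
  have "potential s r j \<le> 0" if "j \<le> b" "1 \<le> j" "1 \<le> r" "r \<le> a" for r j
    using that
  proof (induction j rule: inc_induct)
    case (step j)
    then show ?case using row [of r j] by simp
  qed (simp add: last)
  then have zero: "potential s r j = 0" if "j \<le> b" "1 \<le> j" "1 \<le> r" "r \<le> a" for r j
    using potential_nonneg [of s r j, OF nn] that by (simp add: order_antisym)
  from e show ?thesis
  proof (cases rule: edge_cases)
    case (row i j)
    then show ?thesis
      using top(2) potential_row [OF s, of j i] zero [of j i] zero [of "Suc j" i] by auto
  next
    case (col i j)
    from col(2) show ?thesis
    proof
      assume "1 \<le> i \<and> i < a \<and> 1 \<le> j \<and> j \<le> b"
      then show ?thesis
        using potential_col [of i s j] zero [of j i] zero [of j "Suc i"] by (simp add: col(1))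
    next
      assume "i = 0 \<and> j = 1"
      then show ?thesis
        using zero [of 1 1] a1 b1 by (simp add: col(1) potential_def)
    qed
  qed
qed

lemma balanced_slack: "balanced a b (\<lambda>e. slack b e x)"
  by (simp add: balanced_def slack_def lo_def hi_def)

text \<open>Otherwise a path of equalities would join the forced entries 1 and 2.\<close>

lemma edges_not_zeros:
  assumes x: "x \<in> GT_polytope (two_step a b)"
  shows "\<exists>e\<in>edges a b. slack b e x \<noteq> 0"
proof (rule ccontr)
  assume "\<not> ?thesis"
  then have z: "\<And>e. e \<in> edges a b \<Longrightarrow> slack b e x = 0" by blast
  let ?g = "\<lambda>r j. Poly_Mapping.lookup x (b + r, j)"
  have aff: "x \<in> GT_affine a b" by (rule GT_polytope_affine [OF x])
  have "?g 1 1 = 1"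
    using z [OF bottom_edge] aff b1 by (simp add: slack_def grid_entry_def bottom_ends GT_affine_def)
  moreover have "?g 1 j = ?g 1 1" if "1 \<le> j" "j \<le> b" for j
    using that
  proof (induction j rule: nat_induct_at_least)
    case (Suc j)
    then show ?case using z [OF row_edge [of 1 j]] a1 by (simp add: slack_def grid_entry_def lo_def hi_def)
  qed simp
  moreover have "?g r b = ?g 1 b" if "1 \<le> r" "r \<le> a" for r
    using that
  proof (induction r rule: nat_induct_at_least)
    case (Suc r)
    then show ?case using z [OF col_edge [of r b]] b1 by (simp add: slack_def grid_entry_def)
  qed simp
  moreover have "?g a b = 2"
    using z [OF top_edge] aff a1 by (simp add: slack_def grid_entry_def GT_affine_def)
  ultimately show False using a1 b1 by simp
qed

interpretation GT: slack_polyhedron "GT_affine a b" "edges a b" "slack b" "GT_polytope (two_step a b)"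
  by (rule slack_polyhedron_GT)

lemma edges_not_in_GT_zeros: "edges a b \<notin> GT.zeros ` GT_polytope (two_step a b)"
  using edges_not_zeros by (force simp: GT.zeros_def)

text \<open>The slacks of a point form a balanced weighting. Conversely, a weighting of nonzero
  height is up to scaling the slack vector of \<open>pattern_point\<close>, and height zero gives
  the adjoined set of all edges.\<close>

lemma GT_zeros: "insert (edges a b) (GT.zeros ` GT_polytope (two_step a b)) = zero_sets a b"
proof (intro equalityI subsetI)
  fix S assume "S \<in> insert (edges a b) (GT.zeros ` GT_polytope (two_step a b))"
  then consider "S = edges a b" | x where "x \<in> GT_polytope (two_step a b)" "S = GT.zeros x" by blast
  then show "S \<in> zero_sets a b"
  proof cases
    case 1
    then show ?thesis by (simp add: edges_in_zero_sets)
  next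
    case 2
    then show ?thesis
      unfolding zero_sets_def
      by (intro CollectI exI [of _ "\<lambda>e. slack b e x"]) (simp add: slack_nonneg balanced_slack GT.zeros_def)
  qed
next
  fix S assume "S \<in> zero_sets a b"
  then obtain s where S: "S = {e \<in> edges a b. s e = 0}" and nn: "\<And>e. e \<in> edges a b \<Longrightarrow> 0 \<le> s e"
    and s: "balanced a b s"
    unfolding zero_sets_def by blast
  show "S \<in> insert (edges a b) (GT.zeros ` GT_polytope (two_step a b))"
  proof (cases "height s = 0")
    case True
    then show ?thesis using height_eq_0 [OF s nn] S by auto
  next
    case False
    let ?x = "pattern_point s"
    have "0 \<le> height s"
      unfolding height_def using potential_nonneg [of s a b, OF nn] nn [OF top_edge] a1 b1 by simp
    then have "?x \<in> GT_polytope (two_step a b)"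
      using slack_pattern [OF s False] nn by (intro GT_polytopeI pattern_affine) simp
    moreover have "GT.zeros ?x = S"
      using slack_pattern [OF s False] False by (auto simp: GT.zeros_def S)
    ultimately show ?thesis by blast
  qed
qed

lemma GT_aut_group_iso:
  "perm_aut_group (edges a b) (zero_sets a b) \<cong> combinatorial_aut_group (GT_polytope (two_step a b))"
proof -
  have mem: "S \<in> GT.zeros ` GT_polytope (two_step a b)" if "S \<in> zero_sets a b" "S \<noteq> edges a b" for S
    using that unfolding GT_zeros [symmetric] by blast
  have "{} \<noteq> edges a b" "{e} \<noteq> edges a b" for e
    by (auto simp: edges_def)
  then have "perm_aut_group (edges a b) (insert (edges a b) (GT.zeros ` GT_polytope (two_step a b)))
      \<cong> combinatorial_aut_group (GT_polytope (two_step a b))"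
    by (intro GT.combinatorial_aut_group_iso edges_not_in_GT_zeros mem empty_in_zero_sets singleton_in_zero_sets)
  then show ?thesis
    unfolding GT_zeros .
qed

end

section \<open>Rigidity of the edge automorphisms\<close>

text \<open>The corner vertex \<open>(1, b)\<close> lies on these two edges only, and they occur on
  the same side of a single square equation. On the polytope this reflects the corner entry between
  its two neighbours.\<close>

definition flip_SE :: "nat \<Rightarrow> edge \<Rightarrow> edge" where
  "flip_SE b = Transposition.transpose (2, 2*b-1) (3, 2*b)"

definition flip_NW :: "nat \<Rightarrow> edge \<Rightarrow> edge" where
  "flip_NW a = Transposition.transpose (2*a-1, 2) (2*a, 3)"

text \<open>The outer edges stay fixed, although turning the poset upside down would exchange bottom
  and top; that exchange is left to \<open>outer_swap\<close>, which becomes an independent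
  factor.\<close>

definition rotation :: "nat \<Rightarrow> nat \<Rightarrow> edge \<Rightarrow> edge" where
  "rotation a b e = (if e \<in> inner_edges a b then (2*a+2 - fst e, 2*b+2 - snd e) else e)"

definition outer_swap :: "nat \<Rightarrow> nat \<Rightarrow> edge \<Rightarrow> edge" where
  "outer_swap a b = Transposition.transpose (1, 2) (2*a, 2*b+1)"

definition antitranspose :: "nat \<Rightarrow> edge \<Rightarrow> edge" where
  "antitranspose a e = (if e \<in> inner_edges a a then (2*a+2 - snd e, 2*a+2 - fst e) else e)"

abbreviation edge_group :: "nat \<Rightarrow> nat \<Rightarrow> (edge \<Rightarrow> edge) monoid" where
  "edge_group a b \<equiv> perm_aut_group (edges a b) (zero_sets a b)"

text \<open>Composing a weighting with \<open>p\<close> replaces its zero set by the preimage under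
  \<open>p\<close>, which for an involution is the image.\<close>

lemma involution_in_edge_group:
  assumes "\<And>e. e \<in> edges a b \<Longrightarrow> p e \<in> edges a b" "\<And>e. e \<notin> edges a b \<Longrightarrow> p e = e"
    and invol: "\<And>e. p (p e) = e" and bal: "\<And>s. balanced a b s \<Longrightarrow> balanced a b (s \<circ> p)"
  shows "p \<in> carrier (edge_group a b)"
proof -
  have perm: "p permutes edges a b"
    using assms(2) invol unfolding permutes_def by metis
  have fwd: "p ` S \<in> zero_sets a b" if S: "S \<in> zero_sets a b" for S
  proof -
    obtain s where s: "S = {e \<in> edges a b. s e = 0}" "\<forall>e\<in>edges a b. 0 \<le> s e" "balanced a b s"
      using S unfolding zero_sets_def by blast
    have "p ` S = {e \<in> edges a b. (s \<circ> p) e = 0}"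
    proof (intro equalityI subsetI)
      fix e assume "e \<in> p ` S"
      then show "e \<in> {e \<in> edges a b. (s \<circ> p) e = 0}"
        using s(1) assms(1) invol by auto
    next
      fix e assume "e \<in> {e \<in> edges a b. (s \<circ> p) e = 0}"
      then have "p e \<in> S" using s(1) assms(1) by simp
      then show "e \<in> p ` S" using invol [of e] by (metis image_eqI)
    qed
    then show ?thesis
      using s bal [OF s(3)] assms(1) unfolding zero_sets_def
      by (intro CollectI exI [of _ "s \<circ> p"]) simp
  qed
  have "S \<in> zero_sets a b \<longleftrightarrow> p ` S \<in> zero_sets a b" for S
  proof
    assume "p ` S \<in> zero_sets a b"
    then have "p ` p ` S \<in> zero_sets a b" by (rule fwd)
    then show "S \<in> zero_sets a b" by (simp add: image_image invol)
  qed (rule fwd)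
  then show ?thesis
    using perm by (simp add: perm_aut_group_def)
qed

lemma edge_group_opposite:
  assumes p: "p \<in> carrier (edge_group a b)" and efg: "e \<in> edges a b" "f \<in> edges a b" "g \<in> edges a b"
  shows "opposite a b (p e) (p f) (p g) \<longleftrightarrow> opposite a b e f g"
proof -
  have perm: "p permutes edges a b" and C: "\<And>S. S \<subseteq> edges a b \<Longrightarrow> S \<in> zero_sets a b \<longleftrightarrow> p ` S \<in> zero_sets a b"
    using p by (auto simp: perm_aut_group_def)
  have inj: "p x = p y \<longleftrightarrow> x = y" for x y
    using permutes_inj [OF perm] by (simp add: inj_eq)
  have mem: "p x \<in> p ` S \<longleftrightarrow> x \<in> S" for x S
    using permutes_inj [OF perm] by (rule inj_image_mem_iff)
  have eq: "zero_sets a b = (`) p ` zero_sets a b"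
  proof (intro equalityI subsetI)
    fix S assume S: "S \<in> zero_sets a b"
    then have "S \<subseteq> p ` edges a b"
      using zero_sets_subset permutes_image [OF perm] by auto
    then obtain T where "T \<subseteq> edges a b" "S = p ` T"
      by (auto simp: subset_image_iff)
    then show "S \<in> (`) p ` zero_sets a b"
      using C [of T] S by blast
  next
    fix S assume "S \<in> (`) p ` zero_sets a b"
    then show "S \<in> zero_sets a b"
      using C zero_sets_subset by blast
  qed
  have "(\<forall>S\<in>zero_sets a b. p e \<in> S \<longrightarrow> p f \<in> S \<longrightarrow> p g \<in> S) \<longleftrightarrow>
      (\<forall>S\<in>zero_sets a b. p e \<in> p ` S \<longrightarrow> p f \<in> p ` S \<longrightarrow> p g \<in> p ` S)"
    by (subst eq) (simp only: ball_simps)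
  also have "\<dots> \<longleftrightarrow> (\<forall>S\<in>zero_sets a b. e \<in> S \<longrightarrow> f \<in> S \<longrightarrow> g \<in> S)"
    by (simp only: mem)
  finally show ?thesis
    using efg permutes_in_image [OF perm] by (simp add: opposite_iff inj)
qed

section \<open>Partners and zigzags\<close>

definition partner :: "nat \<Rightarrow> nat \<Rightarrow> edge \<Rightarrow> edge \<Rightarrow> bool" where
  "partner a b e f \<longleftrightarrow> (\<exists>g. opposite a b e f g)"

text \<open>The parity of \<open>x\<close> tells which of the two paths of a square the diagonal
  step is.\<close>

lemma partner_Suc:
  assumes "(x, y) \<in> inner_edges a b" "(Suc x, Suc y) \<in> inner_edges a b"
  shows "partner a b (x, y) (Suc x, Suc y)"
proof (cases "even x")
  case True
  then obtain i j where ij: "x = 2*i" "y = 2*j+1"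
    using assms(1) by (auto simp: inner_edges_def elim!: evenE oddE)
  then have "1 \<le> i" "i < a" "1 \<le> j" "j < b"
    using assms by (auto simp: inner_edges_def)
  then have "opposite a b (x, y) (Suc x, Suc y) (2*i+1, 2*j)"
    unfolding opposite_def ij by (intro exI [of _ i] exI [of _ j]) simp
  then show ?thesis unfolding partner_def by blast
next
  case False
  then obtain i j where ij: "x = 2*i+1" "y = 2*j"
    using assms(1) by (auto simp: inner_edges_def elim!: evenE oddE)
  then have "1 \<le> i" "i < a" "1 \<le> j" "j < b"
    using assms by (auto simp: inner_edges_def)
  then have "opposite a b (x, y) (Suc x, Suc y) (2*i, 2*j+1)"
    unfolding opposite_def ij by (intro exI [of _ i] exI [of _ j]) simp
  then show ?thesis unfolding partner_def by blast
qed

lemma opposite_mem: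
  assumes "opposite a b e f g"
  shows "e \<in> inner_edges a b" "f \<in> inner_edges a b" "g \<in> inner_edges a b"
  using assms by (auto simp: opposite_def inner_edges_def doubleton_eq_iff)

lemma partner_commute: "partner a b e f \<longleftrightarrow> partner a b f e"
  by (simp add: partner_def opposite_commute [of a b e f])

lemma partner_iff:
  "partner a b (x, y) (u, v) \<longleftrightarrow>
    (x, y) \<in> inner_edges a b \<and> (u, v) \<in> inner_edges a b \<and> (u = Suc x \<and> v = Suc y \<or> x = Suc u \<and> y = Suc v)"
  (is "?L \<longleftrightarrow> ?R")
proof
  assume ?L
  then obtain g where g: "opposite a b (x, y) (u, v) g" by (auto simp: partner_def)
  show ?R
    using opposite_mem [OF g] g by (auto simp: opposite_def doubleton_eq_iff)
next
  assume ?R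
  then show ?L
    using partner_Suc partner_commute by blast
qed

locale grid =
  fixes a b :: nat
  assumes a2: "2 \<le> a" and b2: "2 \<le> b"
begin

abbreviation "I \<equiv> inner_edges a b"

definition end_edge :: "edge \<Rightarrow> bool" where
  "end_edge e \<longleftrightarrow> fst e = 2 \<or> snd e = 2 \<or> fst e = 2*a \<or> snd e = 2*b"

text \<open>Having a partner singles out the inner edges. If the upward step is blocked at an even
  maximal coordinate, parity makes the other coordinate at least 3, so the downward step
  exists.\<close>

lemma inner_partner: "e \<in> I \<Longrightarrow> \<exists>f. partner a b e f"
proof -
  assume e: "e \<in> I"
  obtain x y where xy: "e = (x, y)" by (cases e)
  show ?thesis
  proof (cases "x < 2*a \<and> y < 2*b")
    case True
    then show ?thesis
      using e xy by (intro exI [of _ "(Suc x, Suc y)"]) (auto simp: partner_iff inner_edges_def)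
  next
    case False
    have "2 \<le> x" "2 \<le> y" "x \<le> 2*a" "y \<le> 2*b" "odd (x + y)"
      using e xy by (auto simp: inner_edges_def)
    then have "2 \<le> x - 1 \<and> 2 \<le> y - 1 \<and> odd (x - 1 + (y - 1)) \<and> x - 1 \<le> 2*a \<and> y - 1 \<le> 2*b"
      using False a2 b2 by presburger
    then have "(x - 1, y - 1) \<in> I" "Suc (x - 1) = x" "Suc (y - 1) = y"
      by (auto simp: inner_edges_def)
    then show ?thesis
      using e xy by (intro exI [of _ "(x - 1, y - 1)"]) (simp add: partner_iff)
  qed
qed

text \<open>A bordering coordinate removes one of the two diagonal neighbours. This expresses the
  ends of zigzags through partners alone, which automorphisms preserve.\<close>

lemma end_edge_iff:
  assumes "e \<in> I"
  shows "end_edge e \<longleftrightarrow> (\<forall>f g. partner a b e f \<longrightarrow> partner a b e g \<longrightarrow> f = g)"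
proof -
  obtain x y where xy: "e = (x, y)" by (cases e)
  show ?thesis
  proof
    assume "end_edge e"
    then show "\<forall>f g. partner a b e f \<longrightarrow> partner a b e g \<longrightarrow> f = g"
      using assms unfolding xy by (auto simp: end_edge_def partner_iff inner_edges_def)
  next
    assume R: "\<forall>f g. partner a b e f \<longrightarrow> partner a b e g \<longrightarrow> f = g"
    show "end_edge e"
    proof (rule ccontr)
      assume "\<not> end_edge e"
      then have "2 < x" "2 < y" "x < 2*a" "y < 2*b" "odd (x + y)"
        using assms unfolding xy by (auto simp: end_edge_def inner_edges_def)
      then have "partner a b e (Suc x, Suc y)" "partner a b e (x - 1, y - 1)"
        using assms unfolding xy by (auto simp: partner_iff inner_edges_def)
      then have "(Suc x, Suc y) = (x - 1, y - 1)" using R by blast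
      then have "Suc x = x - 1" by simp
      then show False by linarith
    qed
  qed
qed

end

locale grid_aut = grid +
  fixes p :: "edge \<Rightarrow> edge"
  assumes p: "p \<in> carrier (edge_group a b)"
begin

lemma perm: "p permutes edges a b"
  using p by (auto simp: perm_aut_group_def)

lemma p_eq_iff: "p x = p y \<longleftrightarrow> x = y"
  using permutes_inj [OF perm] by (simp add: inj_eq)

lemma inner_subset: "e \<in> I \<Longrightarrow> e \<in> edges a b"
  by (simp add: edges_def)

lemma opposite_p:
  assumes "e \<in> I" "f \<in> I" "g \<in> I"
  shows "opposite a b (p e) (p f) (p g) \<longleftrightarrow> opposite a b e f g"
  using edge_group_opposite [OF p] assms by (simp add: inner_subset)

lemma partner_p:
  assumes "partner a b e f"
  shows "partner a b (p e) (p f)"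
proof -
  obtain g where g: "opposite a b e f g"
    using assms by (auto simp: partner_def)
  then have "opposite a b (p e) (p f) (p g)"
    using opposite_p opposite_mem by blast
  then show ?thesis unfolding partner_def by blast
qed

lemma inner_p: "e \<in> I \<Longrightarrow> p e \<in> I"
  using inner_partner partner_p by (metis partner_iff surj_pair)

lemma image_inner: "p ` I = I"
proof (rule card_subset_eq)
  show "finite I"
    using finite_edges [of a b] by (simp add: edges_def)
  show "card (p ` I) = card I"
    using p_eq_iff by (intro card_image) (simp add: inj_on_def)
qed (use inner_p in blast)

lemma end_edge_p:
  assumes e: "e \<in> I"
  shows "end_edge (p e) \<longleftrightarrow> end_edge e"
proof -
  have preimage: "\<exists>f'. f = p f' \<and> partner a b e f'" if pf: "partner a b (p e) f" for f
  proof -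
    obtain g where g: "opposite a b (p e) f g" using pf by (auto simp: partner_def)
    obtain f' g' where fg: "f = p f'" "g = p g'" "f' \<in> I" "g' \<in> I"
      using opposite_mem [OF g] image_inner by blast
    then show ?thesis
      using g opposite_p [OF e fg(3,4)] unfolding partner_def by blast
  qed
  show ?thesis
    unfolding end_edge_iff [OF e] end_edge_iff [OF inner_p [OF e]]
  proof (intro iffI allI impI)
    fix f g assume "\<forall>f g. partner a b (p e) f \<longrightarrow> partner a b (p e) g \<longrightarrow> f = g"
      and "partner a b e f" "partner a b e g"
    then have "p f = p g" using partner_p by blast
    then show "f = g" by (simp add: p_eq_iff)
  next
    fix f g assume *: "\<forall>f g. partner a b e f \<longrightarrow> partner a b e g \<longrightarrow> f = g"
      and "partner a b (p e) f" "partner a b (p e) g"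
    then obtain f' g' where "f = p f'" "g = p g'" "partner a b e f'" "partner a b e g'"
      using preimage by meson
    then show "f = g" using * by blast
  qed
qed

text \<open>The image of the next edge is a partner of the current image, so it lies one step up or
  down the image diagonal. Down is impossible: at the start it leaves the grid, and later that edge
  is already the image of the previous one.\<close>

lemma zigzag:
  assumes xy: "(x, y) \<in> I" "p (x, y) = (x', y')" and x'y': "x' = 2 \<or> y' = 2"
  shows "(x + k, y + k) \<in> I \<Longrightarrow> p (x + k, y + k) = (x' + k, y' + k)"
proof (induction k rule: less_induct)
  case (less k)
  have ge: "2 \<le> x" "2 \<le> y" "odd (x + y)" using xy by (auto simp: inner_edges_def)
  have I: "(x + m, y + m) \<in> I" if "m \<le> k" for m
    using less.prems ge that by (auto simp: inner_edges_def)
  show ?case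
  proof (cases k)
    case 0
    then show ?thesis using xy by simp
  next
    case (Suc m)
    obtain u v where uv: "p (x + k, y + k) = (u, v)" by (cases "p (x + k, y + k)")
    have "partner a b (x + m, y + m) (x + k, y + k)"
      using I [of m] I [of k] Suc by (simp add: partner_iff)
    then have "partner a b (p (x + m, y + m)) (p (x + k, y + k))"
      by (rule partner_p)
    then have part: "partner a b (x' + m, y' + m) (u, v)"
      using less.IH [of m] I [of m] Suc uv by simp
    show ?thesis
    proof (rule ccontr)
      assume "p (x + k, y + k) \<noteq> (x' + k, y' + k)"
      then have down: "x' + m = Suc u" "y' + m = Suc v" "(u, v) \<in> I"
        using part uv Suc by (auto simp: partner_iff)
      show False
      proof (cases m)
        case 0
        then show ?thesis using down x'y' by (auto simp: inner_edges_def)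
      next
        case (Suc n)
        then have "p (x + n, y + n) = (u, v)"
          using less.IH [of n] I [of n] \<open>k = Suc m\<close> down by simp
        then show ?thesis
          using uv \<open>k = Suc m\<close> Suc p_eq_iff [of "(x + n, y + n)" "(x + k, y + k)"] by simp
      qed
    qed
  qed
qed

end

section \<open>The generators are automorphisms\<close>

lemma transpose_image_mem: "x \<in> A \<Longrightarrow> y \<in> A \<Longrightarrow> e \<in> A \<Longrightarrow> Transposition.transpose x y e \<in> A"
  by (simp add: Transposition.transpose_def)

lemma doubleton_eqI: "x \<in> {u, v} \<Longrightarrow> y \<in> {u, v} \<Longrightarrow> x \<noteq> y \<Longrightarrow> {x, y} = {u, v}"
  by auto

context grid
begin

lemma flip_SE_in: "flip_SE b \<in> carrier (edge_group a b)"
proof (rule involution_in_edge_group)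
  have mem: "(2, 2*b-1) \<in> edges a b" "(3, 2*b) \<in> edges a b"
    using a2 b2 by (auto simp: edges_def inner_edges_def)
  then show "flip_SE b e \<in> edges a b" if "e \<in> edges a b" for e
    using that unfolding flip_SE_def by (intro transpose_image_mem)
  show "flip_SE b e = e" if "e \<notin> edges a b" for e
    using that mem unfolding flip_SE_def by (auto simp: Transposition.transpose_def)
  show "flip_SE b (flip_SE b e) = e" for e
    by (simp add: flip_SE_def)
  fix s assume s: "balanced a b s"
  show "balanced a b (s \<circ> flip_SE b)"
    unfolding balanced_def
  proof (intro allI impI)
    fix i j assume ij: "1 \<le> i \<and> i < a \<and> 1 \<le> j \<and> j < b"
    then have eq: "s (2*i, 2*j+1) + s (2*i+1, 2*j+2) = s (2*i+1, 2*j) + s (2*i+2, 2*j+1)"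
      using s by (simp add: balanced_def)
    obtain c where c: "b = Suc c" using b2 by (cases b) auto
    have "flip_SE b (2*i+1, 2*j) = (2*i+1, 2*j)" "flip_SE b (2*i+2, 2*j+1) = (2*i+2, 2*j+1)"
      using ij by (auto simp: flip_SE_def Transposition.transpose_def c)
    \<comment> \<open>In the corner square the flip exchanges two summands on one side of the
      equation; no other square contains a moved edge.\<close>
    moreover have "flip_SE b (2*i, 2*j+1) = (2*i+1, 2*j+2) \<and> flip_SE b (2*i+1, 2*j+2) = (2*i, 2*j+1) \<or>
        flip_SE b (2*i, 2*j+1) = (2*i, 2*j+1) \<and> flip_SE b (2*i+1, 2*j+2) = (2*i+1, 2*j+2)"
      using ij by (cases "i = 1 \<and> j = c") (auto simp: flip_SE_def Transposition.transpose_def c)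
    ultimately show "(s \<circ> flip_SE b) (2*i, 2*j+1) + (s \<circ> flip_SE b) (2*i+1, 2*j+2) =
        (s \<circ> flip_SE b) (2*i+1, 2*j) + (s \<circ> flip_SE b) (2*i+2, 2*j+1)"
      using eq unfolding o_def by (elim disjE conjE) (simp_all only: add.commute)
  qed
qed

lemma flip_NW_in: "flip_NW a \<in> carrier (edge_group a b)"
proof (rule involution_in_edge_group)
  have mem: "(2*a-1, 2) \<in> edges a b" "(2*a, 3) \<in> edges a b"
    using a2 b2 by (auto simp: edges_def inner_edges_def)
  then show "flip_NW a e \<in> edges a b" if "e \<in> edges a b" for e
    using that unfolding flip_NW_def by (intro transpose_image_mem)
  show "flip_NW a e = e" if "e \<notin> edges a b" for e
    using that mem unfolding flip_NW_def by (auto simp: Transposition.transpose_def)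
  show "flip_NW a (flip_NW a e) = e" for e
    by (simp add: flip_NW_def)
  fix s assume s: "balanced a b s"
  show "balanced a b (s \<circ> flip_NW a)"
    unfolding balanced_def
  proof (intro allI impI)
    fix i j assume ij: "1 \<le> i \<and> i < a \<and> 1 \<le> j \<and> j < b"
    then have eq: "s (2*i, 2*j+1) + s (2*i+1, 2*j+2) = s (2*i+1, 2*j) + s (2*i+2, 2*j+1)"
      using s by (simp add: balanced_def)
    obtain c where c: "a = Suc c" using a2 by (cases a) auto
    have "flip_NW a (2*i, 2*j+1) = (2*i, 2*j+1)" "flip_NW a (2*i+1, 2*j+2) = (2*i+1, 2*j+2)"
      using ij by (auto simp: flip_NW_def Transposition.transpose_def c)
    moreover have "flip_NW a (2*i+1, 2*j) = (2*i+2, 2*j+1) \<and> flip_NW a (2*i+2, 2*j+1) = (2*i+1, 2*j) \<or>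
        flip_NW a (2*i+1, 2*j) = (2*i+1, 2*j) \<and> flip_NW a (2*i+2, 2*j+1) = (2*i+2, 2*j+1)"
      using ij by (cases "i = c \<and> j = 1") (auto simp: flip_NW_def Transposition.transpose_def c)
    ultimately show "(s \<circ> flip_NW a) (2*i, 2*j+1) + (s \<circ> flip_NW a) (2*i+1, 2*j+2) =
        (s \<circ> flip_NW a) (2*i+1, 2*j) + (s \<circ> flip_NW a) (2*i+2, 2*j+1)"
      using eq unfolding o_def by (elim disjE conjE) (simp_all only: add.commute)
  qed
qed

lemma outer_swap_in: "outer_swap a b \<in> carrier (edge_group a b)"
proof (rule involution_in_edge_group)
  have mem: "(1, 2) \<in> edges a b" "(2*a, 2*b+1) \<in> edges a b"
    by (auto simp: edges_def)
  then show "outer_swap a b e \<in> edges a b" if "e \<in> edges a b" for e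
    using that unfolding outer_swap_def by (intro transpose_image_mem)
  show "outer_swap a b e = e" if "e \<notin> edges a b" for e
    using that mem unfolding outer_swap_def by (auto simp: Transposition.transpose_def)
  show "outer_swap a b (outer_swap a b e) = e" for e
    by (simp add: outer_swap_def)
  fix s assume s: "balanced a b s"
  have "outer_swap a b (2*i, 2*j+1) = (2*i, 2*j+1)" "outer_swap a b (2*i+1, 2*j+2) = (2*i+1, 2*j+2)"
    "outer_swap a b (2*i+1, 2*j) = (2*i+1, 2*j)" "outer_swap a b (2*i+2, 2*j+1) = (2*i+2, 2*j+1)"
    if "1 \<le> i \<and> i < a \<and> 1 \<le> j \<and> j < b" for i j
    using that by (auto simp: outer_swap_def Transposition.transpose_def)
  then show "balanced a b (s \<circ> outer_swap a b)"
    using s by (simp add: balanced_def)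
qed

lemma rotation_inner: "e \<in> I \<Longrightarrow> rotation a b e \<in> I"
  by (cases e) (auto simp: rotation_def inner_edges_def)

lemma rotation_rotation: "rotation a b (rotation a b e) = e"
  by (cases e) (auto simp: rotation_def inner_edges_def)

lemma rotation_in: "rotation a b \<in> carrier (edge_group a b)"
proof (rule involution_in_edge_group)
  show "rotation a b e \<in> edges a b" if "e \<in> edges a b" for e
    using that rotation_inner [of e] by (cases "e \<in> I") (auto simp: edges_def rotation_def)
  show "rotation a b e = e" if "e \<notin> edges a b" for e
    using that by (auto simp: rotation_def edges_def)
  show "rotation a b (rotation a b e) = e" for e
    by (rule rotation_rotation)
  fix s assume s: "balanced a b s"
  show "balanced a b (s \<circ> rotation a b)"
    unfolding balanced_def
  proof (intro allI impI)
    fix i j assume ij: "1 \<le> i \<and> i < a \<and> 1 \<le> j \<and> j < b"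
    \<comment> \<open>The half turn carries the square \<open>(i, j)\<close> to the square
      \<open>(a - i, b - j)\<close> and exchanges the two sides of the equation.\<close>
    define k l where "k = a - i" and "l = b - j"
    then have kl: "a = i + k" "b = j + l" "1 \<le> k" "1 \<le> l" using ij by auto
    then have "s (2*k, 2*l+1) + s (2*k+1, 2*l+2) = s (2*k+1, 2*l) + s (2*k+2, 2*l+1)"
      using s ij by (simp add: balanced_def)
    moreover have "rotation a b (2*i, 2*j+1) = (2*k+2, 2*l+1)" "rotation a b (2*i+1, 2*j+2) = (2*k+1, 2*l)"
      "rotation a b (2*i+1, 2*j) = (2*k+1, 2*l+2)" "rotation a b (2*i+2, 2*j+1) = (2*k, 2*l+1)"
      using ij kl(3,4) by (auto simp: rotation_def inner_edges_def kl(1,2))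
    ultimately show "(s \<circ> rotation a b) (2*i, 2*j+1) + (s \<circ> rotation a b) (2*i+1, 2*j+2) =
        (s \<circ> rotation a b) (2*i+1, 2*j) + (s \<circ> rotation a b) (2*i+2, 2*j+1)"
      unfolding o_def by (simp only:)
  qed
qed

lemma antitranspose_in:
  assumes "a = b"
  shows "antitranspose a \<in> carrier (edge_group a b)"
proof (rule involution_in_edge_group)
  have inner: "antitranspose a e \<in> I" if "e \<in> I" for e
    using that assms by (cases e) (auto simp: antitranspose_def inner_edges_def)
  then show "antitranspose a e \<in> edges a b" if "e \<in> edges a b" for e
    using that assms by (cases "e \<in> I") (auto simp: edges_def antitranspose_def)
  show "antitranspose a e = e" if "e \<notin> edges a b" for e
    using that assms by (auto simp: antitranspose_def edges_def)
  show "antitranspose a (antitranspose a e) = e" for e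
    by (cases e) (auto simp: antitranspose_def inner_edges_def)
  fix s assume s: "balanced a b s"
  show "balanced a b (s \<circ> antitranspose a)"
    unfolding balanced_def
  proof (intro allI impI)
    fix i j assume ij: "1 \<le> i \<and> i < a \<and> 1 \<le> j \<and> j < b"
    \<comment> \<open>The square \<open>(i, j)\<close> goes to \<open>(a - j, a - i)\<close>; each
      path stays on its side of the equation with its halves interchanged.\<close>
    define k l where "k = a - j" and "l = a - i"
    then have kl: "a = i + l" "b = i + l" "j + k = i + l" "1 \<le> k" "1 \<le> l" using ij assms by auto
    then have "s (2*k, 2*l+1) + s (2*k+1, 2*l+2) = s (2*k+1, 2*l) + s (2*k+2, 2*l+1)"
      using s ij by (simp add: balanced_def)
    moreover have "antitranspose a (2*i, 2*j+1) = (2*k+1, 2*l+2)" "antitranspose a (2*i+1, 2*j+2) = (2*k, 2*l+1)"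
      "antitranspose a (2*i+1, 2*j) = (2*k+2, 2*l+1)" "antitranspose a (2*i+2, 2*j+1) = (2*k+1, 2*l)"
      using ij kl by (auto simp: antitranspose_def inner_edges_def)
    ultimately show "(s \<circ> antitranspose a) (2*i, 2*j+1) + (s \<circ> antitranspose a) (2*i+1, 2*j+2) =
        (s \<circ> antitranspose a) (2*i+1, 2*j) + (s \<circ> antitranspose a) (2*i+2, 2*j+1)"
      unfolding o_def by (simp only: add.commute)
  qed
qed

lemma opposite_row_iff:
  "opposite a b (2*i, 2*j+1) (2*i+1, 2*j+2) g \<longleftrightarrow>
    1 \<le> i \<and> i < a \<and> 1 \<le> j \<and> j < b \<and> g \<in> {(2*i+1, 2*j), (2*i+2, 2*j+1)}" (is "?L \<longleftrightarrow> ?R")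
proof
  assume ?L
  then show ?R unfolding opposite_def doubleton_eq_iff prod.inject
    by (auto simp: Suc_double_not_eq_double double_not_eq_Suc_double)
next
  assume ?R
  then show ?L unfolding opposite_def by (intro exI [of _ i] exI [of _ j]) blast
qed

lemma opposite_col_iff:
  "opposite a b (2*i+1, 2*j) (2*i+2, 2*j+1) g \<longleftrightarrow>
    1 \<le> i \<and> i < a \<and> 1 \<le> j \<and> j < b \<and> g \<in> {(2*i, 2*j+1), (2*i+1, 2*j+2)}" (is "?L \<longleftrightarrow> ?R")
proof
  assume ?L
  then show ?R unfolding opposite_def doubleton_eq_iff prod.inject
    by (auto simp: Suc_double_not_eq_double double_not_eq_Suc_double)
next
  assume ?R
  then show ?L unfolding opposite_def by (intro exI [of _ i] exI [of _ j]) blast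
qed

end

section \<open>Spreading fixed edges from the lowest square\<close>

context grid_aut
begin

text \<open>One path of the lowest square maps to a path of some square. The other two edges are
  opposite to that path, so their distinct images fill the other path of the same square.\<close>

lemma cell_image:
  obtains i j where "1 \<le> i" "i < a" "1 \<le> j" "j < b"
    "{p (2, 3), p (3, 4)} = {(2*i, 2*j+1), (2*i+1, 2*j+2)} \<and> {p (3, 2), p (4, 3)} = {(2*i+1, 2*j), (2*i+2, 2*j+1)} \<or>
     {p (2, 3), p (3, 4)} = {(2*i+1, 2*j), (2*i+2, 2*j+1)} \<and> {p (3, 2), p (4, 3)} = {(2*i, 2*j+1), (2*i+1, 2*j+2)}"
proof -
  have opp: "opposite a b (2, 3) (3, 4) (3, 2)" "opposite a b (2, 3) (3, 4) (4, 3)"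
    using opposite_row_iff [of 1 1] a2 b2 by (simp_all add: numeral_eq_Suc)
  then have 1: "opposite a b (p (2, 3)) (p (3, 4)) (p (3, 2))" "opposite a b (p (2, 3)) (p (3, 4)) (p (4, 3))"
    using opposite_p opposite_mem by blast+
  have 2: "p (3, 2) \<noteq> p (4, 3)" by (simp add: p_eq_iff)
  obtain i j where ij: "1 \<le> i" "i < a" "1 \<le> j" "j < b"
    "{p (2, 3), p (3, 4)} = {(2*i, 2*j+1), (2*i+1, 2*j+2)} \<or>
     {p (2, 3), p (3, 4)} = {(2*i+1, 2*j), (2*i+2, 2*j+1)}"
    using 1(1) unfolding opposite_def by blast
  show ?thesis
  proof (rule that [OF ij(1-4)])
    from ij(5) show "{p (2, 3), p (3, 4)} = {(2*i, 2*j+1), (2*i+1, 2*j+2)} \<and> {p (3, 2), p (4, 3)} = {(2*i+1, 2*j), (2*i+2, 2*j+1)} \<or>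
     {p (2, 3), p (3, 4)} = {(2*i+1, 2*j), (2*i+2, 2*j+1)} \<and> {p (3, 2), p (4, 3)} = {(2*i, 2*j+1), (2*i+1, 2*j+2)}"
    proof
      assume eq: "{p (2, 3), p (3, 4)} = {(2*i, 2*j+1), (2*i+1, 2*j+2)}"
      then have "opposite a b (2*i, 2*j+1) (2*i+1, 2*j+2) x \<longleftrightarrow> opposite a b (p (2, 3)) (p (3, 4)) x" for x
        by (simp only: opposite_def)
      then have "p (3, 2) \<in> {(2*i+1, 2*j), (2*i+2, 2*j+1)}" "p (4, 3) \<in> {(2*i+1, 2*j), (2*i+2, 2*j+1)}"
        using 1 opposite_row_iff by blast+
      then show ?thesis using eq doubleton_eqI [OF _ _ 2] by blast
    next
      assume eq: "{p (2, 3), p (3, 4)} = {(2*i+1, 2*j), (2*i+2, 2*j+1)}"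
      then have "opposite a b (2*i+1, 2*j) (2*i+2, 2*j+1) x \<longleftrightarrow> opposite a b (p (2, 3)) (p (3, 4)) x" for x
        by (simp only: opposite_def)
      then have "p (3, 2) \<in> {(2*i, 2*j+1), (2*i+1, 2*j+2)}" "p (4, 3) \<in> {(2*i, 2*j+1), (2*i+1, 2*j+2)}"
        using 1 opposite_col_iff by blast+
      then show ?thesis using eq doubleton_eqI [OF _ _ 2] by blast
    qed
  qed
qed

text \<open>Every inner edge lies on a zigzag whose first edge has a coordinate 2, so
  \<open>zigzag\<close> spreads the fixed edges.\<close>

lemma eq_id_of_starts:
  assumes "p (1, 2) = (1, 2)" "p (2*a, 2*b+1) = (2*a, 2*b+1)"
    and start: "\<And>x y. (x, y) \<in> I \<Longrightarrow> x = 2 \<or> y = 2 \<Longrightarrow> p (x, y) = (x, y)"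
  shows "p = id"
proof
  fix e :: edge
  obtain u v where e: "e = (u, v)" by (cases e)
  show "p e = id e"
  proof (cases "e \<in> I")
    case True
    define m where "m = min u v - 2"
    have uv: "2 \<le> u" "2 \<le> v" using True e by (auto simp: inner_edges_def)
    have m: "u - m = 2 \<or> v - m = 2" "u = (u - m) + m" "v = (v - m) + m" "2 \<le> u - m" "2 \<le> v - m"
      using uv by (auto simp: m_def)
    have "(u - m, v - m) \<in> I"
      using True e m by (auto simp: inner_edges_def)
    then have "p ((u - m) + m, (v - m) + m) = ((u - m) + m, (v - m) + m)"
      using start m True e by (intro zigzag) auto
    then show ?thesis using m e by simp
  next
    case False
    then show ?thesis
      using assms(1,2) permutes_not_in [OF perm, of e] by (auto simp: edges_def)
  qed
qed

text \<open>Induction eastwards along the lowest squares. If \<open>(3, 2*j)\<close> and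
  \<open>(4, 2*j+1)\<close> are fixed, then \<open>(2, 2*j+1)\<close> goes to itself or its partner.
  Before the last square the partner is no end edge, so \<open>(2, 2*j+1)\<close> is fixed, and its
  zigzag fixes the corresponding path of the next square. Only the south-east corner keeps a
  choice.\<close>

lemma row_fixed:
  assumes S: "p (2, 3) = (2, 3)" and W: "p (3, 2) = (3, 2)"
  shows "1 \<le> j \<Longrightarrow> j < b \<Longrightarrow> p (3, 2*j) = (3, 2*j) \<and> p (4, 2*j+1) = (4, 2*j+1)"
    and "1 \<le> j \<Longrightarrow> j < b \<Longrightarrow> p (2, 2*j+1) \<in> {(2, 2*j+1), (3, 2*j+2)}"
    and "1 \<le> j \<Longrightarrow> Suc j < b \<Longrightarrow> p (2, 2*j+1) = (2, 2*j+1)"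
proof -
  have mem: "(2, 2*j+1) \<in> I" "(3, 2*j) \<in> I" "(4, 2*j+1) \<in> I" "(3, 2*j+2) \<in> I" if "1 \<le> j" "j < b" for j
    using that a2 by (auto simp: inner_edges_def)
  have opp: "p (2, 2*j+1) \<in> {(2, 2*j+1), (3, 2*j+2)}"
    if "1 \<le> j" "j < b" "p (3, 2*j) = (3, 2*j) \<and> p (4, 2*j+1) = (4, 2*j+1)" for j
  proof -
    have "opposite a b (3, 2*j) (4, 2*j+1) (2, 2*j+1)"
      using opposite_col_iff [of 1 j] a2 that by (simp add: numeral_eq_Suc)
    then have "opposite a b (3, 2*j) (4, 2*j+1) (p (2, 2*j+1))"
      using opposite_p [OF mem(2) [OF that(1,2)] mem(3) [OF that(1,2)] mem(1) [OF that(1,2)]] that(3)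
      by simp
    then show ?thesis
      using opposite_col_iff [of 1 j] by (simp add: numeral_eq_Suc)
  qed
  have fix_S: "p (2, 2*j+1) = (2, 2*j+1)"
    if j: "1 \<le> j" "Suc j < b" and "p (2, 2*j+1) \<in> {(2, 2*j+1), (3, 2*j+2)}" for j
  proof -
    have "end_edge (2, 2*j+1)" by (simp add: end_edge_def)
    moreover have "\<not> end_edge (3, 2*j+2)"
      using j a2 by (auto simp: end_edge_def)
    ultimately show ?thesis
      using that(3) end_edge_p [OF mem(1) [of j]] j by auto
  qed
  show *: "p (3, 2*j) = (3, 2*j) \<and> p (4, 2*j+1) = (4, 2*j+1)" if "1 \<le> j" "j < b" for j
    using that
  proof (induction j rule: nat_induct_at_least)
    case base
    have "p (3 + 1, 2 + 1) = (3 + 1, 2 + 1)"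
      using mem [of 1] W b2 by (intro zigzag) (simp_all add: numeral_eq_Suc)
    then show ?case using W by (simp add: numeral_eq_Suc)
  next
    case (Suc j)
    then have IH: "p (3, 2*j) = (3, 2*j) \<and> p (4, 2*j+1) = (4, 2*j+1)" by simp
    have S: "p (2, 2*j+1) = (2, 2*j+1)"
      using fix_S opp IH Suc by simp
    \<comment> \<open>One and two steps along this zigzag give \<open>(3, 2*j+2)\<close> and
      \<open>(4, 2*j+3)\<close>, the path needed in the next square.\<close>
    have "p (2 + k, 2*j+1 + k) = (2 + k, 2*j+1 + k)" if "k \<in> {1, 2}" for k
      using mem [of j] mem [of "Suc j"] S Suc that by (intro zigzag) (auto simp: numeral_eq_Suc)
    from this [of 1] this [of 2] show ?case by (simp add: numeral_eq_Suc)
  qed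
  show "p (2, 2*j+1) \<in> {(2, 2*j+1), (3, 2*j+2)}" if "1 \<le> j" "j < b"
    using opp * that by simp
  then show "p (2, 2*j+1) = (2, 2*j+1)" if "1 \<le> j" "Suc j < b"
    using fix_S that by simp
qed

text \<open>The argument of \<open>row_fixed\<close> along the first column of squares; the choice
  remains at the north-west corner.\<close>

lemma column_fixed:
  assumes S: "p (2, 3) = (2, 3)" and W: "p (3, 2) = (3, 2)"
  shows "1 \<le> i \<Longrightarrow> i < a \<Longrightarrow> p (2*i, 3) = (2*i, 3) \<and> p (2*i+1, 4) = (2*i+1, 4)"
    and "1 \<le> i \<Longrightarrow> i < a \<Longrightarrow> p (2*i+1, 2) \<in> {(2*i+1, 2), (2*i+2, 3)}"
    and "1 \<le> i \<Longrightarrow> Suc i < a \<Longrightarrow> p (2*i+1, 2) = (2*i+1, 2)"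
proof -
  have mem: "(2*i+1, 2) \<in> I" "(2*i, 3) \<in> I" "(2*i+1, 4) \<in> I" "(2*i+2, 3) \<in> I" if "1 \<le> i" "i < a" for i
    using that b2 by (auto simp: inner_edges_def)
  have opp: "p (2*i+1, 2) \<in> {(2*i+1, 2), (2*i+2, 3)}"
    if "1 \<le> i" "i < a" "p (2*i, 3) = (2*i, 3) \<and> p (2*i+1, 4) = (2*i+1, 4)" for i
  proof -
    have "opposite a b (2*i, 3) (2*i+1, 4) (2*i+1, 2)"
      using opposite_row_iff [of i 1] b2 that by (simp add: numeral_eq_Suc)
    then have "opposite a b (2*i, 3) (2*i+1, 4) (p (2*i+1, 2))"
      using opposite_p [OF mem(2) [OF that(1,2)] mem(3) [OF that(1,2)] mem(1) [OF that(1,2)]] that(3)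
      by simp
    then show ?thesis
      using opposite_row_iff [of i 1] by (simp add: numeral_eq_Suc)
  qed
  have fix_W: "p (2*i+1, 2) = (2*i+1, 2)"
    if i: "1 \<le> i" "Suc i < a" and "p (2*i+1, 2) \<in> {(2*i+1, 2), (2*i+2, 3)}" for i
  proof -
    have "end_edge (2*i+1, 2)" by (simp add: end_edge_def)
    moreover have "\<not> end_edge (2*i+2, 3)"
      using i b2 by (auto simp: end_edge_def)
    ultimately show ?thesis
      using that(3) end_edge_p [OF mem(1) [of i]] i by auto
  qed
  show *: "p (2*i, 3) = (2*i, 3) \<and> p (2*i+1, 4) = (2*i+1, 4)" if "1 \<le> i" "i < a" for i
    using that
  proof (induction i rule: nat_induct_at_least)
    case base
    have "p (2 + 1, 3 + 1) = (2 + 1, 3 + 1)"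
      using mem [of 1] S a2 by (intro zigzag) (simp_all add: numeral_eq_Suc)
    then show ?case using S by (simp add: numeral_eq_Suc)
  next
    case (Suc i)
    then have IH: "p (2*i, 3) = (2*i, 3) \<and> p (2*i+1, 4) = (2*i+1, 4)" by simp
    have W: "p (2*i+1, 2) = (2*i+1, 2)"
      using fix_W opp IH Suc by simp
    have "p (2*i+1 + k, 2 + k) = (2*i+1 + k, 2 + k)" if "k \<in> {1, 2}" for k
      using mem [of i] mem [of "Suc i"] W Suc that by (intro zigzag) (auto simp: numeral_eq_Suc)
    from this [of 1] this [of 2] show ?case by (simp add: numeral_eq_Suc)
  qed
  show "p (2*i+1, 2) \<in> {(2*i+1, 2), (2*i+2, 3)}" if "1 \<le> i" "i < a"
    using opp * that by simp
  then show "p (2*i+1, 2) = (2*i+1, 2)" if "1 \<le> i" "Suc i < a"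
    using fix_W that by simp
qed

text \<open>The zigzags of \<open>(2, 3)\<close> and \<open>(3, 2)\<close> have different lengths
  unless \<open>a = b\<close>: at the shorter side one of them goes on while its image would leave
  the grid.\<close>

lemma swapped_corner_imp_square:
  assumes S: "p (2, 3) = (3, 2)" and W: "p (3, 2) = (2, 3)"
  shows "a = b"
proof (rule ccontr)
  assume "a \<noteq> b"
  then consider "a < b" | "b < a" by linarith
  then show False
  proof cases
    case 1
    have k: "2 + (2*a - 2) = 2*a" "3 + (2*a - 2) = 2*a + 1" using a2 by auto
    have "p (2 + (2*a - 2), 3 + (2*a - 2)) = (3 + (2*a - 2), 2 + (2*a - 2))"
      using 1 a2 b2 S by (intro zigzag) (auto simp: inner_edges_def)
    moreover have "(2*a, 2*a+1) \<in> I" "(2*a+1, 2*a) \<notin> I"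
      using 1 a2 by (auto simp: inner_edges_def)
    ultimately show False
      using inner_p [of "(2*a, 2*a+1)"] unfolding k by metis
  next
    case 2
    have k: "2 + (2*b - 2) = 2*b" "3 + (2*b - 2) = 2*b + 1" using b2 by auto
    have "p (3 + (2*b - 2), 2 + (2*b - 2)) = (2 + (2*b - 2), 3 + (2*b - 2))"
      using 2 a2 b2 W by (intro zigzag) (auto simp: inner_edges_def)
    moreover have "(2*b+1, 2*b) \<in> I" "(2*b, 2*b+1) \<notin> I"
      using 2 b2 by (auto simp: inner_edges_def)
    ultimately show False
      using inner_p [of "(2*b+1, 2*b)"] unfolding k by metis
  qed
qed

end

section \<open>Reduction of an automorphism to the identity\<close>

definition generators :: "nat \<Rightarrow> nat \<Rightarrow> (edge \<Rightarrow> edge) set" where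
  "generators a b = {flip_SE b, flip_NW a, rotation a b, outer_swap a b} \<union>
    (if a = b then {antitranspose a} else {})"

lemma comp_in_edge_group:
  assumes "p \<in> carrier (edge_group a b)" "q \<in> carrier (edge_group a b)"
  shows "p \<circ> q \<in> carrier (edge_group a b)"
proof -
  interpret group "edge_group a b" by (rule group_perm_aut_group)
  show ?thesis
    using m_closed [OF assms] by (simp add: perm_aut_group_def)
qed

context grid
begin

lemma end_edge_cell:
  "end_edge (2*i, 2*j+1) \<longleftrightarrow> i = 1 \<or> i = a"
  "end_edge (2*i+1, 2*j+2) \<longleftrightarrow> j = 0 \<or> j+1 = b"
  "end_edge (2*i+1, 2*j) \<longleftrightarrow> j = 1 \<or> j = b"
  "end_edge (2*i+2, 2*j+1) \<longleftrightarrow> i = 0 \<or> i+1 = a"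
  unfolding end_edge_def fst_conv snd_conv by presburger+

lemma generators_in: "g \<in> generators a b \<Longrightarrow> g \<in> carrier (edge_group a b)"
  using flip_SE_in flip_NW_in rotation_in outer_swap_in antitranspose_in
  by (auto simp: generators_def split: if_splits)

end

text \<open>Ends go to ends: \<open>(2, 3)\<close> and \<open>(3, 2)\<close> always are ends,
  \<open>(3, 4)\<close> only for \<open>b = 2\<close> and \<open>(4, 3)\<close> only for
  \<open>a = 2\<close>. In each of the eight ways to map the square this makes the image square the
  lowest or the highest one, and a half turn reduces the second case to the first.\<close>

lemma (in grid_aut) corner_image:
  obtains r where "r \<in> {id, rotation a b}"
    "(r (p (2, 3)) = (2, 3) \<or> b = 2 \<and> r (p (2, 3)) = (3, 4)) \<and>
     (r (p (3, 2)) = (3, 2) \<or> a = 2 \<and> r (p (3, 2)) = (4, 3)) \<or>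
     r (p (2, 3)) = (3, 2) \<and> r (p (3, 2)) = (2, 3)"
proof -
  obtain i j where ij: "1 \<le> i" "i < a" "1 \<le> j" "j < b"
    and cell: "{p (2, 3), p (3, 4)} = {(2*i, 2*j+1), (2*i+1, 2*j+2)} \<and> {p (3, 2), p (4, 3)} = {(2*i+1, 2*j), (2*i+2, 2*j+1)} \<or>
     {p (2, 3), p (3, 4)} = {(2*i+1, 2*j), (2*i+2, 2*j+1)} \<and> {p (3, 2), p (4, 3)} = {(2*i, 2*j+1), (2*i+1, 2*j+2)}"
    by (rule cell_image)
  have "(2, 3) \<in> I" "(3, 4) \<in> I" "(3, 2) \<in> I" "(4, 3) \<in> I"
    using a2 b2 by (auto simp: inner_edges_def)
  note images = this [THEN end_edge_p]
  have ends: "end_edge (p (2, 3))" "end_edge (p (3, 2))" "end_edge (p (3, 4)) \<longleftrightarrow> b = 2"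
      "end_edge (p (4, 3)) \<longleftrightarrow> a = 2"
    unfolding images unfolding end_edge_def fst_conv snd_conv by presburger+
  have rot: "rotation a b (2*i, 2*j+1) = (2*a+2-2*i, 2*b+1-2*j)"
      "rotation a b (2*i+1, 2*j+2) = (2*a+1-2*i, 2*b-2*j)"
      "rotation a b (2*i+1, 2*j) = (2*a+1-2*i, 2*b+2-2*j)"
      "rotation a b (2*i+2, 2*j+1) = (2*a-2*i, 2*b+1-2*j)"
    using ij by (auto simp: rotation_def inner_edges_def)
  have main: "\<exists>r\<in>{id, rotation a b}.
     (r (p (2, 3)) = (2, 3) \<or> b = 2 \<and> r (p (2, 3)) = (3, 4)) \<and>
     (r (p (3, 2)) = (3, 2) \<or> a = 2 \<and> r (p (3, 2)) = (4, 3)) \<or>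
     r (p (2, 3)) = (3, 2) \<and> r (p (3, 2)) = (2, 3)"
    using cell unfolding doubleton_eq_iff
  proof (elim disjE conjE)
    assume eq: "p (2, 3) = (2*i, 2*j+1)" "p (3, 4) = (2*i+1, 2*j+2)" "p (3, 2) = (2*i+1, 2*j)" "p (4, 3) = (2*i+2, 2*j+1)"
    have "i = 1" "j = 1" using ends ij unfolding eq end_edge_cell by auto
    then show ?thesis using eq by simp
  next
    assume eq: "p (2, 3) = (2*i, 2*j+1)" "p (3, 4) = (2*i+1, 2*j+2)" "p (3, 2) = (2*i+2, 2*j+1)" "p (4, 3) = (2*i+1, 2*j)"
    have "i = 1" "j = 1" "a = 2" using ends ij unfolding eq end_edge_cell by auto
    then show ?thesis using eq by simp
  next
    assume eq: "p (2, 3) = (2*i+1, 2*j+2)" "p (3, 4) = (2*i, 2*j+1)" "p (3, 2) = (2*i+1, 2*j)" "p (4, 3) = (2*i+2, 2*j+1)"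
    have "i = 1" "j = 1" "b = 2" using ends ij unfolding eq end_edge_cell by auto
    then show ?thesis using eq by simp
  next
    assume eq: "p (2, 3) = (2*i+1, 2*j+2)" "p (3, 4) = (2*i, 2*j+1)" "p (3, 2) = (2*i+2, 2*j+1)" "p (4, 3) = (2*i+1, 2*j)"
    have "a = i+1" "b = j+1" using ends ij unfolding eq end_edge_cell by auto
    then show ?thesis using eq rot by simp
  next
    assume eq: "p (2, 3) = (2*i+1, 2*j)" "p (3, 4) = (2*i+2, 2*j+1)" "p (3, 2) = (2*i, 2*j+1)" "p (4, 3) = (2*i+1, 2*j+2)"
    have "i = 1" "j = 1" using ends ij unfolding eq end_edge_cell by auto
    then show ?thesis using eq by simp
  next
    assume eq: "p (2, 3) = (2*i+1, 2*j)" "p (3, 4) = (2*i+2, 2*j+1)" "p (3, 2) = (2*i+1, 2*j+2)" "p (4, 3) = (2*i, 2*j+1)"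
    have "j = 1" "b = 2" "a = i+1" using ends ij unfolding eq end_edge_cell by auto
    then show ?thesis using eq rot by simp
  next
    assume eq: "p (2, 3) = (2*i+2, 2*j+1)" "p (3, 4) = (2*i+1, 2*j)" "p (3, 2) = (2*i, 2*j+1)" "p (4, 3) = (2*i+1, 2*j+2)"
    have "i = 1" "a = 2" "b = j+1" using ends ij unfolding eq end_edge_cell by auto
    then show ?thesis using eq rot by simp
  next
    assume eq: "p (2, 3) = (2*i+2, 2*j+1)" "p (3, 4) = (2*i+1, 2*j)" "p (3, 2) = (2*i+1, 2*j+2)" "p (4, 3) = (2*i, 2*j+1)"
    have "a = i+1" "b = j+1" using ends ij unfolding eq end_edge_cell by auto
    then show ?thesis using eq rot by simp
  qed
  then show ?thesis using that by blast
qed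

text \<open>Generation in the form in which it is proved: generators are composed on the left until
  \<open>id\<close> is reached, and \<open>cancel\<close> carries membership in \<open>H\<close>
  back. \<open>H\<close> will be the image of a homomorphism from the abstract product.\<close>

locale closed_under_generators = grid +
  fixes H :: "(edge \<Rightarrow> edge) set"
  assumes id_in: "id \<in> H"
    and cancel: "g \<in> generators a b \<Longrightarrow> x \<in> carrier (edge_group a b) \<Longrightarrow> g \<circ> x \<in> H \<Longrightarrow> x \<in> H"
begin

lemma grid_autI: "p \<in> carrier (edge_group a b) \<Longrightarrow> grid_aut a b p"
  by unfold_locales

lemma cancel_generator:
  assumes "g \<in> generators a b" "p \<in> carrier (edge_group a b)"
    and "g \<circ> p \<in> carrier (edge_group a b) \<Longrightarrow> g \<circ> p \<in> H"
  shows "p \<in> H"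
  using assms cancel comp_in_edge_group generators_in by blast

lemma flip_SE_gen: "flip_SE b \<in> generators a b"
  and flip_NW_gen: "flip_NW a \<in> generators a b"
  and rotation_gen: "rotation a b \<in> generators a b"
  and outer_swap_gen: "outer_swap a b \<in> generators a b"
  and antitranspose_gen: "a = b \<Longrightarrow> antitranspose a \<in> generators a b"
  by (simp_all add: generators_def)

definition normalized :: "(edge \<Rightarrow> edge) \<Rightarrow> bool" where
  "normalized p \<longleftrightarrow> p \<in> carrier (edge_group a b) \<and> p (1, 2) = (1, 2) \<and> p (2*a, 2*b+1) = (2*a, 2*b+1) \<and>
     p (2, 3) = (2, 3) \<and> p (3, 2) = (3, 2)"

lemma generator_simps:
  "flip_SE b (2, 2*b-1) = (3, 2*b)" "flip_SE b (3, 2*b) = (2, 2*b-1)"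
  "flip_NW a (2*a-1, 2) = (2*a, 3)" "flip_NW a (2*a, 3) = (2*a-1, 2)"
  by (auto simp: flip_SE_def flip_NW_def)

lemma flip_SE_fixes:
  "x \<noteq> (2, 2*b-1) \<Longrightarrow> x \<noteq> (3, 2*b) \<Longrightarrow> flip_SE b x = x"
  by (simp add: flip_SE_def Transposition.transpose_def)

lemma flip_NW_fixes:
  "x \<noteq> (2*a-1, 2) \<Longrightarrow> x \<noteq> (2*a, 3) \<Longrightarrow> flip_NW a x = x"
  by (simp add: flip_NW_def Transposition.transpose_def)

lemma flip_SE_fixes_outer: "flip_SE b (1, 2) = (1, 2)" "flip_SE b (2*a, 2*b+1) = (2*a, 2*b+1)"
  using a2 b2 by (auto intro!: flip_SE_fixes)

lemma flip_NW_fixes_outer: "flip_NW a (1, 2) = (1, 2)" "flip_NW a (2*a, 2*b+1) = (2*a, 2*b+1)"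
  using a2 b2 by (auto intro!: flip_NW_fixes)

text \<open>\<open>row_fixed\<close> and \<open>column_fixed\<close> fix every first edge of a
  zigzag except the last one in the row and in the column; these two are the assumptions.\<close>

lemma normalized_fixing_corners:
  assumes n: "normalized p" and SE: "p (2, 2*b-1) = (2, 2*b-1)" and NW: "p (2*a-1, 2) = (2*a-1, 2)"
  shows "p \<in> H"
proof -
  interpret grid_aut a b p
    using n by (intro grid_autI) (simp add: normalized_def)
  have "p = id"
  proof (rule eq_id_of_starts)
    fix x y assume xy: "(x, y) \<in> I" "x = 2 \<or> y = 2"
    from xy(2) show "p (x, y) = (x, y)"
    proof
      assume x: "x = 2"
      then have "odd y" "2 \<le> y" "y \<le> 2*b" using xy(1) by (auto simp: inner_edges_def)
      then obtain j where j: "y = 2*j+1" "1 \<le> j" "j < b" by (auto elim!: oddE)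
      show ?thesis
      proof (cases "Suc j < b")
        case True
        then show ?thesis using row_fixed(3) [of j] n j x by (simp add: normalized_def)
      next
        case False
        then have "y = 2*b-1" using j by simp
        then show ?thesis using SE x by simp
      qed
    next
      assume y: "y = 2"
      then have "odd x" "2 \<le> x" "x \<le> 2*a" using xy(1) by (auto simp: inner_edges_def)
      then obtain i where i: "x = 2*i+1" "1 \<le> i" "i < a" by (auto elim!: oddE)
      show ?thesis
      proof (cases "Suc i < a")
        case True
        then show ?thesis using column_fixed(3) [of i] n i y by (simp add: normalized_def)
      next
        case False
        then have "x = 2*a-1" using i by simp
        then show ?thesis using NW y by simp
      qed
    qed
  qed (use n in \<open>auto simp: normalized_def\<close>)
  then show ?thesis using id_in by simp
qed

text \<open>By \<open>column_fixed\<close> the edge \<open>(2*a-1, 2)\<close> can only move to its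
  partner, which \<open>flip_NW\<close> undoes.\<close>

lemma normalized_fixing_SE:
  assumes n: "normalized p" and SE: "p (2, 2*b-1) = (2, 2*b-1)"
  shows "p \<in> H"
proof (cases "p (2*a-1, 2) = (2*a-1, 2)")
  case True
  then show ?thesis using normalized_fixing_corners n SE by blast
next
  case False
  interpret grid_aut a b p
    using n by (intro grid_autI) (simp add: normalized_def)
  have image: "p (2*a-1, 2) = (2*a, 3)"
  proof -
    obtain c where c: "a = Suc c" "2*a-1 = 2*c+1" "2*a = 2*c+2" using a2 by (cases a) auto
    then have "p (2*c+1, 2) \<in> {(2*c+1, 2), (2*c+2, 3)}"
      using n a2 by (intro column_fixed(2)) (auto simp: normalized_def)
    then show ?thesis using False by (simp add: c)
  qed
  \<comment> \<open>For \<open>a = 2\<close> the edge \<open>(2*a-1, 2)\<close> is the fixed edge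
    \<open>(3, 2)\<close>; otherwise \<open>flip_NW\<close> leaves the normalised edges
    alone.\<close>
  have "a \<noteq> 2"
    using n False by (auto simp: normalized_def)
  have unmoved: "flip_NW a (2, 2*b-1) = (2, 2*b-1)" "flip_NW a (2, 3) = (2, 3)" "flip_NW a (3, 2) = (3, 2)"
    by (rule flip_NW_fixes; simp only: prod.inject; insert a2 b2 \<open>a \<noteq> 2\<close>; presburger)+
  show ?thesis
  proof (rule cancel_generator [OF flip_NW_gen])
    show "p \<in> carrier (edge_group a b)" using n by (simp add: normalized_def)
    assume "flip_NW a \<circ> p \<in> carrier (edge_group a b)"
    then have "normalized (flip_NW a \<circ> p)"
      using n unfolding normalized_def o_def by (simp only: flip_NW_fixes_outer unmoved simp_thms)
    then show "flip_NW a \<circ> p \<in> H"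
      by (rule normalized_fixing_corners) (simp_all only: o_def SE unmoved image generator_simps)
  qed
qed

lemma normalized_mem:
  assumes n: "normalized p"
  shows "p \<in> H"
proof (cases "p (2, 2*b-1) = (2, 2*b-1)")
  case True
  then show ?thesis using normalized_fixing_SE n by blast
next
  case False
  interpret grid_aut a b p
    using n by (intro grid_autI) (simp add: normalized_def)
  have image: "p (2, 2*b-1) = (3, 2*b)"
  proof -
    obtain c where c: "b = Suc c" "2*b-1 = 2*c+1" "2*b = 2*c+2" using b2 by (cases b) auto
    then have "p (2, 2*c+1) \<in> {(2, 2*c+1), (3, 2*c+2)}"
      using n b2 by (intro row_fixed(2)) (auto simp: normalized_def)
    then show ?thesis using False by (simp add: c)
  qed
  have "b \<noteq> 2"
    using n False by (auto simp: normalized_def)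
  have unmoved: "flip_SE b (2, 3) = (2, 3)" "flip_SE b (3, 2) = (3, 2)"
    by (rule flip_SE_fixes; simp only: prod.inject; insert a2 b2 \<open>b \<noteq> 2\<close>; presburger)+
  show ?thesis
  proof (rule cancel_generator [OF flip_SE_gen])
    show "p \<in> carrier (edge_group a b)" using n by (simp add: normalized_def)
    assume "flip_SE b \<circ> p \<in> carrier (edge_group a b)"
    then have "normalized (flip_SE b \<circ> p)"
      using n unfolding normalized_def o_def by (simp only: flip_SE_fixes_outer unmoved simp_thms)
    then show "flip_SE b \<circ> p \<in> H"
      by (rule normalized_fixing_SE) (simp only: o_def image generator_simps)
  qed
qed

lemma outer_fixed_mem:
  assumes p: "p \<in> carrier (edge_group a b)" "p (1, 2) = (1, 2)" "p (2*a, 2*b+1) = (2*a, 2*b+1)"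
  shows "p \<in> H"
proof -
  \<comment> \<open>For \<open>a = 2\<close> the north-west corner belongs to the lowest square, and
    \<open>flip_NW\<close> repairs \<open>(3, 2)\<close> itself.\<close>
  have fixed_NW: "q \<in> H" if q: "q \<in> carrier (edge_group a b)" "q (1, 2) = (1, 2)" "q (2*a, 2*b+1) = (2*a, 2*b+1)"
    "q (2, 3) = (2, 3)" "q (3, 2) = (3, 2) \<or> a = 2 \<and> q (3, 2) = (4, 3)" for q
  proof (cases "q (3, 2) = (3, 2)")
    case True
    then show ?thesis using q by (intro normalized_mem) (simp add: normalized_def)
  next
    case False
    then have "a = 2" "q (3, 2) = (4, 3)" using q(5) by auto
    then have "(flip_NW a \<circ> q) (3, 2) = (3, 2)" "(flip_NW a \<circ> q) (2, 3) = (2, 3)"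
      using q(4) by (auto simp: flip_NW_def Transposition.transpose_def)
    then have "flip_NW a \<circ> q \<in> carrier (edge_group a b) \<Longrightarrow> normalized (flip_NW a \<circ> q)"
      using q(1-3) unfolding normalized_def o_def by (simp only: flip_NW_fixes_outer simp_thms)
    then show ?thesis
      using cancel_generator [OF flip_NW_gen q(1)] normalized_mem by blast
  qed
  have fixed_corner: "q \<in> H" if q: "q \<in> carrier (edge_group a b)" "q (1, 2) = (1, 2)" "q (2*a, 2*b+1) = (2*a, 2*b+1)"
    "q (2, 3) = (2, 3) \<or> b = 2 \<and> q (2, 3) = (3, 4)" "q (3, 2) = (3, 2) \<or> a = 2 \<and> q (3, 2) = (4, 3)" for q
  proof (cases "q (2, 3) = (2, 3)")
    case True
    then show ?thesis using q by (intro fixed_NW)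
  next
    case False
    then have b: "b = 2" "q (2, 3) = (3, 4)" using q(4) by auto
    then have "(flip_SE b \<circ> q) (2, 3) = (2, 3)" "flip_SE b (3, 2) = (3, 2)" "flip_SE b (4, 3) = (4, 3)"
      by (auto simp: flip_SE_def Transposition.transpose_def)
    moreover from this have "(flip_SE b \<circ> q) (3, 2) = (3, 2) \<or> a = 2 \<and> (flip_SE b \<circ> q) (3, 2) = (4, 3)"
      using q(5) by auto
    moreover have "(flip_SE b \<circ> q) (1, 2) = (1, 2)" "(flip_SE b \<circ> q) (2*a, 2*b+1) = (2*a, 2*b+1)"
      using q(2,3) by (simp_all only: o_def flip_SE_fixes_outer)
    ultimately show ?thesis
      using cancel_generator [OF flip_SE_gen q(1)] fixed_NW by blast
  qed
  have corner: "q \<in> H" if q: "q \<in> carrier (edge_group a b)" "q (1, 2) = (1, 2)" "q (2*a, 2*b+1) = (2*a, 2*b+1)"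
    and c: "(q (2, 3) = (2, 3) \<or> b = 2 \<and> q (2, 3) = (3, 4)) \<and>
     (q (3, 2) = (3, 2) \<or> a = 2 \<and> q (3, 2) = (4, 3)) \<or>
     q (2, 3) = (3, 2) \<and> q (3, 2) = (2, 3)" for q
  proof (cases "q (2, 3) = (3, 2) \<and> q (3, 2) = (2, 3)")
    case False
    then show ?thesis using q c by (intro fixed_corner) auto
  next
    case True
    interpret q: grid_aut a b q
      by (rule grid_autI [OF q(1)])
    have ab: "a = b" using q.swapped_corner_imp_square True by blast
    \<comment> \<open>The antitransposition after the half turn is the reflection in the main
      diagonal, which undoes the exchange of \<open>(2, 3)\<close> and
      \<open>(3, 2)\<close>.\<close>
    define t where "t = antitranspose a \<circ> (rotation a b \<circ> q)"
    have "rotation a b (2, 3) = (2*a, 2*a-1)" "rotation a b (3, 2) = (2*a-1, 2*a)"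
      "antitranspose a (2*a, 2*a-1) = (3, 2)" "antitranspose a (2*a-1, 2*a) = (2, 3)"
      using ab a2 by (auto simp: rotation_def antitranspose_def inner_edges_def)
    then have "t (2, 3) = (2, 3)" "t (3, 2) = (3, 2)"
      using True by (simp_all add: t_def)
    moreover have "t (1, 2) = (1, 2)" "t (2*a, 2*b+1) = (2*a, 2*b+1)"
      using q ab by (simp_all add: t_def rotation_def antitranspose_def inner_edges_def)
    ultimately have "t \<in> carrier (edge_group a b) \<Longrightarrow> t \<in> H"
      by (intro normalized_mem) (simp add: normalized_def)
    then have "rotation a b \<circ> q \<in> H" if "rotation a b \<circ> q \<in> carrier (edge_group a b)"
      unfolding t_def by (rule cancel_generator [OF antitranspose_gen [OF ab] that])
    then show ?thesis
      by (rule cancel_generator [OF rotation_gen q(1)])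
  qed
  interpret grid_aut a b p
    by (rule grid_autI [OF p(1)])
  obtain r where r: "r \<in> {id, rotation a b}"
    "(r (p (2, 3)) = (2, 3) \<or> b = 2 \<and> r (p (2, 3)) = (3, 4)) \<and>
     (r (p (3, 2)) = (3, 2) \<or> a = 2 \<and> r (p (3, 2)) = (4, 3)) \<or>
     r (p (2, 3)) = (3, 2) \<and> r (p (3, 2)) = (2, 3)"
    by (rule corner_image)
  have outer: "r (1, 2) = (1, 2)" "r (2*a, 2*b+1) = (2*a, 2*b+1)"
    using r(1) by (auto simp: rotation_def inner_edges_def)
  have *: "r \<circ> p \<in> H" if "r \<circ> p \<in> carrier (edge_group a b)"
    using that by (rule corner) (simp_all only: o_def assms(2,3) outer r(2))
  show ?thesis
  proof (cases "r = id")
    case True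
    then show ?thesis using * p(1) by simp
  next
    case False
    then have "r = rotation a b" using r(1) by simp
    then show ?thesis
      using * cancel_generator [OF rotation_gen assms(1)] by blast
  qed
qed

lemma edge_group_mem:
  assumes p: "p \<in> carrier (edge_group a b)"
  shows "p \<in> H"
proof -
  interpret grid_aut a b p
    by (rule grid_autI [OF p])
  \<comment> \<open>The outer edges form the complement of the invariant set
    \<open>I\<close>.\<close>
  have outer: "p e \<in> {(1, 2), (2*a, 2*b+1)}" if e: "e \<in> {(1, 2), (2*a, 2*b+1)}" for e
  proof -
    have "e \<notin> I" "e \<in> edges a b" using e by (auto simp: inner_edges_def edges_def)
    then have "p e \<notin> I" "p e \<in> edges a b"
      using image_inner permutes_in_image [OF perm] p_eq_iff by (metis imageE)+
    then show ?thesis by (auto simp: edges_def)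
  qed
  have ne: "p (1, 2) \<noteq> p (2*a, 2*b+1)" by (simp add: p_eq_iff)
  show ?thesis
  proof (cases "p (1, 2) = (1, 2)")
    case True
    then show ?thesis
      using outer [of "(2*a, 2*b+1)"] ne by (intro outer_fixed_mem p) auto
  next
    case False
    then have "p (1, 2) = (2*a, 2*b+1)" "p (2*a, 2*b+1) = (1, 2)"
      using outer [of "(1, 2)"] outer [of "(2*a, 2*b+1)"] ne by auto
    then have "(outer_swap a b \<circ> p) (1, 2) = (1, 2)" "(outer_swap a b \<circ> p) (2*a, 2*b+1) = (2*a, 2*b+1)"
      by (simp_all only: o_def outer_swap_def transpose_apply_first transpose_apply_second)
    then show ?thesis
      using cancel_generator [OF outer_swap_gen assms] outer_fixed_mem by blast
  qed
qed

end

section \<open>The group structure\<close>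

lemma (in group) commutes_int_pow:
  assumes "x \<otimes> y = y \<otimes> x" "x \<in> carrier G" "y \<in> carrier G" "0 \<le> k"
  shows "x [^] (k::int) \<otimes> y = y \<otimes> x [^] k"
  using assms group_commutes_pow [of x y "nat k"] by (simp add: pow_nat)

lemma (in group) commutes_mult:
  assumes "x \<otimes> z = z \<otimes> x" "y \<otimes> z = z \<otimes> y" "x \<in> carrier G" "y \<in> carrier G" "z \<in> carrier G"
  shows "(x \<otimes> y) \<otimes> z = z \<otimes> (x \<otimes> y)"
  using assms by (metis m_assoc)

lemma (in group) int_pow_mod_eq:
  assumes x: "x \<in> carrier G" and "x [^] (int m) = \<one>"
  shows "x [^] (k mod int m) = x [^] k"
proof -
  have "x [^] k = x [^] (int m * (k div int m) + k mod int m)" by simp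
  also have "\<dots> = (x [^] (int m)) [^] (k div int m) \<otimes> x [^] (k mod int m)"
    using x by (simp only: int_pow_mult int_pow_pow)
  also have "\<dots> = x [^] (k mod int m)"
    using x assms(2) by simp
  finally show ?thesis by simp
qed

lemma (in group) integer_mod_group_hom:
  assumes "x \<in> carrier G" "x [^] (int m) = \<one>"
  shows "(\<lambda>k. x [^] k) \<in> hom (integer_mod_group m) G"
  using assms by (intro homI) (simp_all add: int_pow_mod_eq int_pow_mult)

text \<open>The relation \<open>rs\<close> extends to \<open>s r^l = r^(-l) s\<close>, the sign rule
  in the multiplication of \<open>dihedral_group\<close>; exponents may be reduced modulo
  \<open>m\<close> because the \<open>m\<close>-th power of \<open>r\<close> is trivial.\<close>

lemma (in group) dihedral_group_hom:
  assumes r: "r \<in> carrier G" "r [^] (int m) = \<one>" and s: "s \<in> carrier G" "s \<otimes> s = \<one>"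
    and rs: "s \<otimes> r = inv r \<otimes> s"
  shows "(\<lambda>(k, b). r [^] k \<otimes> (if b then s else \<one>)) \<in> hom (dihedral_group m) G"
proof (rule homI)
  fix x assume "x \<in> carrier (dihedral_group m)"
  then show "(case x of (k, b) \<Rightarrow> r [^] k \<otimes> (if b then s else \<one>)) \<in> carrier G"
    using r s by (cases x) simp
next
  have conj: "s \<otimes> r [^] (n::nat) = r [^] (- int n) \<otimes> s" for n
  proof (induction n)
    case 0
    then show ?case using s by simp
  next
    case (Suc n)
    have "s \<otimes> r [^] (Suc n) = (s \<otimes> r [^] n) \<otimes> r"
      using r s by (simp add: m_assoc)
    also have "\<dots> = r [^] (- int n) \<otimes> (s \<otimes> r)"
      unfolding Suc.IH using r s by (simp add: m_assoc)
    also have "\<dots> = (r [^] (- int n) \<otimes> r [^] (- 1 :: int)) \<otimes> s"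
      unfolding rs using r s by (simp add: m_assoc int_pow_neg)
    also have "r [^] (- int n) \<otimes> r [^] (- 1 :: int) = r [^] (- int (Suc n))"
      using r int_pow_mult [of r "- int n" "- 1"] by (simp add: algebra_simps)
    finally show ?case .
  qed
  fix x y assume xy: "x \<in> carrier (dihedral_group m)" "y \<in> carrier (dihedral_group m)"
  obtain k b where x: "x = (k, b)" by (cases x)
  obtain l c where y: "y = (l, c)" by (cases y)
  have "0 \<le> l" using xy y by (simp add: dihedral_group_def)
  then have conj_l: "s \<otimes> r [^] l = r [^] (- l) \<otimes> s"
    using conj [of "nat l"] by (simp add: pow_nat)
  have diff: "r [^] (k - l) = r [^] k \<otimes> r [^] (- l)"
    using int_pow_mult [OF r(1), of k "- l"] by simp
  have key: "r [^] k \<otimes> s \<otimes> (r [^] l \<otimes> z) = r [^] (k - l) \<otimes> (s \<otimes> z)" if z: "z \<in> carrier G" for z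
  proof -
    have "r [^] k \<otimes> s \<otimes> (r [^] l \<otimes> z) = r [^] k \<otimes> (s \<otimes> r [^] l) \<otimes> z"
      using r s z by (simp add: m_assoc)
    also have "\<dots> = r [^] (k - l) \<otimes> (s \<otimes> z)"
      unfolding conj_l diff using r s z by (simp add: m_assoc)
    finally show ?thesis .
  qed
  have "r [^] ((if b then k - l else k + l) mod int m) \<otimes> (if b \<noteq> c then s else \<one>) =
     (r [^] k \<otimes> (if b then s else \<one>)) \<otimes> (r [^] l \<otimes> (if c then s else \<one>))"
  proof (cases b)
    case True
    then show ?thesis
      using r s key [OF one_closed] key [OF s(1)] by (cases c) (simp_all add: int_pow_mod_eq)
  next
    case False
    then show ?thesis
      using r s by (simp add: int_pow_mod_eq int_pow_mult m_assoc)
  qed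
  then show "(case x \<otimes>\<^bsub>dihedral_group m\<^esub> y of (k, b) \<Rightarrow> r [^] k \<otimes> (if b then s else \<one>)) =
    (case x of (k, b) \<Rightarrow> r [^] k \<otimes> (if b then s else \<one>)) \<otimes> (case y of (k, b) \<Rightarrow> r [^] k \<otimes> (if b then s else \<one>))"
    by (simp add: x y dihedral_group_def)
qed

lemma (in group) DirProd_hom:
  assumes f: "f \<in> hom H G" and g: "g \<in> hom K G"
    and comm: "\<And>x y. x \<in> carrier H \<Longrightarrow> y \<in> carrier K \<Longrightarrow> f x \<otimes> g y = g y \<otimes> f x"
  shows "(\<lambda>(x, y). f x \<otimes> g y) \<in> hom (H \<times>\<times> K) G"
proof (rule homI)
  have closed: "x \<in> carrier H \<Longrightarrow> f x \<in> carrier G" "y \<in> carrier K \<Longrightarrow> g y \<in> carrier G" for x y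
    using f g by (auto simp: hom_def)
  then show "(case z of (x, y) \<Rightarrow> f x \<otimes> g y) \<in> carrier G" if "z \<in> carrier (H \<times>\<times> K)" for z
    using that by auto
  fix z w assume zw: "z \<in> carrier (H \<times>\<times> K)" "w \<in> carrier (H \<times>\<times> K)"
  obtain x y x' y' where eq: "z = (x, y)" "w = (x', y')" by (cases z; cases w)
  then have mem: "x \<in> carrier H" "y \<in> carrier K" "x' \<in> carrier H" "y' \<in> carrier K" using zw by auto
  have "f (x \<otimes>\<^bsub>H\<^esub> x') \<otimes> g (y \<otimes>\<^bsub>K\<^esub> y') = (f x \<otimes> f x') \<otimes> (g y \<otimes> g y')"
    using hom_mult [OF f mem(1,3)] hom_mult [OF g mem(2,4)] by simp
  also have "\<dots> = f x \<otimes> (f x' \<otimes> g y) \<otimes> g y'"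
    using closed mem by (simp add: m_assoc)
  also have "\<dots> = (f x \<otimes> g y) \<otimes> (f x' \<otimes> g y')"
    unfolding comm [OF mem(3,2)] using closed mem by (simp add: m_assoc)
  finally show "(case z \<otimes>\<^bsub>H \<times>\<times> K\<^esub> w of (x, y) \<Rightarrow> f x \<otimes> g y) =
      (case z of (x, y) \<Rightarrow> f x \<otimes> g y) \<otimes> (case w of (x, y) \<Rightarrow> f x \<otimes> g y)"
    by (simp add: eq)
qed

text \<open>Only coordinate 0 is read, enough for the intended \<open>d \<le> 1\<close>. For
  \<open>d = 0\<close> there is no such coordinate, hence the trivial map.\<close>

lemma (in group) Z2_power_hom:
  assumes "x \<in> carrier G" "x \<otimes> x = \<one>"
  shows "(\<lambda>w. if d = 0 then \<one> else x [^] w 0) \<in> hom (Z2_power d) G"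
proof -
  have "x [^] (int 2) = \<one>"
    unfolding int_pow_int using assms by (simp add: numeral_2_eq_2)
  then show ?thesis
    using assms by (intro homI) (simp_all add: int_pow_mod_eq [of x 2, simplified] int_pow_mult)
qed

lemma involution_conj_transpose:
  assumes "\<And>x. f (f x) = x"
  shows "f \<circ> Transposition.transpose x y = Transposition.transpose (f x) (f y) \<circ> f"
proof
  fix z
  have "f z = f w \<longleftrightarrow> z = w" for w using assms by metis
  then show "(f \<circ> Transposition.transpose x y) z = (Transposition.transpose (f x) (f y) \<circ> f) z"
    by (simp add: Transposition.transpose_def)
qed

lemma funpow_orbit:
  assumes "f x = y" "f y = z" "f z = w"
  shows "(f ^^ 1) x = y" "(f ^^ 2) x = z" "(f ^^ 3) x = w"
  using assms by (simp_all add: numeral_2_eq_2 numeral_3_eq_3)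

section \<open>Relations among the generators\<close>

context grid
begin

text \<open>Acts on the four corner edges as a 4-cycle: the rotation of the dihedral group, with
  \<open>flip_SE\<close> as reflection.\<close>

abbreviation "turn \<equiv> rotation a b \<circ> flip_SE b"

lemma antitranspose_antitranspose: "a = b \<Longrightarrow> antitranspose a (antitranspose a e) = e"
  by (cases e) (auto simp: antitranspose_def inner_edges_def)

lemma flip_SE_flip_SE: "flip_SE b \<circ> flip_SE b = id"
  by (simp add: flip_SE_def)

lemma flip_NW_flip_NW: "flip_NW a \<circ> flip_NW a = id"
  by (simp add: flip_NW_def)

lemma rotation_o_rotation: "rotation a b \<circ> rotation a b = id"
  using rotation_rotation by auto

lemma rotation_corner:
  "rotation a b (2, 2*b-1) = (2*a, 3)" "rotation a b (3, 2*b) = (2*a-1, 2)"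
  "rotation a b (2*a, 3) = (2, 2*b-1)" "rotation a b (2*a-1, 2) = (3, 2*b)"
  using a2 b2 by (auto simp: rotation_def inner_edges_def)

lemma antitranspose_corner:
  assumes "a = b"
  shows "antitranspose a (2, 2*b-1) = (3, 2*b)" "antitranspose a (3, 2*b) = (2, 2*b-1)"
  using a2 assms by (auto simp: antitranspose_def inner_edges_def)

lemma fixes_outer:
  "rotation a b (1, 2) = (1, 2)" "rotation a b (2*a, 2*b+1) = (2*a, 2*b+1)"
  "flip_SE b (1, 2) = (1, 2)" "flip_SE b (2*a, 2*b+1) = (2*a, 2*b+1)"
  "a = b \<Longrightarrow> antitranspose a (1, 2) = (1, 2)" "a = b \<Longrightarrow> antitranspose a (2*a, 2*b+1) = (2*a, 2*b+1)"
  using a2 b2 by (auto simp: rotation_def flip_SE_def antitranspose_def inner_edges_def Transposition.transpose_def)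

text \<open>The half turn exchanges the two corner pairs, hence conjugates one flip into the
  other.\<close>

lemma rotation_o_flip_SE: "rotation a b \<circ> flip_SE b = flip_NW a \<circ> rotation a b"
  unfolding flip_SE_def flip_NW_def
  by (subst involution_conj_transpose [OF rotation_rotation])
     (simp only: rotation_corner transpose_commute)

lemma flips_commute: "flip_SE b \<circ> flip_NW a = flip_NW a \<circ> flip_SE b"
proof -
  have "flip_SE b (2*a-1, 2) = (2*a-1, 2)" "flip_SE b (2*a, 3) = (2*a, 3)"
    unfolding flip_SE_def using a2 b2 by (auto simp: Transposition.transpose_def)
  moreover have "flip_SE b (flip_SE b e) = e" for e
    by (simp add: flip_SE_def)
  ultimately show ?thesis
    using involution_conj_transpose [of "flip_SE b" "(2*a-1, 2)" "(2*a, 3)"] by (simp add: flip_NW_def)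
qed

lemma outer_swap_commutes:
  "rotation a b \<circ> outer_swap a b = outer_swap a b \<circ> rotation a b"
  "flip_SE b \<circ> outer_swap a b = outer_swap a b \<circ> flip_SE b"
  "a = b \<Longrightarrow> antitranspose a \<circ> outer_swap a b = outer_swap a b \<circ> antitranspose a"
proof -
  have *: "f \<circ> outer_swap a b = outer_swap a b \<circ> f"
    if "\<And>e. f (f e) = e" "f (1, 2) = (1, 2)" "f (2*a, 2*b+1) = (2*a, 2*b+1)" for f
    using involution_conj_transpose [of f "(1, 2)" "(2*a, 2*b+1)"] that by (simp only: outer_swap_def)
  show "rotation a b \<circ> outer_swap a b = outer_swap a b \<circ> rotation a b"
    by (rule * [OF rotation_rotation fixes_outer(1,2)])
  show "flip_SE b \<circ> outer_swap a b = outer_swap a b \<circ> flip_SE b"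
    using * [OF _ fixes_outer(3,4)] by (simp add: flip_SE_def)
  show "antitranspose a \<circ> outer_swap a b = outer_swap a b \<circ> antitranspose a" if "a = b"
    by (rule * [OF antitranspose_antitranspose [OF that] fixes_outer(5) [OF that] fixes_outer(6) [OF that]])
qed

lemma antitranspose_commutes:
  assumes "a = b"
  shows "rotation a b \<circ> antitranspose a = antitranspose a \<circ> rotation a b"
    and "flip_SE b \<circ> antitranspose a = antitranspose a \<circ> flip_SE b"
proof -
  show "rotation a b \<circ> antitranspose a = antitranspose a \<circ> rotation a b"
  proof
    fix e :: edge
    show "(rotation a b \<circ> antitranspose a) e = (antitranspose a \<circ> rotation a b) e"
      using assms by (cases e) (auto simp: rotation_def antitranspose_def inner_edges_def)
  qed
  show "flip_SE b \<circ> antitranspose a = antitranspose a \<circ> flip_SE b"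
    using involution_conj_transpose [OF antitranspose_antitranspose [OF assms], of "(2, 2*b-1)" "(3, 2*b)"]
    by (simp only: flip_SE_def antitranspose_corner [OF assms] transpose_commute [of "(3, 2*b)"])
qed

lemma turn_turn: "turn \<circ> turn = flip_NW a \<circ> flip_SE b"
proof -
  have "turn \<circ> turn = (rotation a b \<circ> flip_SE b) \<circ> rotation a b \<circ> flip_SE b"
    by (simp add: o_assoc)
  also have "\<dots> = flip_NW a \<circ> (rotation a b \<circ> rotation a b) \<circ> flip_SE b"
    unfolding rotation_o_flip_SE by (simp add: o_assoc)
  finally show ?thesis by (simp add: rotation_o_rotation)
qed

lemma turn_pow4: "turn \<circ> turn \<circ> (turn \<circ> turn) = id"
proof -
  have "turn \<circ> turn \<circ> (turn \<circ> turn) = flip_NW a \<circ> (flip_SE b \<circ> flip_NW a) \<circ> flip_SE b"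
    unfolding turn_turn by (simp add: o_assoc)
  also have "\<dots> = (flip_NW a \<circ> flip_NW a) \<circ> (flip_SE b \<circ> flip_SE b)"
    unfolding flips_commute by (simp add: o_assoc)
  finally show ?thesis by (simp add: flip_SE_flip_SE flip_NW_flip_NW)
qed

sublocale group "edge_group a b"
  by (rule group_perm_aut_group)

lemma mult_edge_group: "p \<otimes>\<^bsub>edge_group a b\<^esub> q = p \<circ> q"
  and one_edge_group: "\<one>\<^bsub>edge_group a b\<^esub> = id"
  by (simp_all add: perm_aut_group_def)

lemma turn_in: "turn \<in> carrier (edge_group a b)"
  by (rule comp_in_edge_group [OF rotation_in flip_SE_in])

definition dihedral_part :: "int \<times> bool \<Rightarrow> edge \<Rightarrow> edge" where
  "dihedral_part = (\<lambda>(k, b'). turn [^]\<^bsub>edge_group a b\<^esub> k \<otimes>\<^bsub>edge_group a b\<^esub>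
     (if b' then flip_SE b else \<one>\<^bsub>edge_group a b\<^esub>))"

lemma dihedral_part_hom: "dihedral_part \<in> hom (dihedral_group 4) (edge_group a b)"
  unfolding dihedral_part_def
proof (rule dihedral_group_hom)
  show "turn [^]\<^bsub>edge_group a b\<^esub> int 4 = \<one>\<^bsub>edge_group a b\<^esub>"
    using turn_pow4 turn_in by (simp only: int_pow_int numeral_eq_Suc pred_numeral_simps nat_pow_Suc nat_pow_0 
      mult_edge_group one_edge_group id_o Num.eval_nat_numeral BitM.simps One_nat_def) (simp add: o_assoc)
  have "turn \<otimes>\<^bsub>edge_group a b\<^esub> (flip_SE b \<circ> rotation a b) = \<one>\<^bsub>edge_group a b\<^esub>"
    unfolding mult_edge_group one_edge_group
    by (metis comp_assoc comp_id flip_SE_flip_SE rotation_o_rotation)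
  then have "inv\<^bsub>edge_group a b\<^esub> turn = flip_SE b \<circ> rotation a b"
    using inv_equality inv_comm turn_in comp_in_edge_group [OF flip_SE_in rotation_in] by blast
  then show "flip_SE b \<otimes>\<^bsub>edge_group a b\<^esub> turn = inv\<^bsub>edge_group a b\<^esub> turn \<otimes>\<^bsub>edge_group a b\<^esub> flip_SE b"
    by (simp add: mult_edge_group o_assoc)
qed (simp_all add: turn_in flip_SE_in mult_edge_group one_edge_group flip_SE_flip_SE)

lemma dihedral_part_cases:
  assumes "x \<in> carrier (dihedral_group 4)"
  obtains k b' where "x = (k, b')" "k \<in> {0, 1, 2, 3}"
    "dihedral_part x = (turn ^^ nat k) \<circ> (if b' then flip_SE b else id)"
proof -
  obtain k b' where x: "x = (k, b')" by (cases x)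
  have k: "0 \<le> k" "k < 4" using assms x by (auto simp: dihedral_group_def)
  have pow: "turn [^]\<^bsub>edge_group a b\<^esub> (n::nat) = turn ^^ n" for n
    by (induction n) (simp_all add: mult_edge_group one_edge_group funpow_Suc_right del: funpow.simps(2))
  have "dihedral_part x = (turn ^^ nat k) \<circ> (if b' then flip_SE b else id)"
    using k pow [of "nat k"] by (simp add: dihedral_part_def x pow_nat mult_edge_group one_edge_group)
  moreover have "k \<in> {0, 1, 2, 3}" using k by auto
  ultimately show ?thesis using that x by blast
qed

lemma dihedral_part_commutes:
  assumes x: "x \<in> carrier (dihedral_group 4)" and z: "z \<in> carrier (edge_group a b)"
    and comm: "rotation a b \<circ> z = z \<circ> rotation a b" "flip_SE b \<circ> z = z \<circ> flip_SE b"
  shows "dihedral_part x \<otimes>\<^bsub>edge_group a b\<^esub> z = z \<otimes>\<^bsub>edge_group a b\<^esub> dihedral_part x"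
proof -
  obtain k b' where kb: "x = (k, b')" by (cases x)
  then have "0 \<le> k" using x by (simp add: dihedral_group_def)
  have "turn \<otimes>\<^bsub>edge_group a b\<^esub> z = z \<otimes>\<^bsub>edge_group a b\<^esub> turn"
    using commutes_mult [of "rotation a b" z "flip_SE b"] comm z rotation_in flip_SE_in
    by (simp add: mult_edge_group)
  then show ?thesis
    unfolding dihedral_part_def kb prod.case
    using \<open>0 \<le> k\<close> z turn_in flip_SE_in comm one_closed [unfolded one_edge_group]
    by (intro commutes_mult commutes_int_pow) (auto simp: mult_edge_group one_edge_group)
qed

lemma dihedral_part_fixes_outer:
  assumes "x \<in> carrier (dihedral_group 4)"
  shows "dihedral_part x (1, 2) = (1, 2)"
proof -
  obtain k b' where x: "dihedral_part x = (turn ^^ nat k) \<circ> (if b' then flip_SE b else id)"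
    using dihedral_part_cases [OF assms] by metis
  have "(turn ^^ n) (1, 2) = (1, 2)" for n
    by (induction n) (simp_all add: fixes_outer [simplified])
  then show ?thesis by (simp add: x fixes_outer [simplified])
qed

text \<open>\<open>flip_SE\<close> fixes \<open>(2*a-1, 2)\<close> and \<open>turn\<close> moves it
  through four distinct edges, so its image reveals \<open>k\<close>; then \<open>(2, 2*b-1)\<close>
  reveals \<open>b'\<close>.\<close>

lemma dihedral_part_eq_id:
  assumes x: "x \<in> carrier (dihedral_group 4)" and "dihedral_part x = id"
  shows "x = \<one>\<^bsub>dihedral_group 4\<^esub>"
proof -
  obtain k b' where kb: "x = (k, b')" "k \<in> {0, 1, 2, 3}"
    "dihedral_part x = (turn ^^ nat k) \<circ> (if b' then flip_SE b else id)"
    using dihedral_part_cases [OF x] by metis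
  have SE: "flip_SE b (2*a-1, 2) = (2*a-1, 2)" "flip_SE b (2*a, 3) = (2*a, 3)"
      "flip_SE b (2, 2*b-1) = (3, 2*b)" "flip_SE b (3, 2*b) = (2, 2*b-1)"
    unfolding flip_SE_def using a2 b2 by (auto simp: Transposition.transpose_def)
  have turn: "turn (2*a-1, 2) = (3, 2*b)" "turn (3, 2*b) = (2*a, 3)" "turn (2*a, 3) = (2, 2*b-1)"
    by (simp_all only: o_def SE rotation_corner)
  have "(turn ^^ nat k) (2*a-1, 2) = (2*a-1, 2)"
    using fun_cong [OF assms(2), of "(2*a-1, 2)"] unfolding kb(3)
    by (cases b') (simp_all only: o_def if_True if_False SE id_def)
  moreover have "(turn ^^ 1) (2*a-1, 2) = (3, 2*b)" "(turn ^^ 2) (2*a-1, 2) = (2*a, 3)"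
      "(turn ^^ 3) (2*a-1, 2) = (2, 2*b-1)"
    by (rule funpow_orbit [OF turn])+
  moreover have "(3, 2*b) \<noteq> (2*a-1, 2)" "(2*a, 3) \<noteq> (2*a-1, 2)" "(2, 2*b-1) \<noteq> (2*a-1, 2::nat)"
    unfolding prod.inject using a2 b2 by presburger+
  ultimately have "nat k \<noteq> 1" "nat k \<noteq> 2" "nat k \<noteq> 3" by metis+
  then have "k = 0" using kb(2) by auto
  then have "(if b' then flip_SE b else id) (2, 2*b-1) = (2, 2*b-1)"
    using fun_cong [OF assms(2), of "(2, 2*b-1)"] unfolding kb(3) by simp
  then have "\<not> b'" using SE(3) by (cases b') simp_all
  then show ?thesis using \<open>k = 0\<close> kb(1) by (simp add: dihedral_group_def)
qed

text \<open>\<open>flip_NW\<close> is a conjugate of \<open>flip_SE\<close>, so all generators lie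
  in \<open>H\<close>, and a subgroup satisfies the rule \<open>cancel\<close>.\<close>

lemma subgroup_eq_carrier:
  assumes H: "subgroup H (edge_group a b)"
    and gens: "rotation a b \<in> H" "flip_SE b \<in> H" "outer_swap a b \<in> H" "a = b \<Longrightarrow> antitranspose a \<in> H"
  shows "H = carrier (edge_group a b)"
proof -
  interpret H: subgroup H "edge_group a b" by (rule H)
  have "flip_NW a = rotation a b \<circ> flip_SE b \<circ> rotation a b"
    unfolding rotation_o_flip_SE comp_assoc rotation_o_rotation by simp
  then have "flip_NW a \<in> H"
    using H.m_closed gens(1,2) by (simp add: mult_edge_group)
  then have gensH: "g \<in> H" if "g \<in> generators a b" for g
    using that gens by (auto simp: generators_def split: if_splits)
  interpret closed_under_generators a b H
  proof
    show "id \<in> H" using H.one_closed by (simp add: one_edge_group)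
    fix g x assume g: "g \<in> generators a b" and x: "x \<in> carrier (edge_group a b)" "g \<circ> x \<in> H"
    have "inv\<^bsub>edge_group a b\<^esub> g \<otimes>\<^bsub>edge_group a b\<^esub> (g \<otimes>\<^bsub>edge_group a b\<^esub> x) = x"
      using generators_in [OF g] x(1) by (simp add: m_assoc [symmetric])
    then show "x \<in> H"
      using H.m_closed [OF H.m_inv_closed [OF gensH [OF g]] x(2)] by (simp add: mult_edge_group)
  qed
  show ?thesis using edge_group_mem H.subset by blast
qed

end

section \<open>The two isomorphisms\<close>

lemma funpow_closed: "f ` A \<subseteq> A \<Longrightarrow> x \<in> A \<Longrightarrow> (f ^^ n) x \<in> A"
  by (induction n) auto

context grid
begin

definition swap_part :: "int \<Rightarrow> edge \<Rightarrow> edge" where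
  "swap_part c = outer_swap a b [^]\<^bsub>edge_group a b\<^esub> c"

lemma swap_part_hom: "swap_part \<in> hom Z2 (edge_group a b)"
proof -
  have "outer_swap a b [^]\<^bsub>edge_group a b\<^esub> (int 2) = \<one>\<^bsub>edge_group a b\<^esub>"
    unfolding int_pow_int by (simp add: numeral_2_eq_2 mult_edge_group one_edge_group outer_swap_def)
  from integer_mod_group_hom [OF outer_swap_in this] show ?thesis
    unfolding swap_part_def .
qed

lemma swap_part_cases:
  assumes "c \<in> carrier Z2"
  shows "c = 0 \<and> swap_part c = id \<or> c = 1 \<and> swap_part c = outer_swap a b"
proof -
  have "c = 0 \<or> c = 1" using assms by (auto simp: carrier_integer_mod_group)
  then show ?thesis using outer_swap_in by (auto simp: swap_part_def one_edge_group)
qed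

lemma dihedral_part_1: "dihedral_part (1, True) = rotation a b"
proof -
  have "turn \<circ> flip_SE b = rotation a b"
    by (simp add: comp_assoc flip_SE_flip_SE)
  then show ?thesis
    using turn_in by (simp add: dihedral_part_def mult_edge_group)
qed

lemma dihedral_part_0: "dihedral_part (0, True) = flip_SE b" "dihedral_part (0, False) = id"
  using flip_SE_in by (simp_all add: dihedral_part_def mult_edge_group one_edge_group)

lemma outer_swap_apply: "outer_swap a b (1, 2) \<noteq> (1, 2)"
  by (auto simp: outer_swap_def)

text \<open>The dihedral part fixes the outer edge \<open>(1, 2)\<close> and the swap moves it, so
  the two factors are read off separately.\<close>

lemma dihedral_swap_eq_id:
  assumes x: "x \<in> carrier (dihedral_group 4)" and c: "c \<in> carrier Z2"
    and eq: "dihedral_part x \<circ> swap_part c = id"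
  shows "x = \<one>\<^bsub>dihedral_group 4\<^esub> \<and> c = 0"
proof -
  have "swap_part c \<circ> dihedral_part x = id"
    using eq swap_part_cases [OF c]
      dihedral_part_commutes [OF x outer_swap_in outer_swap_commutes(1,2)]
    by (auto simp: mult_edge_group)
  then have "swap_part c (dihedral_part x (1, 2)) = (1, 2)"
    by (metis comp_apply id_apply)
  then have "swap_part c (1, 2) = (1, 2)"
    using dihedral_part_fixes_outer [OF x] by simp
  then have "c = 0" "swap_part c = id"
    using swap_part_cases [OF c] outer_swap_apply by auto
  then show ?thesis
    using dihedral_part_eq_id [OF x] eq by simp
qed

lemma group_dihedral_Z2: "group (dihedral_group 4 \<times>\<times> Z2)"
  by (intro DirProd_group group_dihedral_group) simp_all

lemma edge_group_iso_small:
  assumes ab: "a = 2" "b = 2"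
  shows "dihedral_group 4 \<times>\<times> Z2 \<cong> edge_group a b"
proof -
  let ?G = "edge_group a b"
  define \<Phi> where "\<Phi> = (\<lambda>(x, c). dihedral_part x \<otimes>\<^bsub>?G\<^esub> swap_part c)"
  have hom: "\<Phi> \<in> hom (dihedral_group 4 \<times>\<times> Z2) ?G"
    unfolding \<Phi>_def
  proof (rule DirProd_hom [OF dihedral_part_hom swap_part_hom])
    fix x c assume x: "x \<in> carrier (dihedral_group 4)" and c: "c \<in> carrier Z2"
    show "dihedral_part x \<otimes>\<^bsub>?G\<^esub> swap_part c = swap_part c \<otimes>\<^bsub>?G\<^esub> dihedral_part x"
      using swap_part_cases [OF c] dihedral_part_commutes [OF x outer_swap_in outer_swap_commutes(1,2)]
      by (auto simp: mult_edge_group)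
  qed
  interpret group_hom "dihedral_group 4 \<times>\<times> Z2" ?G \<Phi>
    using hom group_dihedral_Z2 group_perm_aut_group by (simp add: group_hom_def group_hom_axioms_def)
  have "\<Phi> ` carrier (dihedral_group 4 \<times>\<times> Z2) = carrier ?G"
  proof (rule subgroup_eq_carrier [OF img_is_subgroup])
    have rot: "\<Phi> ((1, True), 0) = rotation a b" and SE: "\<Phi> ((0, True), 0) = flip_SE b"
      and swap: "\<Phi> ((0, False), 1) = outer_swap a b"
      using outer_swap_in by (simp_all add: \<Phi>_def dihedral_part_1 dihedral_part_0 swap_part_def
          mult_edge_group one_edge_group)
    have mem: "((1, True), 0) \<in> carrier (dihedral_group 4 \<times>\<times> Z2)" "((0, True), 0) \<in> carrier (dihedral_group 4 \<times>\<times> Z2)"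
        "((0, False), 1) \<in> carrier (dihedral_group 4 \<times>\<times> Z2)"
      by (auto simp: dihedral_group_def)
    show 1: "rotation a b \<in> \<Phi> ` carrier (dihedral_group 4 \<times>\<times> Z2)"
      using rot mem(1) by (metis image_eqI)
    show 2: "flip_SE b \<in> \<Phi> ` carrier (dihedral_group 4 \<times>\<times> Z2)"
      using SE mem(2) by (metis image_eqI)
    show "outer_swap a b \<in> \<Phi> ` carrier (dihedral_group 4 \<times>\<times> Z2)"
      using swap mem(3) by (metis image_eqI)
    interpret im: subgroup "\<Phi> ` carrier (dihedral_group 4 \<times>\<times> Z2)" ?G
      by (rule img_is_subgroup)
    \<comment> \<open>On a single square the antitransposition is the product of the two flips.\<close>
    have "antitranspose a e = flip_SE b (flip_NW a e)" for e
    proof (cases "e \<in> {(2, 3), (3, 2), (3, 4), (4, 3)}")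
      case True
      then show ?thesis using ab
        by (auto simp: antitranspose_def inner_edges_def flip_SE_def flip_NW_def Transposition.transpose_def)
    next
      case False
      obtain u v where e: "e = (u, v)" by (cases e)
      have "e \<notin> I"
      proof
        assume "e \<in> I"
        then have "u \<in> {2, 3, 4}" "v \<in> {2, 3, 4}" "odd (u + v)"
          using ab e by (auto simp: inner_edges_def)
        then show False using False e by auto
      qed
      then show ?thesis
        using False ab by (auto simp: antitranspose_def flip_SE_def flip_NW_def Transposition.transpose_def)
    qed
    moreover have "flip_NW a = rotation a b \<circ> (flip_SE b \<circ> rotation a b)"
      unfolding comp_assoc [symmetric] rotation_o_flip_SE by (simp add: comp_assoc rotation_o_rotation)
    ultimately have "antitranspose a = flip_SE b \<circ> (rotation a b \<circ> (flip_SE b \<circ> rotation a b))"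
      by (auto simp: fun_eq_iff)
    then show "antitranspose a \<in> \<Phi> ` carrier (dihedral_group 4 \<times>\<times> Z2)"
      using 1 2 im.m_closed by (simp add: mult_edge_group)
  qed
  moreover have "z = \<one>\<^bsub>dihedral_group 4 \<times>\<times> Z2\<^esub>"
    if "z \<in> carrier (dihedral_group 4 \<times>\<times> Z2)" "\<Phi> z = \<one>\<^bsub>?G\<^esub>" for z
    using that dihedral_swap_eq_id [of "fst z" "snd z"]
    by (cases z) (auto simp: \<Phi>_def mult_edge_group one_edge_group)
  ultimately have "\<Phi> \<in> iso (dihedral_group 4 \<times>\<times> Z2) ?G"
    unfolding iso_iff by blast
  then show ?thesis by (rule is_isoI)
qed

text \<open>For \<open>a \<noteq> 2\<close> the flip does not touch this edge at the highest corner,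
  so only the half turn moves it. The antitransposition sends it to \<open>(2, 3)\<close> and
  therefore is not in the dihedral part.\<close>

lemma dihedral_part_corner_orbit:
  assumes x: "x \<in> carrier (dihedral_group 4)" and ab: "a = b" "a \<noteq> 2"
  shows "dihedral_part x (2*a-1, 2*a) \<in> {(2*a-1, 2*a), (3, 2)}"
proof -
  obtain k b' where kb: "dihedral_part x = (turn ^^ nat k) \<circ> (if b' then flip_SE b else id)"
    using dihedral_part_cases [OF x] by metis
  have SE: "flip_SE b (2*a-1, 2*a) = (2*a-1, 2*a)" "flip_SE b (3, 2) = (3, 2)"
    unfolding flip_SE_def using a2 b2 ab by (auto simp: Transposition.transpose_def)
  have rot: "rotation a b (2*a-1, 2*a) = (3, 2)" "rotation a b (3, 2) = (2*a-1, 2*a)"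
    using a2 ab by (auto simp: rotation_def inner_edges_def)
  have "turn ` {(2*a-1, 2*a), (3, 2)} \<subseteq> {(2*a-1, 2*a), (3, 2)}"
    unfolding image_insert image_empty o_apply SE rot by blast
  then have "(turn ^^ n) (2*a-1, 2*a) \<in> {(2*a-1, 2*a), (3, 2)}" for n
    by (rule funpow_closed) simp
  then show ?thesis
    unfolding kb by (cases b') (simp_all only: o_apply if_True if_False SE id_apply)
qed

lemma edge_group_iso_general:
  assumes ab: "\<not> (a = 2 \<and> b = 2)" and d: "d = (if a = b then 1 else 0)"
  shows "dihedral_group 4 \<times>\<times> Z2 \<times>\<times> Z2_power d \<cong> edge_group a b"
proof -
  let ?G = "edge_group a b" and ?D = "dihedral_group 4 \<times>\<times> Z2 \<times>\<times> Z2_power d"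
  \<comment> \<open>With \<open>q = id\<close> for \<open>a \<noteq> b\<close> both values of
    \<open>d\<close> are treated together.\<close>
  define q where "q = (if a = b then antitranspose a else id)"
  define \<psi> where "\<psi> = (\<lambda>w :: nat \<Rightarrow> int. if d = 0 then \<one>\<^bsub>?G\<^esub> else q [^]\<^bsub>?G\<^esub> w 0)"
  define \<Phi> where "\<Phi> = (\<lambda>(x, y). dihedral_part x \<otimes>\<^bsub>?G\<^esub> (case y of (c, w) \<Rightarrow> swap_part c \<otimes>\<^bsub>?G\<^esub> \<psi> w))"
  have q_in: "q \<in> carrier ?G"
    using antitranspose_in one_closed [unfolded one_edge_group] by (simp add: q_def)
  have q2: "q \<otimes>\<^bsub>?G\<^esub> q = \<one>\<^bsub>?G\<^esub>"
    using antitranspose_antitranspose by (auto simp: q_def mult_edge_group one_edge_group)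
  have q_comm: "rotation a b \<circ> q = q \<circ> rotation a b" "flip_SE b \<circ> q = q \<circ> flip_SE b"
     "outer_swap a b \<circ> q = q \<circ> outer_swap a b"
    using antitranspose_commutes outer_swap_commutes(3) by (simp_all add: q_def)
  have \<psi>_hom: "\<psi> \<in> hom (Z2_power d) ?G"
    unfolding \<psi>_def by (rule Z2_power_hom [OF q_in q2])
  have \<psi>_cases: "w = \<one>\<^bsub>Z2_power d\<^esub> \<and> \<psi> w = id \<or> a = b \<and> \<psi> w = q" if w: "w \<in> carrier (Z2_power d)" for w
  proof (cases "d = 0")
    case True
    then show ?thesis using w by (auto simp: \<psi>_def one_edge_group)
  next
    case False
    then have d1: "d = 1" "a = b" using d by (auto split: if_splits)
    then have "0 \<le> w 0" "w 0 < 2" using w by (auto simp: carrier_integer_mod_group PiE_iff)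
    then have "w 0 = 0 \<or> w 0 = 1" by linarith
    then show ?thesis
    proof
      assume "w 0 = 0"
      moreover from this have "w = \<one>\<^bsub>Z2_power d\<^esub>"
        using w d1 by (auto simp: fun_eq_iff PiE_iff extensional_def restrict_def)
      ultimately show ?thesis by (simp add: \<psi>_def one_edge_group)
    next
      assume "w 0 = 1"
      then have "\<psi> w = q" using d1(1) q_in by (simp add: \<psi>_def)
      then show ?thesis using d1(2) by blast
    qed
  qed
  have sw_hom: "(\<lambda>(c, w). swap_part c \<otimes>\<^bsub>?G\<^esub> \<psi> w) \<in> hom (Z2 \<times>\<times> Z2_power d) ?G"
  proof (rule DirProd_hom [OF swap_part_hom \<psi>_hom])
    fix c w assume c: "c \<in> carrier Z2" and w: "w \<in> carrier (Z2_power d)"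
    show "swap_part c \<otimes>\<^bsub>?G\<^esub> \<psi> w = \<psi> w \<otimes>\<^bsub>?G\<^esub> swap_part c"
      using swap_part_cases [OF c] \<psi>_cases [OF w] q_comm(3) unfolding mult_edge_group
      by (elim disjE conjE) simp_all
  qed
  have hom: "\<Phi> \<in> hom ?D ?G"
    unfolding \<Phi>_def
  proof (rule DirProd_hom [OF dihedral_part_hom sw_hom])
    fix x y assume x: "x \<in> carrier (dihedral_group 4)" and y: "y \<in> carrier (Z2 \<times>\<times> Z2_power d)"
    obtain c w where cw: "y = (c, w)" "c \<in> carrier Z2" "w \<in> carrier (Z2_power d)"
      using y by (cases y) auto
    have in_G: "dihedral_part x \<in> carrier ?G" "swap_part c \<in> carrier ?G" "\<psi> w \<in> carrier ?G"
      using dihedral_part_hom swap_part_hom \<psi>_hom x cw by (auto simp: hom_def)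
    have 1: "swap_part c \<otimes>\<^bsub>?G\<^esub> dihedral_part x = dihedral_part x \<otimes>\<^bsub>?G\<^esub> swap_part c"
      using swap_part_cases [OF cw(2)] dihedral_part_commutes [OF x outer_swap_in outer_swap_commutes(1,2)]
      unfolding mult_edge_group by (elim disjE conjE) simp_all
    have 2: "\<psi> w \<otimes>\<^bsub>?G\<^esub> dihedral_part x = dihedral_part x \<otimes>\<^bsub>?G\<^esub> \<psi> w"
      using \<psi>_cases [OF cw(3)] dihedral_part_commutes [OF x q_in q_comm(1,2)]
      unfolding mult_edge_group by (elim disjE conjE) simp_all
    show "dihedral_part x \<otimes>\<^bsub>?G\<^esub> (case y of (c, w) \<Rightarrow> swap_part c \<otimes>\<^bsub>?G\<^esub> \<psi> w) =
        (case y of (c, w) \<Rightarrow> swap_part c \<otimes>\<^bsub>?G\<^esub> \<psi> w) \<otimes>\<^bsub>?G\<^esub> dihedral_part x"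
      using commutes_mult [OF 1 2 in_G(2,3,1)] by (simp add: cw(1))
  qed
  have "group ?D"
    by (intro DirProd_group group_dihedral_group) simp_all
  then interpret group_hom ?D ?G \<Phi>
    using hom group_perm_aut_group by (simp add: group_hom_def group_hom_axioms_def)
  \<comment> \<open>\<open>w1\<close> is restricted to the index set because members of the product
    group are extensional; for \<open>d = 1\<close> it generates the last factor.\<close>
  define w0 w1 where "w0 = \<one>\<^bsub>Z2_power d\<^esub>" and "w1 = (\<lambda>i\<in>{..<d}. 1 :: int)"
  have w_in: "w0 \<in> carrier (Z2_power d)" "w1 \<in> carrier (Z2_power d)"
    by (auto simp: w0_def w1_def)
  have "\<psi> w0 = id"
    using q_in by (simp add: \<psi>_def w0_def one_edge_group)
  have "\<psi> w1 = q" if "a = b"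
  proof -
    have "d = 1" using that d by simp
    then show ?thesis using q_in by (simp add: \<psi>_def w1_def)
  qed
  have "\<Phi> ` carrier ?D = carrier ?G"
  proof (rule subgroup_eq_carrier [OF img_is_subgroup])
    have "\<Phi> ((1, True), 0, w0) = rotation a b" "\<Phi> ((0, True), 0, w0) = flip_SE b"
      "\<Phi> ((0, False), 1, w0) = outer_swap a b"
      using outer_swap_in \<open>\<psi> w0 = id\<close> by (simp_all add: \<Phi>_def dihedral_part_1 dihedral_part_0 swap_part_def
          mult_edge_group one_edge_group)
    moreover have "((1, True), 0, w0) \<in> carrier ?D" "((0, True), 0, w0) \<in> carrier ?D"
        "((0, False), 1, w0) \<in> carrier ?D"
      using w_in by (auto simp: dihedral_group_def)
    ultimately show "rotation a b \<in> \<Phi> ` carrier ?D" "flip_SE b \<in> \<Phi> ` carrier ?D" "outer_swap a b \<in> \<Phi> ` carrier ?D"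
      by (metis image_eqI)+
    assume "a = b"
    then have "\<psi> w1 = antitranspose a"
      using \<open>a = b \<Longrightarrow> \<psi> w1 = q\<close> by (simp add: q_def)
    then have "\<Phi> ((0, False), 0, w1) = antitranspose a"
      by (simp add: \<Phi>_def dihedral_part_0 swap_part_def mult_edge_group one_edge_group)
    moreover have "((0, False), 0, w1) \<in> carrier ?D"
      using w_in by (auto simp: dihedral_group_def)
    ultimately show "antitranspose a \<in> \<Phi> ` carrier ?D"
      by (metis image_eqI)
  qed
  moreover have "z = \<one>\<^bsub>?D\<^esub>" if z: "z \<in> carrier ?D" "\<Phi> z = \<one>\<^bsub>?G\<^esub>" for z
  proof -
    obtain x c w where xcw: "z = (x, c, w)" by (metis prod.exhaust)
    have mem: "x \<in> carrier (dihedral_group 4)" "c \<in> carrier Z2" "w \<in> carrier (Z2_power d)"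
      using z xcw by auto
    have eq: "dihedral_part x \<circ> (swap_part c \<circ> \<psi> w) = id"
      using z(2) by (simp add: xcw \<Phi>_def mult_edge_group one_edge_group)
    \<comment> \<open>Otherwise \<open>\<psi> w\<close> is the antitransposition. It sends
      \<open>(2, 3)\<close> to \<open>(2*a-1, 2*a)\<close>, which the swap fixes and the dihedral
      part cannot send back.\<close>
    have "w = \<one>\<^bsub>Z2_power d\<^esub> \<and> \<psi> w = id"
    proof (rule ccontr)
      assume "\<not> ?thesis"
      then have ab': "a = b" "\<psi> w = antitranspose a" using \<psi>_cases [OF mem(3)] by (auto simp: q_def)
      then have "a \<noteq> 2" using ab by simp
      have 1: "antitranspose a (2, 3) = (2*a-1, 2*a)"
        using ab' a2 by (auto simp: antitranspose_def inner_edges_def)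
      have 2: "swap_part c (2*a-1, 2*a) = (2*a-1, 2*a)"
        using swap_part_cases [OF mem(2)] a2 ab'(1) by (auto simp: outer_swap_def Transposition.transpose_def)
      have "dihedral_part x (2*a-1, 2*a) = (2, 3)"
        using fun_cong [OF eq, of "(2, 3)"] by (simp only: o_apply ab'(2) 1 2 id_apply)
      then have "(2, 3) \<in> {(2*a-1, 2*a), (3, 2::nat)}"
        using dihedral_part_corner_orbit [OF mem(1) ab'(1) \<open>a \<noteq> 2\<close>] by simp
      then show False using a2 by auto
    qed
    then have w: "w = \<one>\<^bsub>Z2_power d\<^esub>" "dihedral_part x \<circ> swap_part c = id"
      using eq by auto
    from dihedral_swap_eq_id [OF mem(1,2) w(2)] show ?thesis
      by (simp add: xcw w(1))
  qed
  ultimately have "\<Phi> \<in> iso ?D ?G"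
    unfolding iso_iff by blast
  then show ?thesis by (rule is_isoI)
qed

end

theorem theorem1p2:
  fixes a1 a2 :: nat
  assumes "a1 \<ge> 2" and "a2 \<ge> 2"
  defines "lam \<equiv> replicate a1 1 @ replicate a2 2"
  defines "\<delta> \<equiv> (if a1 = a2 then 1 else 0)"
  shows "(a1 = 2 \<and> a2 = 2 \<longrightarrow>
            combinatorial_aut_group (GT_polytope lam) \<cong> dihedral_group 4 \<times>\<times> Z2) \<and>
         (\<not> (a1 = 2 \<and> a2 = 2) \<longrightarrow>
            combinatorial_aut_group (GT_polytope lam)
              \<cong> dihedral_group 4 \<times>\<times> Z2 \<times>\<times> Z2_power \<delta>)"
proof -
  \<comment> \<open>The rows of the grid come from the twos and the columns from the ones, hence the
    reversed parameters.\<close>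
  interpret grid a2 a1
    using assms(1,2) by unfold_locales
  have *: "edge_group a2 a1 \<cong> combinatorial_aut_group (GT_polytope lam)"
    unfolding lam_def using assms(1,2) by (intro GT_aut_group_iso) auto
  have "group (dihedral_group 4 \<times>\<times> Z2 \<times>\<times> Z2_power \<delta>)"
    by (intro DirProd_group group_dihedral_group) simp_all
  moreover have "\<delta> = (if a2 = a1 then 1 else 0)"
    by (simp add: \<delta>_def)
  ultimately show ?thesis
    using group.iso_sym [OF group_dihedral_Z2 iso_trans [OF edge_group_iso_small *]]
      group.iso_sym [OF _ iso_trans [OF edge_group_iso_general *]] by blast
qed

end
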